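(* Let $M$ be a complex manifold of dimension $2n+1$ and $S \subset M$ a closed subset of complex codimension 2 or more. Then every holomorphic contact structure on $M \setminus S$ extends to a holomorphic contact structure on $M$.
   Context: A subset $S$ of a complex manifold $M$ is of complex codimension 2 or more if every $s \in S$ has an open neighbourhood $U_s \subset M$ such that $S \cap U_s$ is contained in a complex analytic subvariety of $U_s$ of complex codimension at least 2. A hyperplane field on a complex manifold $N$ is a holomorphic line subbundle $L \subset T^*N$ of the holomorphic cotangent bundle. If $\dim N = 2n+1$, the hyperplane field $L$ is a contact structure if every local nowhere vanishing holomorphic section $\alpha$ of $L$ satisfies $\alpha \wedge (d\alpha)^n \neq 0$ at every point. A contact structure $L \subset T^*(M \setminus S)$ extends to $M$ if there is a contact structure $L' \subset T^*M$ with $L'|_{M \setminus S} = L$. *)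

theory Defs
  imports "HOL-Analysis.Analysis"
begin

section \<open>Complex manifolds\<close>

text \<open>
  The model space of a complex manifold of dimension \<open>m\<close> is \<open>complex ^ 'm\<close> with \<open>CARD('m) = m\<close>.
  Holomorphy in several variables is complex Frechet differentiability at every point of an open set.
\<close>

definition holo :: "(complex ^ 'm::finite \<Rightarrow> complex) \<Rightarrow> (complex ^ 'm) set \<Rightarrow> bool" where
  "holo f U \<longleftrightarrow> open U \<and>
     (\<forall>z\<in>U. \<exists>f'. (f has_derivative f') (at z) \<and> (\<forall>c v. f' (c *s v) = c * f' v))"

type_synonym ('a, 'm) chart = "'a set \<times> ('a \<Rightarrow> complex ^ 'm)"

record ('a, 'm) cmfd =
  top_of :: "'a topology"
  atlas :: "('a, 'm::finite) chart set"

abbreviation points :: "('a, 'm::finite) cmfd \<Rightarrow> 'a set" where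
  "points M \<equiv> topspace (top_of M)"

definition is_chart :: "'a topology \<Rightarrow> ('a, 'm::finite) chart \<Rightarrow> bool" where
  "is_chart X = (\<lambda>(V, \<phi>). openin X V \<and> open (\<phi> ` V) \<and>
     homeomorphic_map (subtopology X V) (top_of_set (\<phi> ` V)) \<phi>)"

definition compatible :: "('a, 'm::finite) chart \<Rightarrow> ('a, 'm) chart \<Rightarrow> bool" where
  "compatible = (\<lambda>(V, \<phi>) (W, \<psi>).
     (\<forall>i. holo (\<lambda>z. \<psi> (inv_into V \<phi> z) $ i) (\<phi> ` (V \<inter> W))) \<and>
     (\<forall>i. holo (\<lambda>z. \<phi> (inv_into W \<psi> z) $ i) (\<psi> ` (V \<inter> W))))"

definition complex_manifold :: "('a, 'm::finite) cmfd \<Rightarrow> bool" where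
  "complex_manifold M \<longleftrightarrow>
     Hausdorff_space (top_of M) \<and> second_countable (top_of M) \<and>
     (\<forall>c\<in>atlas M. is_chart (top_of M) c) \<and>
     (\<forall>c\<in>atlas M. \<forall>d\<in>atlas M. compatible c d) \<and>
     points M = (\<Union>c\<in>atlas M. fst c)"

text \<open>The maximal atlas.\<close>

definition charts :: "('a, 'm::finite) cmfd \<Rightarrow> ('a, 'm) chart set" where
  "charts M = {c. is_chart (top_of M) c \<and> (\<forall>d\<in>atlas M. compatible c d)}"

definition open_submanifold :: "('a, 'm::finite) cmfd \<Rightarrow> 'a set \<Rightarrow> ('a, 'm) cmfd" where
  "open_submanifold M U =
     \<lparr>top_of = subtopology (top_of M) U, atlas = (\<lambda>(V, \<phi>). (V \<inter> U, \<phi>)) ` atlas M\<rparr>"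

definition holo_fun :: "('a, 'm::finite) cmfd \<Rightarrow> 'a set \<Rightarrow> ('a \<Rightarrow> complex) \<Rightarrow> bool" where
  "holo_fun M W f \<longleftrightarrow> openin (top_of M) W \<and>
     (\<forall>(V, \<phi>)\<in>atlas M. holo (f \<circ> inv_into V \<phi>) (\<phi> ` (V \<inter> W)))"


section \<open>Analytic subvarieties and their codimension\<close>

definition analytic_subvariety :: "('a, 'm::finite) cmfd \<Rightarrow> 'a set \<Rightarrow> 'a set \<Rightarrow> bool" where
  "analytic_subvariety M U A \<longleftrightarrow> openin (top_of M) U \<and> A \<subseteq> U \<and>
     (\<forall>p\<in>U. \<exists>V F. openin (top_of M) V \<and> p \<in> V \<and> V \<subseteq> U \<and> finite F \<and>
        (\<forall>f\<in>F. holo_fun M V f) \<and> A \<inter> V = {x\<in>V. \<forall>f\<in>F. f x = 0})"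

text \<open>
  \<open>p\<close> is a regular point of \<open>A\<close> of codimension \<open>k\<close>: near \<open>p\<close>, the set \<open>A\<close> is a complex submanifold
  of codimension \<open>k\<close>.  As usual, the dimension of an analytic set is the largest dimension
  occurring at its regular points, so its codimension is the infimum of the codimensions at the
  regular points; it is \<open>\<infinity>\<close> exactly for the empty analytic set.
\<close>

definition regular_point ::
    "('a, 'm::finite) cmfd \<Rightarrow> 'a set \<Rightarrow> 'a \<Rightarrow> nat \<Rightarrow> bool" where
  "regular_point M A p k \<longleftrightarrow> p \<in> A \<and>
     (\<exists>(V, \<phi>)\<in>charts M. \<exists>J. p \<in> V \<and> card J = k \<and> A \<inter> V = {x\<in>V. \<forall>i\<in>J. \<phi> x $ i = 0})"

definition codimension :: "('a, 'm::finite) cmfd \<Rightarrow> 'a set \<Rightarrow> enat" where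
  "codimension M A = Inf {enat k |k. \<exists>p. regular_point M A p k}"

definition codim_two_or_more :: "('a, 'm::finite) cmfd \<Rightarrow> 'a set \<Rightarrow> bool" where
  "codim_two_or_more M S \<longleftrightarrow>
     (\<forall>s\<in>S. \<exists>U A. openin (top_of M) U \<and> s \<in> U \<and>
        analytic_subvariety M U A \<and> codimension M A \<ge> 2 \<and> S \<inter> U \<subseteq> A)"


section \<open>The holomorphic cotangent bundle\<close>

definition holo_near :: "('a, 'm::finite) cmfd \<Rightarrow> 'a \<Rightarrow> ('a \<Rightarrow> complex) \<Rightarrow> bool" where
  "holo_near M p f \<longleftrightarrow> (\<exists>W. p \<in> W \<and> holo_fun M W f)"

text \<open>
  Holomorphic tangent vectors at \<open>p\<close> are the derivations at \<open>p\<close> of the algebra of germs of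
  holomorphic functions, and holomorphic cotangent vectors are the complex-linear functionals on
  the tangent space.  Both are set to 0 outside their proper domain.  Since they only see
  functions near \<open>p\<close>, the (co)tangent spaces of an open submanifold at its points are literally
  those of the ambient manifold; so the restriction of a subbundle to an open submanifold is
  again literally a set of cotangent vectors of that submanifold.
\<close>

type_synonym 'a tvec = "('a \<Rightarrow> complex) \<Rightarrow> complex"
type_synonym 'a covec = "'a tvec \<Rightarrow> complex"

definition tangent_space :: "('a, 'm::finite) cmfd \<Rightarrow> 'a \<Rightarrow> 'a tvec set" where
  "tangent_space M p = {v.
     (\<forall>f. \<not> holo_near M p f \<longrightarrow> v f = 0) \<and>
     (\<forall>f g. holo_near M p f \<and> holo_near M p g \<and>
        (\<exists>W. openin (top_of M) W \<and> p \<in> W \<and> (\<forall>x\<in>W. f x = g x)) \<longrightarrow> v f = v g) \<and>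
     (\<forall>f g. holo_near M p f \<and> holo_near M p g \<longrightarrow> v (\<lambda>x. f x + g x) = v f + v g) \<and>
     (\<forall>c f. holo_near M p f \<longrightarrow> v (\<lambda>x. c * f x) = c * v f) \<and>
     (\<forall>f g. holo_near M p f \<and> holo_near M p g \<longrightarrow>
        v (\<lambda>x. f x * g x) = f p * v g + g p * v f)}"

definition cotangent_space :: "('a, 'm::finite) cmfd \<Rightarrow> 'a \<Rightarrow> 'a covec set" where
  "cotangent_space M p = {\<xi>.
     (\<forall>v. v \<notin> tangent_space M p \<longrightarrow> \<xi> v = 0) \<and>
     (\<forall>v\<in>tangent_space M p. \<forall>w\<in>tangent_space M p. \<xi> (\<lambda>f. v f + w f) = \<xi> v + \<xi> w) \<and>
     (\<forall>c. \<forall>v\<in>tangent_space M p. \<xi> (\<lambda>f. c * v f) = c * \<xi> v)}"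

definition cotangent_bundle :: "('a, 'm::finite) cmfd \<Rightarrow> ('a \<times> 'a covec) set" where
  "cotangent_bundle M = (SIGMA p:points M. cotangent_space M p)"

text \<open>The coordinate vector \<open>\<partial>/\<partial>x\<^sub>i\<close> at \<open>q\<close> in the chart \<open>(V, \<phi>)\<close>.\<close>

definition coord_vec ::
    "('a, 'm::finite) cmfd \<Rightarrow> ('a, 'm) chart \<Rightarrow> 'm \<Rightarrow> 'a \<Rightarrow> 'a tvec" where
  "coord_vec M = (\<lambda>(V, \<phi>) i q f.
     if holo_near M q f
     then frechet_derivative (f \<circ> inv_into V \<phi>) (at (\<phi> q)) (axis i 1) else 0)"

text \<open>
  A 1-form \<open>\<alpha>\<close> is \<open>\<Sum>\<^sub>i a\<^sub>i dx\<^sub>i\<close> in a chart, with \<open>a\<^sub>i = \<alpha>(\<partial>/\<partial>x\<^sub>i)\<close>; it is holomorphic if all \<open>a\<^sub>i\<close> are.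
\<close>

definition coeff ::
    "('a, 'm::finite) cmfd \<Rightarrow> ('a, 'm) chart \<Rightarrow> ('a \<Rightarrow> 'a covec) \<Rightarrow> 'm \<Rightarrow> 'a \<Rightarrow> complex" where
  "coeff M c \<alpha> i q = \<alpha> q (coord_vec M c i q)"

definition holo_one_form ::
    "('a, 'm::finite) cmfd \<Rightarrow> 'a set \<Rightarrow> ('a \<Rightarrow> 'a covec) \<Rightarrow> bool" where
  "holo_one_form M W \<alpha> \<longleftrightarrow> openin (top_of M) W \<and>
     (\<forall>p\<in>W. \<alpha> p \<in> cotangent_space M p) \<and>
     (\<forall>c\<in>atlas M. \<forall>i. holo_fun M (fst c \<inter> W) (coeff M c \<alpha> i))"


section \<open>Alternating forms and the exterior derivative\<close>

text \<open>
  A \<open>k\<close>-form on a tangent space is a function of sequences \<open>v\<close> of tangent vectors that depends on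
  \<open>v 0, \<dots>, v (k - 1)\<close> only.
\<close>

type_synonym 'a form = "(nat \<Rightarrow> 'a tvec) \<Rightarrow> complex"

definition wedge :: "nat \<Rightarrow> nat \<Rightarrow> 'a form \<Rightarrow> 'a form \<Rightarrow> 'a form" where
  "wedge k l \<omega> \<eta> v =
     (\<Sum>\<sigma> | \<sigma> permutes {..<k + l}.
        of_int (sign \<sigma>) * \<omega> (\<lambda>i. v (\<sigma> i)) * \<eta> (\<lambda>i. v (\<sigma> (k + i)))) / (fact k * fact l)"

text \<open>The \<open>n\<close>-th exterior power of a 2-form.\<close>

primrec wedge_power :: "'a form \<Rightarrow> nat \<Rightarrow> 'a form" where
  "wedge_power \<omega> 0 = (\<lambda>v. 1)"
| "wedge_power \<omega> (Suc n) = wedge 2 (2 * n) \<omega> (wedge_power \<omega> n)"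

text \<open>
  \<open>d\<alpha> = \<Sum>\<^sub>i da\<^sub>i \<and> dx\<^sub>i\<close> for \<open>\<alpha> = \<Sum>\<^sub>i a\<^sub>i dx\<^sub>i\<close> in the given chart, where \<open>df(v) = v f\<close>.
  The result does not depend on the chart.
\<close>

definition ext_deriv ::
    "('a, 'm::finite) cmfd \<Rightarrow> ('a, 'm) chart \<Rightarrow> ('a \<Rightarrow> 'a covec) \<Rightarrow> 'a form" where
  "ext_deriv M c \<alpha> v =
     (\<Sum>i\<in>UNIV. v 0 (coeff M c \<alpha> i) * v 1 (\<lambda>x. snd c x $ i)
              - v 1 (coeff M c \<alpha> i) * v 0 (\<lambda>x. snd c x $ i))"

text \<open>\<open>\<alpha> \<and> (d\<alpha>)\<^sup>n \<noteq> 0\<close> at \<open>p\<close>, the exterior derivative being computed in any chart around \<open>p\<close>.\<close>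

definition contact_at ::
    "('a, 'm::finite) cmfd \<Rightarrow> nat \<Rightarrow> ('a \<Rightarrow> 'a covec) \<Rightarrow> 'a \<Rightarrow> bool" where
  "contact_at M n \<alpha> p \<longleftrightarrow> (\<forall>c\<in>atlas M. p \<in> fst c \<longrightarrow>
     (\<exists>v. (\<forall>i. v i \<in> tangent_space M p) \<and>
        wedge 1 (2 * n) (\<lambda>u. \<alpha> p (u 0)) (wedge_power (ext_deriv M c \<alpha>) n) v \<noteq> 0))"


section \<open>Contact structures\<close>

definition nonvanishing_section ::
    "('a, 'm::finite) cmfd \<Rightarrow> ('a \<times> 'a covec) set \<Rightarrow> 'a set \<Rightarrow> ('a \<Rightarrow> 'a covec) \<Rightarrow> bool" where
  "nonvanishing_section M L W \<alpha> \<longleftrightarrow> holo_one_form M W \<alpha> \<and>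
     (\<forall>p\<in>W. (p, \<alpha> p) \<in> L \<and> \<alpha> p \<noteq> (\<lambda>v. 0))"

text \<open>Holomorphic line subbundles of the cotangent bundle.\<close>

definition hyperplane_field :: "('a, 'm::finite) cmfd \<Rightarrow> ('a \<times> 'a covec) set \<Rightarrow> bool" where
  "hyperplane_field M L \<longleftrightarrow> L \<subseteq> cotangent_bundle M \<and>
     (\<forall>p\<in>points M. \<exists>W \<alpha>. p \<in> W \<and> nonvanishing_section M L W \<alpha> \<and>
        (\<forall>q\<in>W. {\<xi>. (q, \<xi>) \<in> L} = {(\<lambda>v. c * \<alpha> q v) |c. True}))"

definition contact_structure ::
    "('a, 'm::finite) cmfd \<Rightarrow> nat \<Rightarrow> ('a \<times> 'a covec) set \<Rightarrow> bool" where
  "contact_structure M n L \<longleftrightarrow> CARD('m) = 2 * n + 1 \<and> hyperplane_field M L \<and>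
     (\<forall>W \<alpha>. nonvanishing_section M L W \<alpha> \<longrightarrow> (\<forall>p\<in>W. contact_at M n \<alpha> p))"

definition restrict_bundle :: "('a \<times> 'a covec) set \<Rightarrow> 'a set \<Rightarrow> ('a \<times> 'a covec) set" where
  "restrict_bundle L U = {(p, \<xi>) \<in> L. p \<in> U}"

definition contact_extends ::
    "('a, 'm::finite) cmfd \<Rightarrow> nat \<Rightarrow> 'a set \<Rightarrow> ('a \<times> 'a covec) set \<Rightarrow> bool" where
  "contact_extends M n S L \<longleftrightarrow>
     (\<exists>L'. contact_structure M n L' \<and> restrict_bundle L' (points M - S) = L)"

end

theory Submission
  imports Defs "HOL-Complex_Analysis.Cauchy_Integral_Formula"
begin

text \<open>
  A contact form \<open>\<alpha>\<close> with \<open>\<alpha> \<and> (d\<alpha>)\<^sup>n\<close> equal to the standard volume form of a chart is determined by its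
  kernel up to an \<open>(n + 1)\<close>-th root of unity, because \<open>h\<alpha> \<and> (d(h\<alpha>))\<^sup>n = h\<^bsup>n+1\<^esup> \<alpha> \<and> (d\<alpha>)\<^sup>n\<close>.  The
  complement of a linear subspace of codimension 2 in a small polydisc is simply connected, so a
  contact structure there is the kernel of a global normalised form; its coefficients extend by
  Hartogs' theorem, and the extended form remains normalised by continuity.

  The general case is reduced to this one without any structure theory of analytic sets.  Let \<open>T\<close> be
  the set of points near which there is no extension, and choose a chart meeting \<open>T\<close> in which as many
  coordinates as possible vanish on \<open>T\<close>.  By maximality a function vanishing on \<open>T\<close> has vanishing
  derivatives on \<open>T\<close> in all the other directions, so it vanishes on the coordinate subspace \<open>N\<close> cut out
  by these coordinates.  Hence \<open>N\<close> lies in the analytic set that contains \<open>S\<close> near a point of \<open>T\<close>.  Then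
  \<open>N\<close> has codimension at least 2, since otherwise that analytic set would have a regular point of codimension
  at most 1; so the structure extends after all.
\<close>

section \<open>Holomorphic functions of several variables\<close>

text \<open>\<open>L\<close> has only local generators, each unique up to a nonvanishing holomorphic
  factor, so at first there are no functions to which Hartogs could be applied. Fixing the volume
  leaves a finite group of factors, and the search for a global generator becomes a lifting problem
  for a finite covering. Codimension 2 enters twice: a ball in C^2 without its centre is simply
  connected because its real dimension is 4, and a Cauchy integral in one coordinate uses the other
  one to avoid the subspace. That the volume coefficient is the constant 1 also keeps the extended
  form from degenerating on the subspace. \<open>S\<close> may be singular and is merely contained
  in an analytic set, so no chart straightens it. The proof by contradiction works with
  \<open>T\<close> instead: extending near a single point of \<open>T\<close> is already absurd, so
  one good chart is enough, and maximality supplies it. Regular points of codimension at most 1 are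
  exhibited by charts: no equation on an open subset, or one equation near a point of a
  hyperplane.\<close>

definition cder :: "(complex ^ 'm::finite \<Rightarrow> complex) \<Rightarrow> ('m \<Rightarrow> complex) \<Rightarrow> complex ^ 'm \<Rightarrow> bool" where
  "cder f a z \<longleftrightarrow> (f has_derivative (\<lambda>v. \<Sum>i\<in>UNIV. a i * v $ i)) (at z)"

definition pd :: "'m::finite \<Rightarrow> (complex ^ 'm \<Rightarrow> complex) \<Rightarrow> complex ^ 'm \<Rightarrow> complex" where
  "pd i f z = frechet_derivative f (at z) (axis i 1)"

text \<open>\<open>pd\<close> is read off from the real derivative. Requiring the derivative to be
  the complex linear map with these coefficients is what separates complex from real
  differentiability.\<close>

definition cdiff :: "(complex ^ 'm::finite \<Rightarrow> complex) \<Rightarrow> complex ^ 'm \<Rightarrow> bool" where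
  "cdiff f z \<longleftrightarrow> cder f (\<lambda>i. pd i f z) z"

lemma cder_pd:
  assumes "cder f a z"
  shows "pd i f z = a i"
proof -
  have "frechet_derivative f (at z) = (\<lambda>v. \<Sum>i\<in>UNIV. a i * v $ i)"
    using assms frechet_derivative_at unfolding cder_def by metis
  then show ?thesis
    by (simp add: pd_def axis_def if_distrib sum.delta cong: if_cong)
qed

lemma cder_cdiff: "cder f a z \<Longrightarrow> cdiff f z"
  using cder_pd[of f a z] by (simp add: cdiff_def)

lemma cdiff_cder: "cdiff f z \<Longrightarrow> cder f (\<lambda>i. pd i f z) z"
  by (simp add: cdiff_def)

lemma cder_of_linear:
  assumes "(f has_derivative f') (at z)" "\<And>c v. f' (c *s v) = c * f' v"
  shows "cder f (\<lambda>i. f' (axis i 1)) z"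
proof -
  have lin: "linear f'" using assms(1) has_derivative_linear by blast
  have "f' v = (\<Sum>i\<in>UNIV. f' (axis i 1) * v $ i)" for v
  proof -
    have "f' v = f' (\<Sum>i\<in>UNIV. v $ i *s axis i 1)" by (simp add: basis_expansion)
    also have "\<dots> = (\<Sum>i\<in>UNIV. f' (v $ i *s axis i 1))" by (rule linear_sum[OF lin])
    finally show ?thesis by (simp add: assms(2) mult.commute)
  qed
  then have "f' = (\<lambda>v. \<Sum>i\<in>UNIV. f' (axis i 1) * v $ i)" by blast
  then show ?thesis using assms(1) unfolding cder_def by metis
qed

lemma holo_cdiff: "holo f U \<longleftrightarrow> open U \<and> (\<forall>z\<in>U. cdiff f z)"
proof -
  have "(\<exists>f'. (f has_derivative f') (at z) \<and> (\<forall>c v. f' (c *s v) = c * f' v)) \<longleftrightarrow> cdiff f z" for z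
  proof
    assume "\<exists>f'. (f has_derivative f') (at z) \<and> (\<forall>c v. f' (c *s v) = c * f' v)"
    then show "cdiff f z" using cder_of_linear cder_cdiff by metis
  next
    assume "cdiff f z"
    then show "\<exists>f'. (f has_derivative f') (at z) \<and> (\<forall>c v. f' (c *s v) = c * f' v)"
      unfolding cdiff_def cder_def
      by (intro exI[of _ "\<lambda>v. \<Sum>i\<in>UNIV. pd i f z * v $ i"]) (auto simp: sum_distrib_left mult_ac)
  qed
  then show ?thesis by (simp add: holo_def)
qed

lemma holo_open: "holo f U \<Longrightarrow> open U" by (simp add: holo_cdiff)

lemma holoD: "holo f U \<Longrightarrow> z \<in> U \<Longrightarrow> cdiff f z" by (simp add: holo_cdiff)

lemma holo_subset: "holo f U \<Longrightarrow> open V \<Longrightarrow> V \<subseteq> U \<Longrightarrow> holo f V" by (auto simp: holo_cdiff)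

lemma cder_cong_open:
  assumes "cder f a z" "open U" "z \<in> U" "\<And>x. x \<in> U \<Longrightarrow> f x = g x"
  shows "cder g a z"
  using assms has_derivative_transform_within_open unfolding cder_def by blast

lemma cdiff_cong_open:
  assumes "open U" "z \<in> U" "\<And>x. x \<in> U \<Longrightarrow> f x = g x"
  shows "cdiff f z \<longleftrightarrow> cdiff g z"
  using cder_cong_open[OF _ assms(1,2)] assms(3) cder_cdiff cdiff_cder by metis

lemma pd_cong_open:
  assumes "open U" "z \<in> U" "\<And>x. x \<in> U \<Longrightarrow> f x = g x"
  shows "pd i f z = pd i g z"
proof -
  have "(f has_derivative f') (at z) = (g has_derivative f') (at z)" for f'
    using has_derivative_transform_within_open[OF _ assms(1,2)] assms(3) by metis
  then show ?thesis by (simp add: pd_def frechet_derivative_def)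
qed

lemma holo_cong: "(\<And>x. x \<in> U \<Longrightarrow> f x = g x) \<Longrightarrow> holo f U \<longleftrightarrow> holo g U"
  using cdiff_cong_open[of U _ f g] by (auto simp: holo_cdiff)

lemma holo_transfer: "holo f U \<Longrightarrow> (\<And>x. x \<in> U \<Longrightarrow> f x = g x) \<Longrightarrow> holo g U"
  using holo_cong by blast

lemma holo_local:
  assumes "\<And>z. z \<in> U \<Longrightarrow> \<exists>V. z \<in> V \<and> V \<subseteq> U \<and> holo f V"
  shows "holo f U"
proof -
  have "open U" by (subst open_subopen) (use assms holo_open in blast)
  then show ?thesis using assms by (meson holo_cdiff)
qed

section \<open>Differentiation rules in several complex variables\<close>

lemma cder_const: "cder (\<lambda>z. c) (\<lambda>i. 0) z"
  by (simp add: cder_def)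

lemma cder_nth: "cder (\<lambda>z. z $ j) (\<lambda>i. if i = j then 1 else 0) z"
  by (simp add: cder_def if_distrib[of "\<lambda>x. x * _"] bounded_linear_imp_has_derivative bounded_linear_vec_nth
      cong: if_cong)

lemma cder_add: "cder f a z \<Longrightarrow> cder g b z \<Longrightarrow> cder (\<lambda>z. f z + g z) (\<lambda>i. a i + b i) z"
  unfolding cder_def by (drule (1) has_derivative_add) (simp add: algebra_simps sum.distrib)

lemma cder_diff: "cder f a z \<Longrightarrow> cder g b z \<Longrightarrow> cder (\<lambda>z. f z - g z) (\<lambda>i. a i - b i) z"
  unfolding cder_def by (drule (1) has_derivative_diff) (simp add: algebra_simps sum_subtractf)

lemma cder_mult: "cder f a z \<Longrightarrow> cder g b z \<Longrightarrow> cder (\<lambda>z. f z * g z) (\<lambda>i. a i * g z + f z * b i) z"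
  unfolding cder_def
  by (drule (1) has_derivative_mult, erule has_derivative_eq_rhs)
     (auto simp: algebra_simps sum.distrib sum_distrib_left)

lemma cder_sum:
  assumes "\<And>k. k \<in> K \<Longrightarrow> cder (f k) (a k) z"
  shows "cder (\<lambda>z. \<Sum>k\<in>K. f k z) (\<lambda>i. \<Sum>k\<in>K. a k i) z"
  using assms
proof (induction K rule: infinite_finite_induct)
  case (insert x F)
  then show ?case by (simp add: cder_add)
qed (auto simp: cder_const)

lemma cder_field:
  assumes "cder f a z" "(g has_field_derivative d) (at (f z))"
  shows "cder (\<lambda>z. g (f z)) (\<lambda>i. d * a i) z"
proof -
  have "(g \<circ> f has_derivative (\<lambda>x. d * x) \<circ> (\<lambda>v. \<Sum>i\<in>UNIV. a i * v $ i)) (at z)"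
    using assms unfolding cder_def has_field_derivative_def by (intro diff_chain_at)
  then show ?thesis by (simp add: cder_def o_def sum_distrib_left mult_ac)
qed

lemma has_derivative_vec:
  fixes F :: "'a::real_normed_vector \<Rightarrow> complex ^ 'n::finite"
  assumes "\<And>j. ((\<lambda>z. F z $ j) has_derivative (\<lambda>v. F' v $ j)) (at z)"
  shows "(F has_derivative F') (at z)"
  by (subst has_derivative_componentwise_within)
     (auto simp: Basis_vec_def inner_axis intro!: has_derivative_inner_left assms)

lemma has_derivative_cder_vec:
  fixes G :: "complex ^ 'n::finite \<Rightarrow> complex ^ 'm::finite"
  assumes "\<And>j. cder (\<lambda>z. G z $ j) (a j) z"
  shows "(G has_derivative (\<lambda>v. \<chi> j. \<Sum>i\<in>UNIV. a j i * v $ i)) (at z)"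
  using assms by (intro has_derivative_vec) (simp add: cder_def)

lemma cder_comp:
  fixes G :: "complex ^ 'n::finite \<Rightarrow> complex ^ 'm::finite"
  assumes "cder f b (G z)" "\<And>j. cder (\<lambda>z. G z $ j) (a j) z"
  shows "cder (\<lambda>z. f (G z)) (\<lambda>i. \<Sum>j\<in>UNIV. b j * a j i) z"
proof -
  have "(f \<circ> G has_derivative (\<lambda>v. \<Sum>i\<in>UNIV. b i * v $ i) \<circ> (\<lambda>v. \<chi> j. \<Sum>i\<in>UNIV. a j i * v $ i)) (at z)"
    using assms(1) unfolding cder_def
    by (intro diff_chain_at has_derivative_cder_vec[OF assms(2)])
  moreover have "(\<Sum>j\<in>UNIV. b j * (\<Sum>i\<in>UNIV. a j i * v $ i)) = (\<Sum>i\<in>UNIV. (\<Sum>j\<in>UNIV. b j * a j i) * v $ i)" for v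
    by (simp only: sum_distrib_left sum_distrib_right mult.assoc) (rule sum.swap)
  ultimately show ?thesis by (simp add: cder_def o_def)
qed

lemma cdiff_const [simp]: "cdiff (\<lambda>z. c) z" by (rule cder_cdiff[OF cder_const])
lemma cdiff_nth [simp]: "cdiff (\<lambda>z. z $ j) z" by (rule cder_cdiff[OF cder_nth])
lemma cdiff_add: "cdiff f z \<Longrightarrow> cdiff g z \<Longrightarrow> cdiff (\<lambda>z. f z + g z) z"
  by (blast intro: cder_cdiff cder_add dest: cdiff_cder)
lemma cdiff_diff: "cdiff f z \<Longrightarrow> cdiff g z \<Longrightarrow> cdiff (\<lambda>z. f z - g z) z"
  by (blast intro: cder_cdiff cder_diff dest: cdiff_cder)
lemma cdiff_mult: "cdiff f z \<Longrightarrow> cdiff g z \<Longrightarrow> cdiff (\<lambda>z. f z * g z) z"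
  by (blast intro: cder_cdiff cder_mult dest: cdiff_cder)
lemma cdiff_sum: "(\<And>k. k \<in> K \<Longrightarrow> cdiff (f k) z) \<Longrightarrow> cdiff (\<lambda>z. \<Sum>k\<in>K. f k z) z"
  by (rule cder_cdiff[OF cder_sum]) (rule cdiff_cder)
lemma cdiff_field: "cdiff f z \<Longrightarrow> (g has_field_derivative d) (at (f z)) \<Longrightarrow> cdiff (\<lambda>z. g (f z)) z"
  by (blast intro: cder_cdiff cder_field dest: cdiff_cder)
lemma cdiff_inverse: "cdiff f z \<Longrightarrow> f z \<noteq> 0 \<Longrightarrow> cdiff (\<lambda>z. inverse (f z)) z"
  by (rule cdiff_field[where g = inverse]) (auto intro!: derivative_eq_intros)
lemma cdiff_divide: "cdiff f z \<Longrightarrow> cdiff g z \<Longrightarrow> g z \<noteq> 0 \<Longrightarrow> cdiff (\<lambda>z. f z / g z) z"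
  unfolding divide_inverse by (intro cdiff_mult cdiff_inverse)
lemma cdiff_comp:
  fixes G :: "complex ^ 'n::finite \<Rightarrow> complex ^ 'm::finite"
  shows "cdiff f (G z) \<Longrightarrow> (\<And>j. cdiff (\<lambda>z. G z $ j) z) \<Longrightarrow> cdiff (\<lambda>z. f (G z)) z"
  by (rule cder_cdiff[OF cder_comp]) (auto intro: cdiff_cder)

lemma pd_const [simp]: "pd i (\<lambda>z. c) z = 0" by (rule cder_pd[OF cder_const])
lemma pd_nth [simp]: "pd i (\<lambda>z. z $ j) z = (if i = j then 1 else 0)" by (rule cder_pd[OF cder_nth])
lemma pd_add: "cdiff f z \<Longrightarrow> cdiff g z \<Longrightarrow> pd i (\<lambda>z. f z + g z) z = pd i f z + pd i g z"
  by (rule cder_pd[OF cder_add]) (auto intro: cdiff_cder)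
lemma pd_mult: "cdiff f z \<Longrightarrow> cdiff g z \<Longrightarrow> pd i (\<lambda>z. f z * g z) z = pd i f z * g z + f z * pd i g z"
  by (rule cder_pd[OF cder_mult]) (auto intro: cdiff_cder)
lemma pd_sum: "(\<And>k. k \<in> K \<Longrightarrow> cdiff (f k) z) \<Longrightarrow> pd i (\<lambda>z. \<Sum>k\<in>K. f k z) z = (\<Sum>k\<in>K. pd i (f k) z)"
  by (rule cder_pd[OF cder_sum]) (auto intro: cdiff_cder)
lemma cdiff_isCont: "cdiff f z \<Longrightarrow> isCont f z"
  unfolding cdiff_def cder_def using has_derivative_continuous by blast

lemma holo_continuous_on: "holo f U \<Longrightarrow> continuous_on U f"
  by (simp add: holo_cdiff cdiff_isCont continuous_at_imp_continuous_on)

lemma holo_mult: "holo f U \<Longrightarrow> holo g U \<Longrightarrow> holo (\<lambda>z. f z * g z) U"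
  by (auto simp: holo_cdiff intro: cdiff_mult)
lemma holo_add: "holo f U \<Longrightarrow> holo g U \<Longrightarrow> holo (\<lambda>z. f z + g z) U"
  by (auto simp: holo_cdiff intro: cdiff_add)
lemma holo_diff: "holo f U \<Longrightarrow> holo g U \<Longrightarrow> holo (\<lambda>z. f z - g z) U"
  by (auto simp: holo_cdiff intro: cdiff_diff)
lemma holo_const: "open U \<Longrightarrow> holo (\<lambda>z. c) U"
  by (auto simp: holo_cdiff)
lemma holo_nth: "open U \<Longrightarrow> holo (\<lambda>z. z $ i) U"
  by (auto simp: holo_cdiff)
lemma holo_sum: "open U \<Longrightarrow> (\<And>k. k \<in> K \<Longrightarrow> holo (f k) U) \<Longrightarrow> holo (\<lambda>z. \<Sum>k\<in>K. f k z) U"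
  by (auto simp: holo_cdiff intro: cdiff_sum)

lemma holo_comp:
  fixes G :: "complex ^ 'n::finite \<Rightarrow> complex ^ 'm::finite"
  assumes "holo f V" "\<And>j. holo (\<lambda>z. G z $ j) U" "G ` U \<subseteq> V" "open U"
  shows "holo (\<lambda>z. f (G z)) U"
proof -
  have "cdiff (\<lambda>z. f (G z)) z" if "z \<in> U" for z
    by (rule cdiff_comp) (use assms that in \<open>auto simp: holo_cdiff\<close>)
  then show ?thesis using assms(4) by (simp add: holo_cdiff)
qed

text \<open>Restriction to a complex line is the bridge to one-variable analysis: Cauchy's formula,
  the identity theorem and the fundamental theorem of calculus are all applied along such a
  line.\<close>

lemma cdiff_slice:
  assumes "cdiff f (z + t *s v)"
  shows "((\<lambda>t. f (z + t *s v)) has_field_derivative (\<Sum>i\<in>UNIV. pd i f (z + t *s v) * v $ i)) (at t)"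
proof -
  have 1: "(f has_derivative (\<lambda>w. \<Sum>i\<in>UNIV. pd i f (z + t *s v) * w $ i)) (at (z + t *s v))"
    using assms by (simp add: cdiff_def cder_def)
  have "((\<lambda>t. z $ j + t * v $ j) has_derivative (\<lambda>s. s * v $ j)) (at t)" for j
    by (auto intro!: derivative_eq_intros)
  then have 2: "((\<lambda>t. z + t *s v) has_derivative (\<lambda>s. s *s v)) (at t)"
    by (intro has_derivative_vec) simp
  show ?thesis
    using diff_chain_at[OF 2 1] unfolding has_field_derivative_def o_def
    by (rule has_derivative_eq_rhs) (auto simp: sum_distrib_left sum_distrib_right mult_ac)
qed

section \<open>Cauchy's formula, and integrals depending on a parameter\<close>

lemma continuous_on_smult [continuous_intros]:
  fixes f :: "'a::topological_space \<Rightarrow> complex"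
  assumes "continuous_on S f" "continuous_on S g"
  shows "continuous_on S (\<lambda>x. f x *s (g x :: complex ^ 'm::finite))"
  unfolding vector_scalar_mult_def
  by (intro continuous_intros assms)

lemma norm_smult: "norm (c *s (v :: complex ^ 'm::finite)) = cmod c * norm v"
  by (simp add: norm_vec_def norm_mult L2_set_right_distrib)

lemma norm_smult_axis [simp]: "norm (c *s axis i 1 :: complex ^ 'm::finite) = cmod c"
  by (simp add: norm_smult)

lemma circle_integral:
  "contour_integral (circlepath c r) f = integral {0..2*pi} (\<lambda>t. f (c + r * cis t) * r * \<i> * cis t)"
  unfolding circlepath_def by (rule contour_integral_part_circlepath_eq) simp

text \<open>Cauchy's formula for the first derivative at the centre, applied to the slice in
  direction \<open>i\<close>. It expresses \<open>pd i f\<close> through values of \<open>f\<close>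
  alone, so regularity of \<open>f\<close> passes to its derivatives.\<close>

lemma pd_cauchy:
  assumes f: "holo f U" and sub: "cball z r \<subseteq> U" and r: "0 < r"
  shows "pd i f z = 1 / (2 * pi * r) * integral {0..2*pi} (\<lambda>t. f (z + (r * cis t) *s axis i 1) / cis t)"
proof -
  let ?g = "\<lambda>s. f (z + s *s axis i 1)"
  have d: "(?g has_field_derivative (\<Sum>k\<in>UNIV. pd k f (z + s *s axis i 1) * axis i 1 $ k)) (at s)" 
    if "s \<in> cball 0 r" for s
    by (rule cdiff_slice, rule holoD[OF f]) (use that sub in \<open>auto simp: dist_norm intro!: subsetD[OF sub]\<close>)
  have cont: "continuous_on (cball 0 r) ?g"
    by (rule continuous_at_imp_continuous_on) (use d DERIV_isCont in blast)
  have hol: "?g holomorphic_on ball 0 r"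
    unfolding holomorphic_on_def field_differentiable_def
  proof
    fix s assume "s \<in> ball (0::complex) r"
    then have "s \<in> cball 0 r" by simp
    then show "\<exists>f'. (?g has_field_derivative f') (at s within ball 0 r)"
      using d has_field_derivative_at_within by blast
  qed
  have "deriv ?g 0 = pd i f z"
    using DERIV_imp_deriv[OF d[of 0]] r by (simp add: axis_def if_distrib cong: if_cong)
  moreover have "contour_integral (circlepath 0 r) (\<lambda>u. ?g u / (u - 0)^2) = (2 * pi * \<i>) * deriv ?g 0"
    by (rule Cauchy_contour_integral_circlepath_2[OF cont hol]) (use r in auto)
  moreover have "contour_integral (circlepath 0 r) (\<lambda>u. ?g u / (u - 0)^2)
      = integral {0..2*pi} (\<lambda>t. (\<i> / r) * (f (z + (r * cis t) *s axis i 1) / cis t))"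
    unfolding circle_integral
    by (rule integral_cong) (use r in \<open>auto simp: field_simps power2_eq_square\<close>)
  moreover have "\<dots> = (\<i> / r) * integral {0..2*pi} (\<lambda>t. f (z + (r * cis t) *s axis i 1) / cis t)"
    by (rule integral_mult_right)
  ultimately have "(2 * pi * \<i>) * pd i f z = (\<i> / r) * integral {0..2*pi} (\<lambda>t. f (z + (r * cis t) *s axis i 1) / cis t)"
    by metis
  then show ?thesis using r by (simp add: field_simps)
qed

lemma local_continuous_on:
  fixes f :: "'a::metric_space \<times> 'b::metric_space \<Rightarrow> 'c::metric_space"
  assumes "open U" "\<And>z. z \<in> U \<Longrightarrow> \<exists>V. open V \<and> z \<in> V \<and> continuous_on (V \<times> A) f"
  shows "continuous_on (U \<times> A) f"
  unfolding continuous_on_eq_continuous_within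
proof
  fix p assume "p \<in> U \<times> A"
  then obtain V where V: "open V" "fst p \<in> V" "continuous_on (V \<times> A) f" and p: "fst p \<in> U" "snd p \<in> A"
    using assms(2)[of "fst p"] by auto
  have "continuous (at p within V \<times> A) f"
    using V p by (metis mem_Times_iff continuous_on_eq_continuous_within)
  moreover have "at p within V \<times> A = at p within U \<times> A"
    by (rule at_within_nhd[of _ "(U \<inter> V) \<times> UNIV"])
       (use V p assms(1) in \<open>auto simp: mem_Times_iff intro!: open_Times\<close>)
  ultimately show "continuous (at p within U \<times> A) f" by simp
qed

text \<open>The Leibniz rule asks for joint continuity of the derivative. Locally the derivative is
  a Cauchy integral of the jointly continuous \<open>f\<close>, hence jointly continuous
  itself.\<close>

lemma continuous_on_pd_param:
  fixes f :: "real \<Rightarrow> complex ^ 'm::finite \<Rightarrow> complex"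
  assumes c: "continuous_on (U \<times> {a..b}) (\<lambda>(z, t). f t z)"
    and h: "\<And>t. t \<in> {a..b} \<Longrightarrow> holo (f t) U" and U: "open U"
  shows "continuous_on (U \<times> {a..b}) (\<lambda>(z, t). pd i (f t) z)"
proof (rule local_continuous_on[OF U])
  fix z0 assume "z0 \<in> U"
  then obtain r where r: "0 < r" "cball z0 r \<subseteq> U" using U open_contains_cball by blast
  \<comment> \<open>With half the radius, the circle of radius \<open>s\<close> around every point
    of \<open>ball z0 s\<close> stays in \<open>U\<close>, so one radius serves all
    \<open>z\<close>.\<close>
  define s where "s = r / 2"
  have s: "0 < s" "\<And>z. z \<in> ball z0 s \<Longrightarrow> cball z s \<subseteq> U"
  proof -
    fix z assume "z \<in> ball z0 s"
    then have "cball z s \<subseteq> cball z0 r"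
      using cball_subset_cball_iff[of z s z0 r] by (simp add: s_def dist_commute)
    then show "cball z s \<subseteq> U" using r by blast
  qed (use r s_def in auto)
  define F where "F z t \<theta> = f t (z + (complex_of_real s * cis \<theta>) *s axis i 1) / cis \<theta>" for z t \<theta>
  have "continuous_on ((ball z0 s \<times> {a..b}) \<times> cbox 0 (2*pi)) (\<lambda>(p, \<theta>). F (fst p) (snd p) \<theta>)"
  proof -
    have "continuous_on ((ball z0 s \<times> {a..b}) \<times> cbox 0 (2*pi))
       (\<lambda>q. (\<lambda>(z, t). f t z) (fst (fst q) + (complex_of_real s * cis (snd q)) *s axis i 1, snd (fst q)))"
    proof (rule continuous_on_compose2[OF c])
      show "continuous_on ((ball z0 s \<times> {a..b}) \<times> cbox 0 (2*pi))
        (\<lambda>q. (fst (fst q) + (complex_of_real s * cis (snd q)) *s axis i 1, snd (fst q)))"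
        by (intro continuous_intros continuous_on_cis)
      have "z + (complex_of_real s * cis \<theta>) *s axis i 1 \<in> U" if "z \<in> ball z0 s" for z \<theta>
        using s(2)[OF that] s(1) by (auto intro!: subsetD[of "cball z s" U] simp: dist_norm norm_mult)
      then show "(\<lambda>q. (fst (fst q) + (complex_of_real s * cis (snd q)) *s axis i 1, snd (fst q))) `
          ((ball z0 s \<times> {a..b}) \<times> cbox 0 (2*pi)) \<subseteq> U \<times> {a..b}"
        by auto
    qed
    then show ?thesis
      unfolding F_def case_prod_beta
      by (intro continuous_on_divide continuous_on_cis continuous_intros) auto
  qed
  then have "continuous_on (ball z0 s \<times> {a..b}) (\<lambda>p. integral (cbox 0 (2*pi)) (F (fst p) (snd p)))"
    by (rule integral_continuous_on_param)
  then have "continuous_on (ball z0 s \<times> {a..b}) (\<lambda>p. 1 / (2 * pi * s) * integral (cbox 0 (2*pi)) (F (fst p) (snd p)))"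
    by (intro continuous_intros)
  moreover have "pd i (f t) z = 1 / (2 * pi * s) * integral (cbox 0 (2*pi)) (F z t)"
    if "z \<in> ball z0 s" "t \<in> {a..b}" for z t
    using pd_cauchy[OF h[OF that(2)] s(2)[OF that(1)] s(1)] unfolding F_def by (simp flip: F_def)
  ultimately have "continuous_on (ball z0 s \<times> {a..b}) (\<lambda>(z, t). pd i (f t) z)"
    by (subst continuous_on_cong[OF refl, where g = "\<lambda>p. 1 / (2 * pi * s) * integral (cbox 0 (2*pi)) (F (fst p) (snd p))"]) auto
  then show "\<exists>V. open V \<and> z0 \<in> V \<and> continuous_on (V \<times> {a..b}) (\<lambda>(z, t). pd i (f t) z)"
    using s(1) by (intro exI[of _ "ball z0 s"]) auto
qed

text \<open>The gradient as a bounded linear map, the type that the Leibniz rule and the inverse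
  function theorem ask for. Written as multiplications composed with projections, it inherits
  continuity from its coefficients.\<close>

definition cgrad :: "('m \<Rightarrow> complex) \<Rightarrow> (complex ^ 'm::finite) \<Rightarrow>\<^sub>L complex" where
  "cgrad a = (\<Sum>i\<in>UNIV. Blinfun (\<lambda>v. a i * v) o\<^sub>L Blinfun (\<lambda>v. v $ i))"

lemma cgrad_apply: "blinfun_apply (cgrad a) v = (\<Sum>i\<in>UNIV. a i * v $ i)"
  by (simp add: cgrad_def blinfun.sum_left bounded_linear_Blinfun_apply bounded_linear_vec_nth
      bounded_linear_mult_right)

lemma continuous_on_cgrad:
  assumes "\<And>i. continuous_on S (\<lambda>x. a x i)"
  shows "continuous_on S (\<lambda>x. cgrad (a x))"
proof -
  define M where "M c = Blinfun (\<lambda>v::complex. c * v)" for c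
  have M: "blinfun_apply (M c) v = c * v" for c v
    by (simp add: M_def bounded_linear_Blinfun_apply bounded_linear_mult_right)
  have bM: "bounded_linear M"
  proof (rule bounded_linear_intro[where K = 1])
    show "M (x + y) = M x + M y" for x y by (rule blinfun_eqI) (simp add: M blinfun.add_left algebra_simps)
    show "M (x *\<^sub>R y) = x *\<^sub>R M y" for x y by (rule blinfun_eqI) (simp add: M blinfun.scaleR_left)
    show "norm (M x) \<le> norm x * 1" for x
      by (rule norm_blinfun_bound) (auto simp: M norm_mult)
  qed
  show ?thesis
    unfolding cgrad_def M_def[symmetric]
    by (intro continuous_intros bounded_linear.continuous_on[OF bM] assms)
qed

text \<open>The Leibniz rule for the gradient as a bounded linear map, whose joint continuity comes
  from \<open>continuous_on_pd_param\<close>.\<close>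

lemma cder_integral_param:
  fixes f :: "real \<Rightarrow> complex ^ 'm::finite \<Rightarrow> complex"
  assumes c: "continuous_on (U \<times> {a..b}) (\<lambda>(z, t). f t z)"
    and h: "\<And>t. t \<in> {a..b} \<Longrightarrow> holo (f t) U" and U: "open U" and z0: "z0 \<in> U"
  shows "cder (\<lambda>z. integral {a..b} (\<lambda>t. f t z)) (\<lambda>i. integral {a..b} (\<lambda>t. pd i (f t) z0)) z0"
proof -
  obtain r where r: "0 < r" "ball z0 r \<subseteq> U" using U z0 open_contains_ball by blast
  define D where "D z t = cgrad (\<lambda>i. pd i (f t) z)" for z t
  have D: "blinfun_apply (D z t) v = (\<Sum>i\<in>UNIV. pd i (f t) z * v $ i)" for z t v
    by (simp add: D_def cgrad_apply)
  have "continuous_on (ball z0 r \<times> {a..b}) (\<lambda>(z, t). pd i (f t) z)" for i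
    by (rule continuous_on_subset[OF continuous_on_pd_param[OF c h U]]) (use r in auto)
  then have contD: "continuous_on (ball z0 r \<times> cbox a b) (\<lambda>(z, t). D z t)"
    unfolding D_def case_prod_beta by (intro continuous_on_cgrad) (simp add: case_prod_beta)
  have der: "((\<lambda>z. integral (cbox a b) (\<lambda>t. f t z)) has_derivative blinfun_apply (integral (cbox a b) (D z0))) (at z0 within ball z0 r)"
  proof (rule leibniz_rule)
    fix z t assume zt: "z \<in> ball z0 r" "t \<in> cbox a b"
    then have "cdiff (f t) z" using h r holoD by (metis cbox_interval subsetD)
    then show "((\<lambda>z. f t z) has_derivative blinfun_apply (D z t)) (at z within ball z0 r)"
      by (simp add: D[abs_def] cdiff_def cder_def has_derivative_at_withinI)
  next
    fix z assume "z \<in> ball z0 r"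
    then have zU: "z \<in> U" using r by blast
    have "continuous_on {a..b} (\<lambda>t. (\<lambda>(z, t). f t z) (z, t))"
      by (rule continuous_on_compose2[OF c]) (use zU in \<open>auto intro!: continuous_intros\<close>)
    then show "(\<lambda>t. f t z) integrable_on cbox a b"
      by (simp add: integrable_continuous_interval)
  qed (use r contD in auto)
  have iD: "D z0 integrable_on {a..b}"
  proof -
    have "continuous_on {a..b} (\<lambda>t. (\<lambda>(z, t). D z t) (z0, t))"
      by (rule continuous_on_compose2[OF contD]) (use r in \<open>auto intro!: continuous_intros\<close>)
    then show ?thesis by (simp add: integrable_continuous_interval)
  qed
  have ii: "(\<lambda>t. pd i (f t) z0) integrable_on {a..b}" for i
  proof -
    have "continuous_on {a..b} (\<lambda>t. (\<lambda>(z, t). pd i (f t) z) (z0, t))"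
      by (rule continuous_on_compose2[OF continuous_on_pd_param[OF c h U]]) (use z0 in \<open>auto intro!: continuous_intros\<close>)
    then show ?thesis by (simp add: integrable_continuous_interval)
  qed
  have "blinfun_apply (integral {a..b} (D z0)) v = (\<Sum>i\<in>UNIV. integral {a..b} (\<lambda>t. pd i (f t) z0) * v $ i)" for v
  proof -
    have "blinfun_apply (integral {a..b} (D z0)) v = integral {a..b} (\<lambda>t. blinfun_apply (D z0 t) v)"
      by (rule blinfun_apply_integral[OF iD])
    also have "\<dots> = (\<Sum>i\<in>UNIV. integral {a..b} (\<lambda>t. pd i (f t) z0 * v $ i))"
      unfolding D by (rule integral_sum) (auto intro!: integrable_on_mult_left ii)
    finally show ?thesis by (simp add: integral_mult_left ii)
  qed
  then have "blinfun_apply (integral {a..b} (D z0)) = (\<lambda>v. \<Sum>i\<in>UNIV. integral {a..b} (\<lambda>t. pd i (f t) z0) * v $ i)"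
    by blast
  then show ?thesis
    using der r unfolding cder_def by (simp add: at_within_open[OF _ open_ball])
qed

lemma holo_integral_param:
  fixes f :: "real \<Rightarrow> complex ^ 'm::finite \<Rightarrow> complex"
  assumes "continuous_on (U \<times> {a..b}) (\<lambda>(z, t). f t z)"
    and "\<And>t. t \<in> {a..b} \<Longrightarrow> holo (f t) U" and "open U"
  shows "holo (\<lambda>z. integral {a..b} (\<lambda>t. f t z)) U"
    and "z \<in> U \<Longrightarrow> pd i (\<lambda>z. integral {a..b} (\<lambda>t. f t z)) z = integral {a..b} (\<lambda>t. pd i (f t) z)"
  using cder_integral_param[OF assms] cder_cdiff cder_pd \<open>open U\<close> by (fastforce simp: holo_cdiff)+

lemma cder_translate:
  assumes "cdiff f (z + w)"
  shows "cder (\<lambda>z. f (z + w)) (\<lambda>i. pd i f (z + w)) z"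
proof -
  have "cder (\<lambda>z. (z + w) $ j) (\<lambda>i. if i = j then 1 else 0) z" for j
    using cder_add[OF cder_nth[of j z] cder_const[of "w $ j" z]] by simp
  then have "cder (\<lambda>z. f (z + w)) (\<lambda>i. \<Sum>j\<in>UNIV. pd j f (z + w) * (if i = j then 1 else 0)) z"
    by (rule cder_comp[where f = f and G = "\<lambda>z. z + w", OF cdiff_cder[OF assms]])
  then show ?thesis by (simp add: if_distrib[of "\<lambda>x. _ * x"] cong: if_cong)
qed

text \<open>Differentiate the Cauchy integral for \<open>pd i f\<close> under the integral sign. The
  last clause is kept for the symmetry of second derivatives: by Cauchy's formula its right-hand
  side is also \<open>pd i (pd j f) z\<close>.\<close>

lemma holo_pd_aux:
  assumes f: "holo f U" and z0: "z0 \<in> U"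
  obtains s where "0 < s" "ball z0 s \<subseteq> U" "holo (pd i f) (ball z0 s)"
    "\<And>z j. z \<in> ball z0 s \<Longrightarrow> cball z s \<subseteq> U \<and> pd j (pd i f) z = 1 / (2 * pi * s) *
        integral {0..2*pi} (\<lambda>t. pd j f (z + (s * cis t) *s axis i 1) / cis t)"
proof -
  obtain r where r: "0 < r" "cball z0 r \<subseteq> U" using z0 holo_open[OF f] open_contains_cball by blast
  define s where "s = r / 2"
  have s: "0 < s" using r s_def by simp
  have sub: "cball z s \<subseteq> U" if "z \<in> ball z0 s" for z
  proof -
    have "cball z s \<subseteq> cball z0 r"
      using cball_subset_cball_iff[of z s z0 r] that by (simp add: s_def dist_commute)
    then show ?thesis using r by blast
  qed
  have inU: "z + (complex_of_real s * cis t) *s axis i 1 \<in> U" if "z \<in> ball z0 s" for z t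
    using sub[OF that] s by (auto intro!: subsetD[of "cball z s" U] simp: dist_norm norm_mult)
  define F where "F t z = f (z + (complex_of_real s * cis t) *s axis i 1) * inverse (cis t)" for t z
  have cd: "cder (F t) (\<lambda>j. pd j f (z + (complex_of_real s * cis t) *s axis i 1) * inverse (cis t)) z"
    if "z \<in> ball z0 s" for t z
    using cder_mult[OF cder_translate[OF holoD[OF f inU[OF that, of t]]] cder_const, of "inverse (cis t)"]
    unfolding F_def by simp
  have hF: "holo (F t) (ball z0 s)" for t
    unfolding holo_cdiff using cder_cdiff[OF cd] by blast
  have "continuous_on (ball z0 s \<times> {0..2*pi}) (\<lambda>p. f (fst p + (complex_of_real s * cis (snd p)) *s axis i 1))"
    by (rule continuous_on_compose2[OF holo_continuous_on[OF f]])
      (use inU in \<open>auto intro!: continuous_intros continuous_on_cis\<close>)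
  then have cF: "continuous_on (ball z0 s \<times> {0..2*pi}) (\<lambda>(z, t). F t z)"
    unfolding F_def case_prod_beta by (intro continuous_intros continuous_on_cis) auto
  have eq: "pd i f z = 1 / (2 * pi * s) * integral {0..2*pi} (\<lambda>t. F t z)" if "z \<in> ball z0 s" for z
    using pd_cauchy[OF f sub[OF that] s] unfolding F_def divide_inverse .
  have hI: "holo (\<lambda>z. 1 / (2 * pi * s) * integral {0..2*pi} (\<lambda>t. F t z)) (ball z0 s)"
    by (rule holo_mult[OF holo_const[OF open_ball] holo_integral_param(1)[OF cF hF open_ball]])
  show thesis
  proof (rule that[OF s])
    have "z \<in> U" if "z \<in> ball z0 s" for z using sub[OF that] s by auto
    then show "ball z0 s \<subseteq> U" by blast
    show "holo (pd i f) (ball z0 s)"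
      using hI by (subst holo_cong[OF eq]) auto
    show "cball z s \<subseteq> U \<and> pd j (pd i f) z = 1 / (2 * pi * s) *
        integral {0..2*pi} (\<lambda>t. pd j f (z + (s * cis t) *s axis i 1) / cis t)" if "z \<in> ball z0 s" for z j
    proof
      have "pd j (pd i f) z = pd j (\<lambda>z. 1 / (2 * pi * s) * integral {0..2*pi} (\<lambda>t. F t z)) z"
        by (rule pd_cong_open[of "ball z0 s"]) (use that eq in auto)
      also have "\<dots> = 1 / (2 * pi * s) * pd j (\<lambda>z. integral {0..2*pi} (\<lambda>t. F t z)) z"
        using holoD[OF holo_integral_param(1)[OF cF hF]] that by (subst pd_mult) auto
      also have "pd j (\<lambda>z. integral {0..2*pi} (\<lambda>t. F t z)) z = integral {0..2*pi} (\<lambda>t. pd j (F t) z)"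
        by (rule holo_integral_param[OF cF hF]) (use that in auto)
      also have "\<dots> = integral {0..2*pi} (\<lambda>t. pd j f (z + (s * cis t) *s axis i 1) / cis t)"
        unfolding divide_inverse cder_pd[OF cd[OF that]] ..
      finally show "pd j (pd i f) z = 1 / (2 * pi * s) *
        integral {0..2*pi} (\<lambda>t. pd j f (z + (s * cis t) *s axis i 1) / cis t)" .
    qed (rule sub[OF that])
  qed
qed

lemma holo_pd: "holo f U \<Longrightarrow> holo (pd i f) U"
  by (rule holo_local) (metis holo_pd_aux centre_in_ball)

lemma pd_commute:
  assumes f: "holo f U" and z: "z \<in> U"
  shows "pd j (pd i f) z = pd i (pd j f) z"
proof -
  obtain s where "0 < s" and sub: "cball z s \<subseteq> U" and "pd j (pd i f) z = 1 / (2 * pi * s) *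
        integral {0..2*pi} (\<lambda>t. pd j f (z + (s * cis t) *s axis i 1) / cis t)"
  proof (rule holo_pd_aux[OF f z, of i])
    fix s :: real
    assume s: "0 < s" and *: "\<And>z' j. z' \<in> ball z s \<Longrightarrow> cball z' s \<subseteq> U \<and> pd j (pd i f) z' = 1 / (2 * pi * s) *
        integral {0..2*pi} (\<lambda>t. pd j f (z' + (s * cis t) *s axis i 1) / cis t)"
    show thesis by (rule that[OF s]) (use *[of z j] s in auto)
  qed
  then show ?thesis using pd_cauchy[OF holo_pd[OF f] sub \<open>0 < s\<close>] by simp
qed

section \<open>Division by coordinates, identity theorem and removable singularities\<close>

lemma continuous_on_vec_nthI:
  fixes G :: "'a::topological_space \<Rightarrow> complex ^ 'm::finite"
  assumes "\<And>j. continuous_on U (\<lambda>z. G z $ j)"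
  shows "continuous_on U G"
  using continuous_on_vec_lambda[of U "\<lambda>j z. G z $ j"] assms by simp

text \<open>Integrates the derivative of \<open>f\<close> along the segment from \<open>P z\<close>
  to \<open>z\<close>, which stays in the convex \<open>U\<close>. A constant \<open>P\<close> gives
  Hadamard's lemma at a point; the projection to a coordinate hyperplane gives division by that
  coordinate.\<close>

lemma holo_segment:
  fixes f :: "complex ^ 'm::finite \<Rightarrow> complex"
  assumes f: "holo f U" and U: "convex U" and P: "\<And>j. holo (\<lambda>z. P z $ j) U" and PU: "P ` U \<subseteq> U"
  obtains g where "\<And>i. holo (g i) U" "\<And>z. z \<in> U \<Longrightarrow> f z - f (P z) = (\<Sum>i\<in>UNIV. (z - P z) $ i * g i z)"
    "\<And>i z. z \<in> U \<Longrightarrow> P z = z \<Longrightarrow> g i z = pd i f z"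
proof -
  have oU: "open U" using f holo_open by blast
  define L where "L t z = P z + complex_of_real t *s (z - P z)" for t z
  have L: "L t z \<in> U" if "t \<in> {0..1}" "z \<in> U" for t z
  proof -
    have "L t z = (1 - t) *\<^sub>R P z + t *\<^sub>R z"
      by (simp add: L_def vec_eq_iff) (simp add: scaleR_conv_of_real algebra_simps)
    also have "\<dots> \<in> U" by (rule convexD_alt[OF U]) (use that PU in auto)
    finally show ?thesis .
  qed
  have cP: "continuous_on U P" by (intro continuous_on_vec_nthI holo_continuous_on P)
  have cL: "continuous_on (U \<times> {0..1}) (\<lambda>p. pd i f (L (snd p) (fst p)))" for i
    by (rule continuous_on_compose2[OF holo_continuous_on[OF holo_pd[OF f]]])
       (use L in \<open>auto simp: L_def intro!: continuous_intros continuous_on_compose2[OF cP]\<close>)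
  have hL: "holo (\<lambda>z. pd i f (L t z)) U" if "t \<in> {0..1}" for i t
    by (rule holo_comp[OF holo_pd[OF f]])
       (use L that oU in \<open>auto simp: L_def intro!: holo_add holo_mult holo_diff holo_const holo_nth P\<close>)
  define g where "g i z = integral {0..1} (\<lambda>t. pd i f (L t z))" for i z
  show thesis
  proof (rule that)
    show "holo (g i) U" for i
      unfolding g_def by (rule holo_integral_param(1)) (use cL hL oU in \<open>auto simp: case_prod_beta\<close>)
  next
    fix z assume z: "z \<in> U"
    have int: "(\<lambda>t. pd i f (L t z)) integrable_on {0..1}" for i
    proof -
      have "continuous_on {0..1} (\<lambda>t. (\<lambda>p. pd i f (L (snd p) (fst p))) (z, t))"
        by (rule continuous_on_compose2[OF cL]) (use z in \<open>auto intro!: continuous_intros\<close>)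
      then show ?thesis by (simp add: integrable_continuous_interval)
    qed
    have d: "((\<lambda>t. f (L t z)) has_vector_derivative (\<Sum>i\<in>UNIV. pd i f (L t z) * (z - P z) $ i)) (at t within {0..1})"
      if "t \<in> {0..1}" for t
      using has_vector_derivative_real_field[OF cdiff_slice[of f "P z" "complex_of_real t" "z - P z"]]
        holoD[OF f L[OF that z]] unfolding L_def by simp
    have "((\<lambda>t. \<Sum>i\<in>UNIV. pd i f (L t z) * (z - P z) $ i) has_integral f (L 1 z) - f (L 0 z)) {0..1}"
      by (rule fundamental_theorem_of_calculus[OF _ d]) auto
    from integral_unique[OF this] have "f z - f (P z) = integral {0..1} (\<lambda>t. \<Sum>i\<in>UNIV. pd i f (L t z) * (z - P z) $ i)"
      by (simp add: L_def)
    also have "\<dots> = (\<Sum>i\<in>UNIV. (z - P z) $ i * g i z)"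
    proof -
      have "integral {0..1} (\<lambda>t. \<Sum>i\<in>UNIV. pd i f (L t z) * (z - P z) $ i) =
          (\<Sum>i\<in>UNIV. integral {0..1} (\<lambda>t. pd i f (L t z) * (z - P z) $ i))"
        by (rule integral_sum) (auto intro!: integrable_on_mult_left int)
      then show ?thesis by (simp only: integral_mult_left) (simp add: g_def mult.commute)
    qed
    finally show "f z - f (P z) = (\<Sum>i\<in>UNIV. (z - P z) $ i * g i z)" .
  next
    show "g i z = pd i f z" if "z \<in> U" "P z = z" for i z
      using that by (simp add: g_def L_def)
  qed
qed

text \<open>\<open>F\<close> is closed under the derivative in direction \<open>v\<close>, so the
  slice function \<open>t \<mapsto> f (z0 + t *s v)\<close> has all derivatives zero at
  \<open>0\<close>, and the identity theorem on the connected slice carries this to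
  \<open>t = 1\<close>. Assuming a whole family spares any formula for higher derivatives.\<close>

lemma vanish_along:
  fixes z0 v :: "complex ^ 'm::finite"
  assumes F: "\<And>h. h \<in> F \<Longrightarrow> holo h W \<and> h z0 = 0"
    and D: "\<And>h. h \<in> F \<Longrightarrow> (\<lambda>z. \<Sum>i\<in>UNIV. pd i h z * v $ i) \<in> F"
    and W: "open W" "convex W" "z0 \<in> W" "z0 + v \<in> W" and f: "f \<in> F"
  shows "f (z0 + v) = 0"
proof -
  define S where "S = (\<lambda>t. z0 + t *s v) -` W"
  have S: "open S" unfolding S_def
    by (rule open_vimage[OF W(1)]) (intro continuous_intros)
  have "convex S"
    unfolding convex_def
  proof (intro ballI allI impI)
    fix x y :: complex and a b :: real
    assume *: "x \<in> S" "y \<in> S" "0 \<le> a" "0 \<le> b" "a + b = 1"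
    have "z0 + (a *\<^sub>R x + b *\<^sub>R y) *s v = a *\<^sub>R (z0 + x *s v) + b *\<^sub>R (z0 + y *s v)"
      using *(5) by (simp add: vec_eq_iff algebra_simps flip: scaleR_add_left)
    then show "a *\<^sub>R x + b *\<^sub>R y \<in> S"
      using convexD[OF W(2), of "z0 + x *s v" "z0 + y *s v" a b] * by (simp add: S_def)
  qed
  then have con: "connected S" by (rule convex_connected)
  have in_W: "z0 + t *s v \<in> W" if "t \<in> S" for t using that by (simp add: S_def)
  have 01: "0 \<in> S" "1 \<in> S" using W by (auto simp: S_def)
  define DD where "DD h z = (\<Sum>i\<in>UNIV. pd i h z * v $ i)" for h z
  have DF: "(DD ^^ k) h \<in> F" if "h \<in> F" for h k
    by (induction k) (use that D in \<open>auto simp: DD_def[abs_def]\<close>)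
  let ?g = "\<lambda>h t. h (z0 + t *s v)"
  have der: "(?g h has_field_derivative ?g (DD h) t) (at t)" if "h \<in> F" "t \<in> S" for h t
    unfolding DD_def by (rule cdiff_slice, rule holoD[of h W]) (use F in_W that in auto)
  have ders: "(deriv ^^ k) (?g f) t = ?g ((DD ^^ k) f) t" if "t \<in> S" for k t
    using that
  proof (induction k arbitrary: t)
    case (Suc k)
    have "(deriv ^^ Suc k) (?g f) t = deriv (?g ((DD ^^ k) f)) t"
    proof (simp, rule deriv_cong_ev)
      show "\<forall>\<^sub>F x in nhds t. (deriv ^^ k) (?g f) x = ?g ((DD ^^ k) f) x"
        using Suc eventually_nhds_in_open[OF S, of t] by (auto elim!: eventually_mono)
    qed simp
    also have "\<dots> = ?g (DD ((DD ^^ k) f)) t"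
      by (rule DERIV_imp_deriv[OF der[OF DF[OF f] Suc.prems]])
    finally show ?case by simp
  qed simp
  have hol: "?g f holomorphic_on S"
    unfolding holomorphic_on_open[OF S] using der f by blast
  have "?g f 1 = 0"
    by (rule holomorphic_fun_eq_0_on_connected[OF hol S con _ 01]) (use ders[OF 01(1)] F DF f in auto)
  then show ?thesis by simp
qed

text \<open>Approach \<open>z\<close> along the \<open>k\<close>-th axis. For \<open>z\<close> in a
  subspace on which the \<open>k\<close>-th coordinate is fixed, the points used lie off it, so
  identities pass from the complement to the subspace.\<close>

lemma isCont_zero_off:
  fixes h :: "complex ^ 'm::finite \<Rightarrow> complex"
  assumes h: "isCont h z" and r: "0 < r" and 0: "\<And>w. w \<in> ball z r \<Longrightarrow> w $ k \<noteq> z $ k \<Longrightarrow> h w = 0"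
  shows "h z = 0"
proof -
  have c: "isCont (\<lambda>t::complex. z + t *s axis k 1) 0"
  proof -
    have "continuous_on UNIV (\<lambda>t::complex. z + t *s axis k 1)"
      by (intro continuous_intros)
    then show ?thesis by (simp add: continuous_on_eq_continuous_at)
  qed
  have "isCont (\<lambda>t::complex. h (z + t *s axis k 1)) 0"
    by (rule isCont_o2[OF c]) (use h in simp)
  then have "((\<lambda>t::complex. h (z + t *s axis k 1)) \<longlongrightarrow> h z) (at 0)"
    by (simp add: isCont_def)
  moreover have "\<forall>\<^sub>F t in at (0::complex). h (z + t *s axis k 1) = 0"
    unfolding eventually_at by (rule exI[of _ r]) (use r in \<open>auto intro!: 0 simp: dist_norm\<close>)
  then have "((\<lambda>t::complex. h (z + t *s axis k 1)) \<longlongrightarrow> 0) (at 0)"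
    by (rule tendsto_eventually)
  ultimately show ?thesis using tendsto_unique trivial_limit_at by blast
qed

text \<open>Cauchy integral in the \<open>i\<close>-th coordinate: the circle avoids the removed subspace even where \<open>z\<^sub>k = z0\<^sub>k\<close>.\<close>

lemma holo_hartogs:
  fixes f :: "complex ^ 'm::finite \<Rightarrow> complex"
  assumes f: "holo f (ball z0 (2 * r) - {z. z $ i = z0 $ i \<and> z $ k = z0 $ k})" and r: "0 < r" and ik: "i \<noteq> k"
  obtains F where "holo F (ball z0 r)"
    "\<And>z. z \<in> ball z0 r \<Longrightarrow> \<not> (z $ i = z0 $ i \<and> z $ k = z0 $ k) \<Longrightarrow> F z = f z"
proof -
  define W where "W = ball z0 (2 * r) - {z. z $ i = z0 $ i \<and> z $ k = z0 $ k}"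
  define R where "R z w = z + (w - z $ i) *s axis i 1" for z :: "complex ^ 'm" and w
  have R: "R z w $ i = w" "j \<noteq> i \<Longrightarrow> R z w $ j = z $ j" for z w j
    by (auto simp: R_def axis_def)
  \<comment> \<open>Why radius \<open>2 * r\<close>: moving \<open>z $ i\<close> to
    \<open>z0 $ i\<close> does not increase the distance from \<open>z0\<close>, and moving on to
    \<open>w\<close> adds at most \<open>r\<close>.\<close>
  have Rball: "R z w \<in> ball z0 (2 * r)" if "z \<in> ball z0 r" "w \<in> cball (z0 $ i) r" for z w
  proof -
    have "norm (R z (z0 $ i) - z0) \<le> norm (z - z0)"
      unfolding norm_vec_def by (rule L2_set_mono) (auto simp: R_def axis_def)
    moreover have "R z w - z0 = (R z (z0 $ i) - z0) + (w - z0 $ i) *s axis i 1"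
      by (simp add: R_def vec_eq_iff algebra_simps)
    then have "norm (R z w - z0) \<le> norm (R z (z0 $ i) - z0) + cmod (w - z0 $ i)"
      by (metis norm_smult_axis norm_triangle_ineq)
    ultimately show ?thesis using that by (simp add: dist_norm norm_minus_commute)
  qed
  have Rt: "R z (z0 $ i + r * cis t) \<in> W" if "z \<in> ball z0 r" for z t
  proof -
    have "z0 $ i + r * cis t \<in> cball (z0 $ i) r" using r by (simp add: dist_norm norm_mult)
    then show ?thesis using Rball[OF that] R(1) r by (auto simp: W_def)
  qed
  have ne: "z0 $ i + r * cis t - z $ i \<noteq> 0" if "z \<in> ball z0 r" for z t
  proof
    assume "z0 $ i + r * cis t - z $ i = 0"
    then have "(z - z0) $ i = r * cis t" by (simp add: algebra_simps)
    then have "cmod ((z - z0) $ i) = r" using r by (simp add: norm_mult)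
    then show False using that Finite_Cartesian_Product.norm_nth_le[of "z - z0" i] by (simp add: dist_norm norm_minus_commute)
  qed
  \<comment> \<open>The Cauchy integrand on the circle, with \<open>dw = \<i> r cis t dt\<close>;
    the \<open>\<i>\<close> cancels against that of \<open>2 pi \<i>\<close>, which leaves
    \<open>1 / (2 * pi)\<close> in \<open>F\<close>.\<close>
  define G where "G t z = f (R z (z0 $ i + r * cis t)) * ((r * cis t) / (z0 $ i + r * cis t - z $ i))" for t z
  have hG: "holo (G t) (ball z0 r)" for t
  proof -
    have "holo (\<lambda>z. f (R z (z0 $ i + r * cis t))) (ball z0 r)"
      by (rule holo_comp[OF f[folded W_def]])
         (use Rt in \<open>auto simp: R_def intro!: holo_add holo_mult holo_diff holo_const holo_nth\<close>)
    moreover have "holo (\<lambda>z. (r * cis t) / (z0 $ i + r * cis t - z $ i)) (ball z0 r)"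
      unfolding holo_cdiff using ne by (auto intro!: cdiff_divide cdiff_diff)
    ultimately show ?thesis unfolding G_def by (rule holo_mult)
  qed
  have "continuous_on (ball z0 r \<times> {0..2*pi}) (\<lambda>p. f (R (fst p) (z0 $ i + r * cis (snd p))))"
    by (rule continuous_on_compose2[OF holo_continuous_on[OF f[folded W_def]]])
      (use Rt in \<open>auto simp: R_def intro!: continuous_intros continuous_on_cis\<close>)
  then have cG: "continuous_on (ball z0 r \<times> {0..2*pi}) (\<lambda>(z, t). G t z)"
    unfolding G_def case_prod_beta
    by (intro continuous_intros continuous_on_cis) (use ne in auto)
  define F where "F z = 1 / (2 * pi) * integral {0..2*pi} (\<lambda>t. G t z)" for z
  have hF: "holo F (ball z0 r)"
    unfolding F_def by (rule holo_mult[OF holo_const[OF open_ball] holo_integral_param(1)[OF cG hG open_ball]])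
  have eq1: "F z = f z" if z: "z \<in> ball z0 r" and zk: "z $ k \<noteq> z0 $ k" for z
  proof -
    have inW: "R z w \<in> W" if "w \<in> cball (z0 $ i) r" for w
      using Rball[OF z that] R(2)[of k z w] ik zk by (auto simp: W_def)
    have d: "\<exists>D. ((\<lambda>w. f (R z w)) has_field_derivative D) (at w)" if "w \<in> cball (z0 $ i) r" for w
    proof -
      have eqR: "R z w = R z 0 + w *s axis i 1" for w
        by (simp add: R_def vec_eq_iff algebra_simps)
      have "cdiff f (R z 0 + w *s axis i 1)"
        using holoD[OF f[folded W_def] inW[OF that]] unfolding eqR[of w] .
      from cdiff_slice[OF this] show ?thesis unfolding eqR[symmetric] by blast
    qed
    have cont: "continuous_on (cball (z0 $ i) r) (\<lambda>w. f (R z w))"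
      by (rule continuous_at_imp_continuous_on) (use d DERIV_isCont in blast)
    have hol: "(\<lambda>w. f (R z w)) holomorphic_on ball (z0 $ i) r"
      using d by (auto simp: holomorphic_on_open)
    have zi: "cmod (z $ i - z0 $ i) < r"
      using z Finite_Cartesian_Product.norm_nth_le[of "z - z0" i] by (simp add: dist_norm norm_minus_commute)
    have "contour_integral (circlepath (z0 $ i) r) (\<lambda>u. f (R z u) / (u - z $ i)) = 2 * of_real pi * \<i> * f (R z (z $ i))"
      by (rule contour_integral_unique, rule Cauchy_integral_circlepath[OF cont hol zi])
    moreover have "contour_integral (circlepath (z0 $ i) r) (\<lambda>u. f (R z u) / (u - z $ i)) = integral {0..2*pi} (\<lambda>t. \<i> * G t z)"
      unfolding circle_integral G_def by (rule integral_cong) (simp add: mult_ac)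
    ultimately have "integral {0..2*pi} (\<lambda>t. \<i> * G t z) = 2 * of_real pi * \<i> * f (R z (z $ i))" by metis
    then have "integral {0..2*pi} (\<lambda>t. G t z) = 2 * of_real pi * f (R z (z $ i))"
      by (simp only: integral_mult_right) (simp add: field_simps)
    then show ?thesis by (simp add: F_def R_def)
  qed
  show thesis
  proof (rule that[OF hF])
    fix z assume z: "z \<in> ball z0 r" and n: "\<not> (z $ i = z0 $ i \<and> z $ k = z0 $ k)"
    show "F z = f z"
    proof (cases "z $ k = z0 $ k")
      case True
      have "z \<in> W" using z n r by (auto simp: W_def)
      then have ic: "isCont (\<lambda>z. F z - f z) z"
        using cdiff_isCont[OF cdiff_diff[OF holoD[OF hF z] holoD[OF f[folded W_def]]]] by simp
      obtain e where e: "0 < e" "ball z e \<subseteq> ball z0 r" using openE[OF open_ball z] by blast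
      have "F w - f w = 0" if "w \<in> ball z e" "w $ k \<noteq> z $ k" for w
        using eq1[of w] that e(2) True by auto
      with ic e(1) have "F z - f z = 0" by (rule isCont_zero_off)
      then show ?thesis by simp
    qed (rule eq1[OF z])
  qed
qed

text \<open>The Jacobian of \<open>\<Phi>\<close> is the identity except in row \<open>j\<close>,
  where it is the gradient of \<open>f\<close>; it is invertible as soon as the entry
  \<open>pd j f z0\<close> is nonzero.\<close>

lemma holo_inverse_coord:
  fixes f :: "complex ^ 'm::finite \<Rightarrow> complex"
  assumes f: "holo f U" and z0: "z0 \<in> U" and nz: "pd j f z0 \<noteq> 0"
  defines "\<Phi> \<equiv> \<lambda>z. (\<chi> k. if k = j then f z else z $ k)"
  obtains U' V' G where "open U'" "z0 \<in> U'" "U' \<subseteq> U" "open V'" "homeomorphism U' V' \<Phi> G"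
    "\<And>k. holo (\<lambda>w. G w $ k) V'"
proof -
  have oU: "open U" using f holo_open by blast
  define B where "B = Blinfun (\<lambda>v::complex ^ 'm. \<chi> k. if k = j then 0 else v $ k)"
  have "linear (\<lambda>v::complex ^ 'm. \<chi> k. if k = j then 0 else v $ k)"
    by (rule linearI) (auto simp: vec_eq_iff)
  then have B: "blinfun_apply B v = (\<chi> k. if k = j then 0 else v $ k)" for v
    by (simp add: B_def bounded_linear_Blinfun_apply linear_conv_bounded_linear)
  define E where "E = Blinfun (\<lambda>c. c *s (axis j 1 :: complex ^ 'm))"
  have "linear (\<lambda>c. c *s (axis j 1 :: complex ^ 'm))"
    by (rule linearI) (auto simp: vec_eq_iff algebra_simps)
  then have E: "blinfun_apply E c = c *s axis j 1" for c
    by (simp add: E_def bounded_linear_Blinfun_apply linear_conv_bounded_linear)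
  define D where "D z = B + (E o\<^sub>L cgrad (\<lambda>i. pd i f z))" for z
  have D: "blinfun_apply (D z) v = (\<chi> k. if k = j then \<Sum>i\<in>UNIV. pd i f z * v $ i else v $ k)" for z v
    by (simp add: D_def blinfun.add_left B E cgrad_apply vec_eq_iff axis_def)
  have contD: "continuous_on U D"
    unfolding D_def
    by (intro continuous_intros continuous_on_cgrad holo_continuous_on[OF holo_pd[OF f]])
  have der: "(\<Phi> has_derivative blinfun_apply (D z)) (at z)" if "z \<in> U" for z
  proof (rule has_derivative_vec)
    fix k
    show "((\<lambda>z. \<Phi> z $ k) has_derivative (\<lambda>v. blinfun_apply (D z) v $ k)) (at z)"
      using holoD[OF f that]
      by (cases "k = j") (auto simp: \<Phi>_def D cdiff_def cder_def bounded_linear_imp_has_derivative bounded_linear_vec_nth)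
  qed
  \<comment> \<open>Inverse of \<open>D z0\<close>: solve row \<open>j\<close> for the
    \<open>j\<close>-th entry and leave all other entries unchanged.\<close>
  define I where "I = Blinfun (\<lambda>v::complex ^ 'm. \<chi> k. if k = j then
      (v $ j - (\<Sum>i\<in>UNIV-{j}. pd i f z0 * v $ i)) * inverse (pd j f z0) else v $ k)"
  have "linear (\<lambda>v::complex ^ 'm. \<chi> k. if k = j then
      (v $ j - (\<Sum>i\<in>UNIV-{j}. pd i f z0 * v $ i)) * inverse (pd j f z0) else v $ k)"
    by (rule linearI) (simp_all add: vec_eq_iff, simp_all add: algebra_simps sum.distrib sum_distrib_left scaleR_conv_of_real)
  then have I: "blinfun_apply I v = (\<chi> k. if k = j then
      (v $ j - (\<Sum>i\<in>UNIV-{j}. pd i f z0 * v $ i)) * inverse (pd j f z0) else v $ k)" for v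
    by (simp add: I_def bounded_linear_Blinfun_apply linear_conv_bounded_linear)
  have ID: "I o\<^sub>L D z0 = id_blinfun"
  proof (rule blinfun_eqI)
    fix v :: "complex ^ 'm"
    have "(\<Sum>i\<in>UNIV. pd i f z0 * v $ i) = pd j f z0 * v $ j + (\<Sum>i\<in>UNIV-{j}. pd i f z0 * v $ i)"
      by (simp add: sum.remove)
    then show "blinfun_apply (I o\<^sub>L D z0) v = blinfun_apply id_blinfun v"
      using nz by (simp add: I D vec_eq_iff)
  qed
  obtain U' V' G G' where *: "open U'" "U' \<subseteq> U" "z0 \<in> U'" "open V'" "homeomorphism U' V' \<Phi> G"
    and G: "\<And>y. y \<in> V' \<Longrightarrow> (G has_derivative (G' y)) (at y)"
      "\<And>y. y \<in> V' \<Longrightarrow> G' y = inv (blinfun_apply (D (G y)))"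
      "\<And>y. y \<in> V' \<Longrightarrow> bij (blinfun_apply (D (G y)))"
    by (rule inverse_function_theorem[OF oU der contD z0 ID]) auto
  \<comment> \<open>The real inverse function theorem gives a real derivative of \<open>G\<close>;
    it is complex linear because it inverts a complex linear bijection.\<close>
  have "holo (\<lambda>w. G w $ k) V'" for k
    unfolding holo_def
  proof (intro conjI ballI exI)
    fix y assume y: "y \<in> V'"
    show "((\<lambda>w. G w $ k) has_derivative (\<lambda>v. G' y v $ k)) (at y)"
      using bounded_linear.has_derivative[OF bounded_linear_vec_nth G(1)[OF y]] .
    show "\<forall>c v. G' y (c *s v) $ k = c * G' y v $ k"
    proof (intro allI)
      fix c v
      let ?T = "blinfun_apply (D (G y))"
      have T: "?T (c *s w) = c *s ?T w" for w
        by (simp add: D vec_eq_iff sum_distrib_left mult_ac)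
      have "?T (G' y v) = v" by (simp add: G(2)[OF y] bij_is_surj[OF G(3)[OF y]] surj_f_inv_f)
      then have "?T (c *s G' y v) = c *s v" using T by metis
      then have "G' y (c *s v) = c *s G' y v" by (metis G(2)[OF y] G(3)[OF y] bij_is_inj inv_f_f)
      then show "G' y (c *s v) $ k = c * G' y v $ k" by simp
    qed
  qed (use * in auto)
  with * show thesis using that by blast
qed

section \<open>Top-degree forms\<close>

text \<open>\<open>wedge\<close> for arguments of any type, so that tangent vectors can be replaced by their coordinate vectors.\<close>

definition gwedge :: "nat \<Rightarrow> nat \<Rightarrow> ((nat \<Rightarrow> 'v) \<Rightarrow> complex) \<Rightarrow> ((nat \<Rightarrow> 'v) \<Rightarrow> complex) \<Rightarrow> (nat \<Rightarrow> 'v) \<Rightarrow> complex" where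
  "gwedge k l \<omega> \<eta> v =
     (\<Sum>\<sigma> | \<sigma> permutes {..<k + l}.
        of_int (sign \<sigma>) * \<omega> (\<lambda>i. v (\<sigma> i)) * \<eta> (\<lambda>i. v (\<sigma> (k + i)))) / (fact k * fact l)"

primrec gpower :: "((nat \<Rightarrow> 'v) \<Rightarrow> complex) \<Rightarrow> nat \<Rightarrow> (nat \<Rightarrow> 'v) \<Rightarrow> complex" where
  "gpower \<omega> 0 = (\<lambda>v. 1)"
| "gpower \<omega> (Suc n) = gwedge 2 (2 * n) \<omega> (gpower \<omega> n)"

text \<open>Forms take infinite sequences, so dependence on the first \<open>d\<close> entries alone
  is demanded along with linearity in each of them.\<close>

definition mlin :: "nat \<Rightarrow> ((nat \<Rightarrow> complex ^ 'm::finite) \<Rightarrow> complex) \<Rightarrow> bool" where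
  "mlin d F \<longleftrightarrow> (\<forall>v w. (\<forall>i<d. v i = w i) \<longrightarrow> F v = F w) \<and>
     (\<forall>v i x y c. i < d \<longrightarrow> F (v(i := c *s x + y)) = c * F (v(i := x)) + F (v(i := y)))"

definition alternating :: "nat \<Rightarrow> ((nat \<Rightarrow> 'v) \<Rightarrow> complex) \<Rightarrow> bool" where
  "alternating d F \<longleftrightarrow> (\<forall>\<tau> v. \<tau> permutes {..<d} \<longrightarrow> F (\<lambda>i. v (\<tau> i)) = of_int (sign \<tau>) * F v)"

lemma mlin_dep: "mlin d F \<Longrightarrow> (\<And>i. i < d \<Longrightarrow> v i = w i) \<Longrightarrow> F v = F w"
  by (auto simp: mlin_def)

lemma mlin_lin: "mlin d F \<Longrightarrow> i < d \<Longrightarrow> F (v(i := c *s x + y)) = c * F (v(i := x)) + F (v(i := y))"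
  by (auto simp: mlin_def)

lemma mlin_zero: "mlin d F \<Longrightarrow> i < d \<Longrightarrow> F (v(i := 0)) = 0"
  using mlin_lin[of d F i v 1 0 0] by simp

lemma mlin_sum:
  assumes "mlin d F" "i < d"
  shows "F (v(i := (\<Sum>k\<in>K. c k *s x k))) = (\<Sum>k\<in>K. c k * F (v(i := x k)))"
proof (induction K rule: infinite_finite_induct)
  case (insert k K)
  then show ?case by (simp only: sum.insert mlin_lin[OF assms] not_False_eq_True)
qed (simp_all only: sum.infinite sum.empty mlin_zero[OF assms] not_False_eq_True)

lemma permutes_lessThan: "\<sigma> permutes {..<d} \<Longrightarrow> i < d \<Longrightarrow> \<sigma> i < (d::nat)"
  using permutes_in_image[of \<sigma> "{..<d}" i] by simp

lemma mlin_gwedge: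
  assumes \<omega>: "mlin k \<omega>" and \<eta>: "mlin l \<eta>"
  shows "mlin (k + l) (gwedge k l \<omega> \<eta>)"
  unfolding mlin_def
proof (intro conjI allI impI)
  fix v w :: "nat \<Rightarrow> complex ^ 'a" assume vw: "\<forall>i<k + l. v i = w i"
  have "\<omega> (\<lambda>i. v (\<sigma> i)) = \<omega> (\<lambda>i. w (\<sigma> i))" "\<eta> (\<lambda>i. v (\<sigma> (k + i))) = \<eta> (\<lambda>i. w (\<sigma> (k + i)))"
    if "\<sigma> permutes {..<k + l}" for \<sigma>
    using permutes_lessThan[OF that] vw by (auto intro!: mlin_dep[OF \<omega>] mlin_dep[OF \<eta>])
  then show "gwedge k l \<omega> \<eta> v = gwedge k l \<omega> \<eta> w"
    by (simp add: gwedge_def cong: sum.cong_simp)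
next
  fix v :: "nat \<Rightarrow> complex ^ 'a" and i x y c
  assume i: "i < k + l"
  define T where "T \<sigma> v = \<omega> (\<lambda>i. v (\<sigma> i)) * \<eta> (\<lambda>i. v (\<sigma> (k + i)))" for \<sigma> and v :: "nat \<Rightarrow> complex ^ 'a"
  have T: "T \<sigma> (v(i := c *s x + y)) = c * T \<sigma> (v(i := x)) + T \<sigma> (v(i := y))"
    if \<sigma>: "\<sigma> permutes {..<k + l}" for \<sigma>
  proof -
    obtain j where j: "\<sigma> j = i" using permutes_surj[OF \<sigma>] by (metis surjD)
    have inj: "\<sigma> a = i \<longleftrightarrow> a = j" for a using permutes_inj[OF \<sigma>] j by (metis injD)
    have jl: "j < k + l" using permutes_in_image[OF \<sigma>, of j] j i by simp
    have 1: "(\<lambda>i'. (v(i := z)) (\<sigma> i')) = (\<lambda>i'. v (\<sigma> i'))(j := z)" for z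
      by (auto simp: inj fun_eq_iff)
    show ?thesis
    proof (cases "j < k")
      case True
      then have "(\<lambda>i'. (v(i := z)) (\<sigma> (k + i'))) = (\<lambda>i'. v (\<sigma> (k + i')))" for z
        by (auto simp: inj fun_eq_iff)
      then show ?thesis unfolding T_def 1 mlin_lin[OF \<omega> True] by (simp only: algebra_simps)
    next
      case False
      have 2: "(\<lambda>i'. (v(i := z)) (\<sigma> (k + i'))) = (\<lambda>i'. v (\<sigma> (k + i')))(j - k := z)" for z
        using False by (auto simp: inj fun_eq_iff)
      have 3: "\<omega> (\<lambda>i'. (v(i := z)) (\<sigma> i')) = \<omega> (\<lambda>i'. v (\<sigma> i'))" for z
        using False by (intro mlin_dep[OF \<omega>]) (auto simp: inj)
      have 4: "j - k < l" using False jl by simp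
      show ?thesis unfolding T_def 2 3 mlin_lin[OF \<eta> 4] by (simp only: algebra_simps)
    qed
  qed
  have "gwedge k l \<omega> \<eta> v = (\<Sum>\<sigma> | \<sigma> permutes {..<k + l}. of_int (sign \<sigma>) * T \<sigma> v) / (fact k * fact l)" for v
    by (simp add: gwedge_def T_def mult.assoc)
  then show "gwedge k l \<omega> \<eta> (v(i := c *s x + y)) = c * gwedge k l \<omega> \<eta> (v(i := x)) + gwedge k l \<omega> \<eta> (v(i := y))"
    using T by (simp add: sum.distrib sum_distrib_left add_divide_distrib algebra_simps cong: sum.cong_simp)
qed

lemma permutes_permutation: "\<sigma> permutes {..<d::nat} \<Longrightarrow> permutation \<sigma>"
  using permutation_permutes by blast

text \<open>Reindexing the defining sum by composition with \<open>\<tau>\<close> on the left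
  multiplies every sign by that of \<open>\<tau>\<close>.\<close>

lemma alternating_gwedge: "alternating (k + l) (gwedge k l \<omega> \<eta>)"
  unfolding alternating_def
proof (intro allI impI)
  fix \<tau> and v :: "nat \<Rightarrow> 'a"
  assume \<tau>: "\<tau> permutes {..<k + l}"
  define T where "T \<sigma> = \<omega> (\<lambda>i. v (\<sigma> i)) * \<eta> (\<lambda>i. v (\<sigma> (k + i)))" for \<sigma> :: "nat \<Rightarrow> nat"
  have s: "(of_int (sign \<tau>) :: complex) * of_int (sign \<tau>) = 1"
    by (simp add: sign_def)
  have "(\<Sum>\<sigma> | \<sigma> permutes {..<k + l}. of_int (sign \<sigma>) * T \<sigma>)
      = (\<Sum>\<sigma> | \<sigma> permutes {..<k + l}. of_int (sign (\<tau> \<circ> \<sigma>)) * T (\<tau> \<circ> \<sigma>))"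
    by (rule setum_permutations_compose_left[OF \<tau>])
  also have "\<dots> = (\<Sum>\<sigma> | \<sigma> permutes {..<k + l}. of_int (sign \<tau>) * (of_int (sign \<sigma>) * T (\<tau> \<circ> \<sigma>)))"
    by (rule sum.cong) (auto simp: sign_compose[OF permutes_permutation[OF \<tau>] permutes_permutation] mult.assoc)
  also have "\<dots> = of_int (sign \<tau>) * (\<Sum>\<sigma> | \<sigma> permutes {..<k + l}. of_int (sign \<sigma>) * T (\<tau> \<circ> \<sigma>))"
    by (simp add: sum_distrib_left)
  finally have "of_int (sign \<tau>) * (\<Sum>\<sigma> | \<sigma> permutes {..<k + l}. of_int (sign \<sigma>) * T \<sigma>)
      = (\<Sum>\<sigma> | \<sigma> permutes {..<k + l}. of_int (sign \<sigma>) * T (\<tau> \<circ> \<sigma>))"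
    by (simp only: s mult.assoc[symmetric] mult_1)
  then show "gwedge k l \<omega> \<eta> (\<lambda>i. v (\<tau> i)) = of_int (sign \<tau>) * gwedge k l \<omega> \<eta> v"
    by (simp add: gwedge_def T_def o_def mult.assoc)
qed

lemma alternating_eq_zero:
  assumes F: "alternating d F" and ij: "i < d" "j < d" "i \<noteq> j" "v i = v j"
  shows "F v = 0"
proof -
  have "Transposition.transpose i j permutes {..<d}" using ij by (intro permutes_swap_id) auto
  moreover have "(\<lambda>k. v (Transposition.transpose i j k)) = v" using ij by (auto simp: Transposition.transpose_def fun_eq_iff)
  ultimately have "F v = of_int (sign (Transposition.transpose i j)) * F v"
    using F unfolding alternating_def by metis
  then show ?thesis using ij by (simp add: sign_swap_id)
qed

text \<open>Expand one argument after the other in the standard basis: if the sum is nonzero, so is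
  some summand.\<close>

lemma mlin_expand:
  assumes F: "mlin d F" and nz: "F v \<noteq> 0"
  obtains \<kappa> where "F (\<lambda>i. axis (\<kappa> i) 1) \<noteq> 0"
proof -
  have "\<exists>\<kappa>. F (\<lambda>i. if i < j then axis (\<kappa> i) 1 else v i) \<noteq> 0" if "j \<le> d" for j
    using that
  proof (induction j)
    case (Suc j)
    then obtain \<kappa> where \<kappa>: "F (\<lambda>i. if i < j then axis (\<kappa> i) 1 else v i) \<noteq> 0" by auto
    let ?w = "\<lambda>i. if i < j then axis (\<kappa> i) 1 else v i"
    have "?w = ?w(j := (\<Sum>k\<in>UNIV. v j $ k *s axis k 1))" by (auto simp: basis_expansion)
    then have "F ?w = (\<Sum>k\<in>UNIV. v j $ k * F (?w(j := axis k 1)))"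
      using mlin_sum[OF F, of j ?w "\<lambda>k. v j $ k" "\<lambda>k. axis k 1" UNIV] Suc.prems by simp
    then obtain k where "F (?w(j := axis k 1)) \<noteq> 0"
      using \<kappa> by (metis (mono_tags, lifting) mult_zero_right sum.neutral)
    moreover have "?w(j := axis k 1) = (\<lambda>i. if i < Suc j then axis ((\<kappa>(j := k)) i) 1 else v i)"
      by (auto simp: less_Suc_eq)
    ultimately show ?case by metis
  qed (use nz in simp)
  then obtain \<kappa> where "F (\<lambda>i. if i < d then axis (\<kappa> i) 1 else v i) \<noteq> 0" by blast
  moreover have "F (\<lambda>i. if i < d then axis (\<kappa> i) 1 else v i) = F (\<lambda>i. axis (\<kappa> i) 1)"
    by (rule mlin_dep[OF F]) simp
  ultimately show thesis using that by metis
qed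

text \<open>Expansion gives basis vectors with nonzero value; alternation makes their indices
  distinct, and \<open>d\<close> distinct indices out of \<open>d\<close> are a rearrangement of
  \<open>e\<close>. So nonvanishing of a top form is a condition on a single number.\<close>

lemma top_form_basis_nonzero:
  fixes F :: "(nat \<Rightarrow> complex ^ 'm::finite) \<Rightarrow> complex"
  assumes F: "mlin d F" "alternating d F" and e: "bij_betw e {..<d} (UNIV :: 'm set)" and nz: "F v \<noteq> 0"
  shows "F (\<lambda>i. axis (e i) 1) \<noteq> 0"
proof -
  obtain \<kappa> where \<kappa>: "F (\<lambda>i. axis (\<kappa> i) 1) \<noteq> 0" using mlin_expand[OF F(1) nz] .
  have inj: "inj_on \<kappa> {..<d}"
  proof (rule inj_onI, rule ccontr)
    fix i j assume "i \<in> {..<d}" "j \<in> {..<d}" "\<kappa> i = \<kappa> j" "i \<noteq> j"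
    then show False using alternating_eq_zero[OF F(2), of i j "\<lambda>i. axis (\<kappa> i) 1"] \<kappa> by simp
  qed
  \<comment> \<open>The identity from \<open>d\<close> on, so that \<open>\<tau>\<close>, as a
    function on all of \<open>nat\<close>, permutes \<open>{..<d}\<close>.\<close>
  define \<tau> where "\<tau> i = (if i < d then inv_into {..<d} e (\<kappa> i) else i)" for i
  have e\<tau>: "e (\<tau> i) = \<kappa> i" "\<tau> i < d" if "i < d" for i
    using that e by (auto simp: \<tau>_def bij_betw_def f_inv_into_f)
      (metis UNIV_I inv_into_into lessThan_iff)
  have inj\<tau>: "inj_on \<tau> {..<d}"
    by (rule inj_onI) (metis e\<tau>(1) inj inj_on_def lessThan_iff)
  have "\<tau> permutes {..<d}"
  proof (rule bij_imp_permutes)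
    show "bij_betw \<tau> {..<d} {..<d}"
      using inj\<tau> e\<tau>(2) endo_inj_surj[of "{..<d}" \<tau>] by (auto simp: bij_betw_def)
  qed (simp add: \<tau>_def)
  then have "F (\<lambda>i. axis (e (\<tau> i)) 1) = of_int (sign \<tau>) * F (\<lambda>i. axis (e i) 1)"
    using F(2)[unfolded alternating_def, rule_format, of \<tau> "\<lambda>i. axis (e i) 1"] by simp
  moreover have "F (\<lambda>i. axis (e (\<tau> i)) 1) = F (\<lambda>i. axis (\<kappa> i) 1)"
    by (rule mlin_dep[OF F(1)]) (simp add: e\<tau>)
  ultimately show ?thesis using \<kappa> by auto
qed

section \<open>The top form \<open>a \<and> \<omega>^n\<close> and its behaviour under
  scaling\<close>

definition pair :: "('m \<Rightarrow> complex) \<Rightarrow> complex ^ 'm::finite \<Rightarrow> complex" where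
  "pair a x = (\<Sum>i\<in>UNIV. a i * x $ i)"

lemma pair_lin: "pair a (c *s x + y) = c * pair a x + pair a y"
  by (simp add: pair_def algebra_simps sum.distrib sum_distrib_left)

lemma pair_scale: "pair (\<lambda>i. h * a i) x = h * pair a x"
  by (simp add: pair_def algebra_simps sum_distrib_left)

definition top_form :: "nat \<Rightarrow> ('m \<Rightarrow> complex) \<Rightarrow> ((nat \<Rightarrow> complex ^ 'm::finite) \<Rightarrow> complex) \<Rightarrow>
    (nat \<Rightarrow> complex ^ 'm) \<Rightarrow> complex" where
  "top_form n a \<omega> = gwedge 1 (2 * n) (\<lambda>u. pair a (u 0)) (gpower \<omega> n)"

lemma mlin_gpower: "mlin 2 \<omega> \<Longrightarrow> mlin (2 * n) (gpower \<omega> n)"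
proof (induction n)
  case (Suc n)
  then show ?case using mlin_gwedge[of 2 \<omega> "2 * n" "gpower \<omega> n"] by simp
qed (simp add: mlin_def)

lemma mlin_top_form:
  assumes "mlin 2 \<omega>"
  shows "mlin (2 * n + 1) (top_form n a \<omega>)"
proof -
  have "mlin 1 (\<lambda>u. pair a (u 0))" by (auto simp: mlin_def pair_lin)
  from mlin_gwedge[OF this mlin_gpower[OF assms]] show ?thesis by (simp add: top_form_def)
qed

lemma alternating_top_form: "alternating (2 * n + 1) (top_form n a \<omega>)"
  using alternating_gwedge[of 1 "2 * n"] by (simp add: top_form_def)

text \<open>Each of the \<open>n\<close> factors is evaluated on some of the \<open>v i\<close>,
  which lie in the kernel of \<open>a\<close>, and so contributes one \<open>h\<close>.\<close>

lemma gpower_kernel: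
  assumes "\<And>u. pair a (u 0) = 0 \<Longrightarrow> pair a (u 1) = 0 \<Longrightarrow> \<omega>' u = h * \<omega> u"
    and "\<And>i. i < 2 * n \<Longrightarrow> pair a (v i) = 0"
  shows "gpower \<omega>' n v = h ^ n * gpower \<omega> n v"
  using assms(2)
proof (induction n arbitrary: v)
  case (Suc n)
  have "\<omega>' (\<lambda>i. v (\<sigma> i)) * gpower \<omega>' n (\<lambda>i. v (\<sigma> (2 + i)))
      = h ^ Suc n * (\<omega> (\<lambda>i. v (\<sigma> i)) * gpower \<omega> n (\<lambda>i. v (\<sigma> (2 + i))))"
    if \<sigma>: "\<sigma> permutes {..<2 + 2 * n}" for \<sigma>
  proof -
    have k: "pair a (v (\<sigma> i)) = 0" if "i < 2 + 2 * n" for i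
      using Suc.prems[of "\<sigma> i"] permutes_lessThan[OF \<sigma> that] by simp
    have "\<omega>' (\<lambda>i. v (\<sigma> i)) = h * \<omega> (\<lambda>i. v (\<sigma> i))" using k by (intro assms(1)) auto
    moreover have "gpower \<omega>' n (\<lambda>i. v (\<sigma> (2 + i))) = h ^ n * gpower \<omega> n (\<lambda>i. v (\<sigma> (2 + i)))"
      using k by (intro Suc.IH) auto
    ultimately show ?thesis by simp
  qed
  then show ?case
    by (simp add: gwedge_def sum_distrib_left mult.assoc mult.left_commute[of "of_int _"] cong: sum.cong_simp)
qed simp

text \<open>A column operation: adding a multiple of \<open>v 0\<close> to another argument adds a
  term with a repeated argument. The bound \<open>j\<close> is there for the induction; the case of
  interest is \<open>j = d\<close>.\<close>

lemma alternating_shear: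
  fixes F :: "(nat \<Rightarrow> complex ^ 'm::finite) \<Rightarrow> complex"
  assumes F: "mlin d F" "alternating d F" and "j \<le> d"
  shows "F (\<lambda>i. if 0 < i \<and> i < j then c i *s v 0 + v i else v i) = F v"
  using assms(3)
proof (induction j)
  case (Suc j)
  let ?w = "\<lambda>i. if 0 < i \<and> i < j then c i *s v 0 + v i else v i"
  have eq: "(\<lambda>i. if 0 < i \<and> i < Suc j then c i *s v 0 + v i else v i)
      = (if j = 0 then ?w else ?w(j := c j *s v 0 + v j))"
    by (auto simp: less_Suc_eq fun_eq_iff)
  have "F (?w(j := c j *s v 0 + v j)) = F ?w" if "0 < j"
  proof -
    have "F (?w(j := c j *s v 0 + v j)) = c j * F (?w(j := v 0)) + F (?w(j := v j))"
      using Suc.prems by (intro mlin_lin[OF F(1)]) auto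
    also have "F (?w(j := v 0)) = 0"
      by (rule alternating_eq_zero[OF F(2), of 0 j]) (use that Suc.prems in auto)
    also have "?w(j := v j) = ?w" by auto
    finally show ?thesis by (simp only: mult_zero_right add_0)
  qed
  then show ?case unfolding eq using Suc by auto
qed simp

text \<open>Applied to \<open>d(h\<alpha>) = dh \<and> \<alpha> + h d\<alpha>\<close>, whose first summand vanishes on the kernel of \<open>\<alpha>\<close>.\<close>

lemma top_form_scale:
  assumes \<omega>: "mlin 2 \<omega>" and \<omega>': "mlin 2 \<omega>'"
    and k: "\<And>u. pair a (u 0) = 0 \<Longrightarrow> pair a (u 1) = 0 \<Longrightarrow> \<omega>' u = h * \<omega> u"
  shows "top_form n (\<lambda>i. h * a i) \<omega>' v = h ^ (n + 1) * top_form n a \<omega> v"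
proof -
  define F where "F = top_form n a \<omega>"
  define F' where "F' = top_form n (\<lambda>i. h * a i) \<omega>'"
  define d where "d = 2 * n + 1"
  have F: "mlin d F" "alternating d F" and F': "mlin d F'" "alternating d F'"
    using mlin_top_form[OF \<omega>] mlin_top_form[OF \<omega>'] alternating_top_form
    by (auto simp: F_def F'_def d_def)
  \<comment> \<open>Only permutations with \<open>\<sigma> 0 = 0\<close> count, since otherwise
    \<open>pair a\<close> meets a kernel vector. In the remaining terms all arguments of the power
    lie in the kernel.\<close>
  have 1: "F' v = h ^ (n + 1) * F v" if ker: "\<And>i. 0 < i \<Longrightarrow> i < d \<Longrightarrow> pair a (v i) = 0" for v
  proof -
    have "pair (\<lambda>i. h * a i) (v (\<sigma> 0)) * gpower \<omega>' n (\<lambda>i. v (\<sigma> (1 + i)))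
        = h ^ (n + 1) * (pair a (v (\<sigma> 0)) * gpower \<omega> n (\<lambda>i. v (\<sigma> (1 + i))))"
      if \<sigma>: "\<sigma> permutes {..<1 + 2 * n}" for \<sigma>
    proof (cases "\<sigma> 0 = 0")
      case True
      have "gpower \<omega>' n (\<lambda>i. v (\<sigma> (1 + i))) = h ^ n * gpower \<omega> n (\<lambda>i. v (\<sigma> (1 + i)))"
      proof (rule gpower_kernel[OF k])
        fix i assume "i < 2 * n"
        then have "\<sigma> (1 + i) < d" using permutes_lessThan[OF \<sigma>, of "1 + i"] by (simp add: d_def)
        moreover have "\<sigma> (1 + i) \<noteq> 0" using permutes_inj[OF \<sigma>] True by (metis add_is_0 injD one_neq_zero)
        ultimately show "pair a (v (\<sigma> (1 + i))) = 0" using ker by simp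
      qed
      then show ?thesis by (simp add: pair_scale)
    next
      case False
      then have "pair a (v (\<sigma> 0)) = 0"
        using ker permutes_lessThan[OF \<sigma>, of 0] by (simp add: d_def)
      then show ?thesis by (simp add: pair_scale)
    qed
    then show ?thesis
      by (simp add: F_def F'_def top_form_def gwedge_def sum_distrib_left mult.assoc
          mult.left_commute[of "of_int _"] cong: sum.cong_simp)
  qed
  have 2: "F' v = h ^ (n + 1) * F v" if nz: "pair a (v 0) \<noteq> 0" for v
  proof -
    \<comment> \<open>Chosen so that \<open>c i *s v 0 + v i\<close> lies in the kernel of
      \<open>a\<close>; the shear then reduces to case \<open>1\<close>.\<close>
    define c where "c i = - pair a (v i) / pair a (v 0)" for i
    let ?w = "\<lambda>i. if 0 < i \<and> i < d then c i *s v 0 + v i else v i"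
    have "F' ?w = h ^ (n + 1) * F ?w"
    proof (rule 1)
      fix i assume "0 < i" "i < d"
      moreover have "pair a (c i *s v 0 + v i) = 0" unfolding pair_lin using nz by (simp add: c_def)
      ultimately show "pair a (?w i) = 0" by simp
    qed
    then show ?thesis using alternating_shear[OF F] alternating_shear[OF F'] by simp
  qed
  have "F' v = h ^ (n + 1) * F v"
  proof (cases "\<exists>i<d. pair a (v i) \<noteq> 0")
    case True
    then obtain i where i: "i < d" "pair a (v i) \<noteq> 0" by blast
    \<comment> \<open>Move an argument outside the kernel to position \<open>0\<close>; both sides
      change by the same sign.\<close>
    have \<tau>: "Transposition.transpose 0 i permutes {..<d}" using i by (intro permutes_swap_id) (auto simp: d_def)
    have "F' (\<lambda>j. v (Transposition.transpose 0 i j)) = h ^ (n + 1) * F (\<lambda>j. v (Transposition.transpose 0 i j))"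
      by (rule 2) (use i in simp)
    then have "of_int (sign (Transposition.transpose 0 i)) * F' v = of_int (sign (Transposition.transpose 0 i)) * (h ^ (n + 1) * F v)"
      using F(2)[unfolded alternating_def, rule_format, OF \<tau>, of v]
        F'(2)[unfolded alternating_def, rule_format, OF \<tau>, of v] by (simp add: mult.left_commute)
    then show ?thesis by (simp add: sign_def split: if_splits)
  qed (use 1 in auto)
  then show ?thesis by (simp add: F_def F'_def)
qed

section \<open>Contact forms in coordinates\<close>

definition dform :: "('m \<Rightarrow> complex ^ 'm::finite \<Rightarrow> complex) \<Rightarrow> complex ^ 'm \<Rightarrow> (nat \<Rightarrow> complex ^ 'm) \<Rightarrow> complex" where
  "dform a z u = (\<Sum>i\<in>UNIV. pair (\<lambda>k. pd k (a i) z) (u 0) * u 1 $ i - pair (\<lambda>k. pd k (a i) z) (u 1) * u 0 $ i)"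

definition contact_form :: "nat \<Rightarrow> ('m \<Rightarrow> complex ^ 'm::finite \<Rightarrow> complex) \<Rightarrow> complex ^ 'm \<Rightarrow> (nat \<Rightarrow> complex ^ 'm) \<Rightarrow> complex" where
  "contact_form n a z = top_form n (\<lambda>i. a i z) (dform a z)"

lemma mlin_dform: "mlin 2 (dform a z)"
  unfolding mlin_def
proof (intro conjI allI impI)
  fix v :: "nat \<Rightarrow> complex ^ 'a" and i :: nat and x y c
  assume "i < 2"
  then consider "i = 0" | "i = 1" by linarith
  then show "dform a z (v(i := c *s x + y)) = c * dform a z (v(i := x)) + dform a z (v(i := y))"
  proof cases
    case 1
    then show ?thesis
      unfolding dform_def pair_lin sum_distrib_left sum.distrib[symmetric]
      by (intro sum.cong) (simp_all add: pair_lin, simp_all add: algebra_simps)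
  next
    case 2
    then show ?thesis
      unfolding dform_def pair_lin sum_distrib_left sum.distrib[symmetric]
      by (intro sum.cong) (simp_all add: pair_lin, simp_all add: algebra_simps)
  qed
qed (auto simp: dform_def)

lemma dform_scale:
  assumes h: "cdiff h z" and a: "\<And>i. cdiff (a i) z"
  shows "dform (\<lambda>i z. h z * a i z) z u = h z * dform a z u +
     (pair (\<lambda>k. pd k h z) (u 0) * pair (\<lambda>i. a i z) (u 1) - pair (\<lambda>k. pd k h z) (u 1) * pair (\<lambda>i. a i z) (u 0))"
proof -
  have "pair (\<lambda>k. pd k (\<lambda>z. h z * a i z) z) x = a i z * pair (\<lambda>k. pd k h z) x + h z * pair (\<lambda>k. pd k (a i) z) x" for i x
    by (simp add: pd_mult[OF h a] pair_def algebra_simps sum.distrib sum_distrib_left)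
  then have "dform (\<lambda>i z. h z * a i z) z u =
      (\<Sum>i\<in>UNIV. (pair (\<lambda>k. pd k h z) (u 0) * (a i z * u 1 $ i) - pair (\<lambda>k. pd k h z) (u 1) * (a i z * u 0 $ i)) +
        h z * (pair (\<lambda>k. pd k (a i) z) (u 0) * u 1 $ i - pair (\<lambda>k. pd k (a i) z) (u 1) * u 0 $ i))"
    unfolding dform_def by (intro sum.cong) (auto simp: algebra_simps)
  also have "\<dots> = (pair (\<lambda>k. pd k h z) (u 0) * pair (\<lambda>i. a i z) (u 1) - pair (\<lambda>k. pd k h z) (u 1) * pair (\<lambda>i. a i z) (u 0))
      + h z * dform a z u"
    unfolding dform_def pair_def[of "\<lambda>i. a i z"] by (simp add: sum.distrib sum_subtractf flip: sum_distrib_left)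
  finally show ?thesis by simp
qed

lemma contact_form_scale:
  assumes h: "cdiff h z" and a: "\<And>i. cdiff (a i) z"
  shows "contact_form n (\<lambda>i z. h z * a i z) z v = h z ^ (n + 1) * contact_form n a z v"
  unfolding contact_form_def
  by (rule top_form_scale[OF mlin_dform mlin_dform]) (simp add: dform_scale[OF h a])

lemma contact_form_nonzero: "contact_form n a z v \<noteq> 0 \<Longrightarrow> \<exists>i. a i z \<noteq> 0"
  by (rule ccontr) (simp add: contact_form_def top_form_def gwedge_def pair_def)

lemma contact_form_cong_open:
  assumes "open U" "z \<in> U" "\<And>i w. w \<in> U \<Longrightarrow> a i w = b i w"
  shows "contact_form n a z = contact_form n b z"
proof -
  have "pd k (a i) z = pd k (b i) z" for k i by (rule pd_cong_open[OF assms(1,2)]) (rule assms(3))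
  then have "dform a z = dform b z" by (simp add: dform_def fun_eq_iff)
  then show ?thesis using assms by (simp add: contact_form_def)
qed

lemma holo_pair: "open U \<Longrightarrow> (\<And>i. holo (a i) U) \<Longrightarrow> holo (\<lambda>z. pair (\<lambda>i. a i z) x) U"
  unfolding pair_def by (intro holo_sum holo_mult holo_const)

lemma holo_gwedge:
  assumes "open U" "\<And>v. holo (\<lambda>z. \<omega> z v) U" "\<And>v. holo (\<lambda>z. \<eta> z v) U"
  shows "holo (\<lambda>z. gwedge k l (\<omega> z) (\<eta> z) v) U"
  unfolding gwedge_def divide_inverse by (intro holo_sum holo_mult holo_const assms)

lemma holo_contact_form:
  assumes U: "open U" and a: "\<And>i. holo (a i) U"
  shows "holo (\<lambda>z. contact_form n a z v) U"
proof -
  have d: "holo (\<lambda>z. dform a z u) U" for u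
    unfolding dform_def by (intro holo_sum holo_diff holo_mult holo_const holo_pair holo_pd a U)
  have "holo (\<lambda>z. gpower (dform a z) n v) U" for v
    by (induction n arbitrary: v) (auto intro!: holo_gwedge holo_const d U)
  then show ?thesis
    unfolding contact_form_def top_form_def by (intro holo_gwedge holo_pair a U)
qed

text \<open>Forms are fed with vectors numbered by \<open>nat\<close>, while coordinates are indexed
  by a finite type. Any fixed numbering does, since another one changes a top form only by a
  sign.\<close>

definition coord_enum :: "nat \<Rightarrow> 'm::finite" where
  "coord_enum = (SOME e. bij_betw e {..<CARD('m)} UNIV)"

lemma bij_coord_enum: "bij_betw (coord_enum :: nat \<Rightarrow> 'm::finite) {..<CARD('m)} UNIV"
proof -
  have "\<exists>e. bij_betw e {..<CARD('m)} (UNIV :: 'm set)"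
    unfolding atLeast0LessThan[symmetric] by (rule ex_bij_betw_nat_finite[OF finite])
  from someI_ex[OF this] show ?thesis unfolding coord_enum_def .
qed

text \<open>The factor between \<open>a \<and> (da)^n\<close> and the volume form that takes the
  value 1 on the basis as numbered by \<open>coord_enum\<close>.\<close>

definition vol_coeff :: "nat \<Rightarrow> ('m \<Rightarrow> complex ^ 'm::finite \<Rightarrow> complex) \<Rightarrow> complex ^ 'm \<Rightarrow> complex" where
  "vol_coeff n a z = contact_form n a z (\<lambda>i. axis (coord_enum i) 1)"

lemma vol_coeff_nonzero:
  assumes "CARD('m::finite) = 2 * n + 1" "contact_form n (a :: 'm \<Rightarrow> _) z v \<noteq> 0"
  shows "vol_coeff n a z \<noteq> 0"
  unfolding vol_coeff_def
proof (rule top_form_basis_nonzero)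
  show "mlin (2 * n + 1) (contact_form n a z)" unfolding contact_form_def by (rule mlin_top_form[OF mlin_dform])
  show "alternating (2 * n + 1) (contact_form n a z)" unfolding contact_form_def by (rule alternating_top_form)
  show "bij_betw (coord_enum :: nat \<Rightarrow> 'm) {..<2 * n + 1} UNIV" using bij_coord_enum assms(1) by metis
qed (rule assms(2))

section \<open>Extension across a linear subspace of codimension two\<close>

lemma finite_separated:
  fixes R :: "complex set"
  assumes "finite R"
  obtains \<delta> where "0 < \<delta>" "\<And>x y. x \<in> R \<Longrightarrow> y \<in> R \<Longrightarrow> x \<noteq> y \<Longrightarrow> \<delta> \<le> cmod (x - y)"
proof -
  \<comment> \<open>The element \<open>1\<close> keeps the minimum defined when \<open>R\<close> has
    at most one point.\<close>
  define D where "D = insert 1 ((\<lambda>(x, y). cmod (x - y)) ` (R \<times> R - Id))"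
  have D: "finite D" "D \<noteq> {}" using assms by (auto simp: D_def)
  show thesis
  proof (rule that)
    show "0 < Min D" using D by (auto simp: D_def)
    show "Min D \<le> cmod (x - y)" if "x \<in> R" "y \<in> R" "x \<noteq> y" for x y
      by (rule Min_le) (use D that in \<open>auto simp: D_def\<close>)
  qed
qed

text \<open>The graphs of the local sections form a finite covering space of \<open>X\<close>; a global section is a lift of the
  identity.\<close>

lemma section_of_finite_cover:
  fixes X :: "'a::real_normed_vector set"
    and Good :: "'a set \<Rightarrow> ('a \<Rightarrow> complex ^ 'm::finite) \<Rightarrow> bool"
  assumes X: "open X" "simply_connected X" and R: "finite R"
    and good: "\<And>B a. Good B a \<Longrightarrow> open B \<and> B \<subseteq> X \<and> continuous_on B a \<and> (\<forall>z\<in>B. a z \<noteq> 0)"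
    and cover: "\<And>z. z \<in> X \<Longrightarrow> \<exists>B a. Good B a \<and> z \<in> B"
    and compare: "\<And>B a B' a' z. Good B a \<Longrightarrow> Good B' a' \<Longrightarrow> z \<in> B \<Longrightarrow> z \<in> B' \<Longrightarrow> \<exists>\<zeta>\<in>R. a' z = \<zeta> *s a z"
    and scale: "\<And>B a \<zeta>. Good B a \<Longrightarrow> \<zeta> \<in> R \<Longrightarrow> Good B (\<lambda>z. \<zeta> *s a z)"
  obtains b where "\<And>z0. z0 \<in> X \<Longrightarrow> \<exists>B a r. Good B a \<and> 0 < r \<and> ball z0 r \<subseteq> B \<and> (\<forall>z\<in>ball z0 r. b z = a z)"
proof -
  \<comment> \<open>Total space of the covering, inside the product of \<open>X\<close> with the
    coordinate space; over a domain \<open>B\<close> it splits into sheets labelled by the elements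
    of \<open>R\<close>.\<close>
  define C where "C = {(z, b). \<exists>B a. Good B a \<and> z \<in> B \<and> b = a z}"
  define sheet where "sheet B a \<zeta> = (\<lambda>z. (z, \<zeta> *s a z)) ` B" for B and a :: "'a \<Rightarrow> complex ^ 'm" and \<zeta>
  obtain \<delta> where \<delta>: "0 < \<delta>" "\<And>x y. x \<in> R \<Longrightarrow> y \<in> R \<Longrightarrow> x \<noteq> y \<Longrightarrow> \<delta> \<le> cmod (x - y)"
    using finite_separated[OF R] by blast
  have sheets: "C \<inter> fst -` B = (\<Union>\<zeta>\<in>R. sheet B a \<zeta>)" if g: "Good B a" for B a
  proof
    show "C \<inter> fst -` B \<subseteq> (\<Union>\<zeta>\<in>R. sheet B a \<zeta>)"
      unfolding C_def sheet_def using compare[OF g] by fastforce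
    show "(\<Union>\<zeta>\<in>R. sheet B a \<zeta>) \<subseteq> C \<inter> fst -` B"
      unfolding C_def sheet_def using scale[OF g] by fastforce
  qed
  have sheet_open: "\<exists>Q. open Q \<and> sheet B a \<zeta> = C \<inter> Q" if g: "Good B a" and \<zeta>: "\<zeta> \<in> R" for B a \<zeta>
  proof -
    note gB = good[OF g]
    \<comment> \<open>Over \<open>z\<close> two different sheets are at least
      \<open>\<delta> * norm (a z)\<close> apart, so this open tube around one sheet misses the
      others.\<close>
    define Q where "Q = (B \<times> UNIV) \<inter> (\<lambda>p. \<delta> * norm (a (fst p)) - norm (snd p - \<zeta> *s a (fst p))) -` {0<..}"
    have "continuous_on (B \<times> UNIV) (\<lambda>p. a (fst p))"
      by (rule continuous_on_compose2[of B a]) (use gB in \<open>auto intro: continuous_intros\<close>)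
    then have "open Q" unfolding Q_def
      by (intro continuous_open_preimage continuous_intros open_Times) (use gB in auto)
    moreover have "sheet B a \<zeta> = C \<inter> Q"
    proof
      show "sheet B a \<zeta> \<subseteq> C \<inter> Q"
        using sheets[OF g] \<zeta> gB \<delta>(1) by (auto simp: sheet_def Q_def)
      show "C \<inter> Q \<subseteq> sheet B a \<zeta>"
      proof
        fix p assume p: "p \<in> C \<inter> Q"
        then have "p \<in> C \<inter> fst -` B" by (auto simp: Q_def)
        then obtain \<zeta>' z where \<zeta>': "\<zeta>' \<in> R" and z: "z \<in> B" "p = (z, \<zeta>' *s a z)"
          unfolding sheets[OF g] by (auto simp: sheet_def)
        have "norm (\<zeta>' *s a z - \<zeta> *s a z) < \<delta> * norm (a z)" using p z by (simp add: Q_def)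
        moreover have "\<zeta>' *s a z - \<zeta> *s a z = (\<zeta>' - \<zeta>) *s a z" by (simp add: vec_eq_iff algebra_simps)
        ultimately have "cmod (\<zeta>' - \<zeta>) * norm (a z) < \<delta> * norm (a z)" by (simp only: norm_smult)
        then have "cmod (\<zeta>' - \<zeta>) < \<delta>" by (rule mult_right_less_imp_less) simp
        then have "\<zeta>' = \<zeta>" using \<delta>(2)[OF \<zeta>' \<zeta>] by (meson not_le)
        then show "p \<in> sheet B a \<zeta>" unfolding sheet_def using z by blast
      qed
    qed
    ultimately show ?thesis by blast
  qed
  have cov: "covering_space C fst X"
    unfolding covering_space_def
  proof (intro conjI ballI)
    show "continuous_on C fst" by (intro continuous_intros)
    show "fst ` C = X"
    proof
      show "fst ` C \<subseteq> X" unfolding C_def using good by fastforce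
      show "X \<subseteq> fst ` C" unfolding C_def using cover by (fastforce simp: image_iff)
    qed
    fix x assume "x \<in> X"
    then obtain B a where g: "Good B a" "x \<in> B" using cover by blast
    note gB = good[OF g(1)]
    have "openin (top_of_set X) B" using gB by (auto intro: open_openin_trans X)
    moreover have "\<Union> (sheet B a ` R) = C \<inter> fst -` B" using sheets[OF g(1)] by simp
    moreover have "\<forall>u\<in>sheet B a ` R. openin (top_of_set C) u"
      using sheet_open[OF g(1)] by (fastforce simp: openin_open)
    moreover have "pairwise disjnt (sheet B a ` R)"
      using gB by (auto simp: pairwise_def disjnt_def sheet_def)
    moreover have "\<forall>u\<in>sheet B a ` R. \<exists>q. homeomorphism u B fst q"
    proof
      fix u assume "u \<in> sheet B a ` R"
      then obtain \<zeta> where u: "u = sheet B a \<zeta>" by blast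
      have "homeomorphism u B fst (\<lambda>z. (z, \<zeta> *s a z))"
        unfolding u sheet_def
        by (intro homeomorphismI continuous_intros) (use gB in auto)
      then show "\<exists>q. homeomorphism u B fst q" by blast
    qed
    ultimately show "\<exists>T. x \<in> T \<and> openin (top_of_set X) T \<and> (\<exists>v. \<Union> v = C \<inter> fst -` T \<and>
        (\<forall>u\<in>v. openin (top_of_set C) u) \<and> pairwise disjnt v \<and> (\<forall>u\<in>v. Ex (homeomorphism u T fst)))"
      using g(2) by blast
  qed
  \<comment> \<open>Simple connectedness enters here; on other domains a loop could permute the
    sheets.\<close>
  obtain g where g: "continuous_on X g" "g \<in> X \<rightarrow> C" "\<And>y. y \<in> X \<Longrightarrow> fst (g y) = y"
    by (rule covering_space_lift[OF cov X(2) open_imp_locally_path_connected[OF X(1)] continuous_on_id[of X]]) auto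
  show thesis
  proof (rule that[of "\<lambda>z. snd (g z)"])
    fix z0 assume z0: "z0 \<in> X"
    then obtain B a where Ba: "Good B a" "z0 \<in> B" using cover by blast
    have "g z0 \<in> C \<inter> fst -` B" using g z0 Ba by auto
    then obtain \<zeta> where \<zeta>: "\<zeta> \<in> R" "g z0 \<in> sheet B a \<zeta>" unfolding sheets[OF Ba(1)] by blast
    \<comment> \<open>The sheet is open in \<open>C\<close>, so by continuity the lift stays in it
      near \<open>z0\<close> and agrees there with a single section.\<close>
    obtain Q where Q: "open Q" "sheet B a \<zeta> = C \<inter> Q" using sheet_open[OF Ba(1) \<zeta>(1)] by blast
    have "open ((X \<inter> g -` Q) \<inter> B)"
      using continuous_open_preimage[OF g(1) X(1) Q(1)] good[OF Ba(1)] by blast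
    moreover have "z0 \<in> (X \<inter> g -` Q) \<inter> B" using z0 \<zeta> Q Ba by auto
    ultimately obtain r where r: "0 < r" "ball z0 r \<subseteq> (X \<inter> g -` Q) \<inter> B"
      using openE by blast
    have "snd (g z) = \<zeta> *s a z" if "z \<in> ball z0 r" for z
    proof -
      have "z \<in> X" "g z \<in> sheet B a \<zeta>" using r that g(2) Q(2) by auto
      then show ?thesis using g(3)[of z] by (force simp: sheet_def)
    qed
    then show "\<exists>B a r. Good B a \<and> 0 < r \<and> ball z0 r \<subseteq> B \<and> (\<forall>z\<in>ball z0 r. snd (g z) = a z)"
      using scale[OF Ba(1) \<zeta>(1)] r by (intro exI[of _ B] exI[of _ "\<lambda>z. \<zeta> *s a z"] exI[of _ r]) auto
  qed
qed

text \<open>Split off the coordinates \<open>i\<close> and \<open>k\<close>: the neighbourhood is a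
  product of a ball in C^2 and a convex set. Removing the subspace punctures only the first factor,
  a convex set of real dimension 4.\<close>

lemma simply_connected_codim_two:
  fixes z0 :: "complex ^ 'm::finite"
  assumes ik: "i \<noteq> k" and r: "0 < r"
  obtains U where "open U" "z0 \<in> U" "U \<subseteq> ball z0 r"
    "simply_connected (U - {z. z $ i = z0 $ i \<and> z $ k = z0 $ k})"
proof -
  \<comment> \<open>Since \<open>norm (J p) \<le> 2 * norm p\<close>, a point of \<open>U\<close> is
    closer to \<open>z0\<close> than \<open>2 * s + s = r\<close>.\<close>
  define s where "s = r / 3"
  have s: "0 < s" using r by (simp add: s_def)
  define q where "q z = (z $ i - z0 $ i, z $ k - z0 $ k)" for z
  define J where "J p = fst p *s axis i 1 + snd p *s axis k 1" for p :: "complex \<times> complex"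
  define y where "y z = z - z0 - J (q z)" for z
  define Y where "Y = {w :: complex ^ 'm. w $ i = 0 \<and> w $ k = 0} \<inter> ball 0 s"
  define U where "U = {z. norm (q z) < s \<and> norm (y z) < s}"
  have cq: "continuous_on A q" and cJ: "continuous_on A' J" and cy: "continuous_on A y" for A A'
    unfolding q_def y_def J_def by (intro continuous_intros)+
  have nJ: "norm (J p) \<le> 2 * norm p" for p
  proof -
    have "norm (J p) \<le> cmod (fst p) + cmod (snd p)"
      unfolding J_def by (metis norm_smult_axis norm_triangle_ineq)
    also have "\<dots> \<le> 2 * norm p" using norm_fst_le[of "fst p" "snd p"] norm_snd_le[of "snd p" "fst p"] by simp
    finally show ?thesis .
  qed
  have yi: "y z $ i = 0" "y z $ k = 0" for z
    using ik by (auto simp: y_def J_def q_def axis_def)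
  have inv1: "z0 + J (q z) + y z = z" for z by (simp add: y_def)
  have inv2: "q (z0 + J p + w) = p" "y (z0 + J p + w) = w" if "w $ i = 0" "w $ k = 0" for p w
    using that ik by (auto simp: y_def J_def q_def axis_def prod_eq_iff vec_eq_iff)
  show thesis
  proof (rule that)
    show "open U"
      unfolding U_def by (intro open_Collect_conj open_Collect_less continuous_on_norm cq cy continuous_on_const)
    show "z0 \<in> U" using s by (simp add: U_def q_def y_def J_def zero_prod_def[symmetric])
    show "U \<subseteq> ball z0 r"
    proof
      fix z assume "z \<in> U"
      then have "norm (J (q z) + y z) < 3 * s"
        using nJ[of "q z"] norm_triangle_ineq[of "J (q z)" "y z"] by (simp add: U_def)
      then show "z \<in> ball z0 r"
        by (simp add: dist_norm y_def norm_minus_commute s_def)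
    qed
    have "convex Y" unfolding Y_def
      by (intro convex_Int convex_ball) (auto simp: convex_def)
    moreover have "simply_connected (ball 0 s - {0 :: complex \<times> complex})"
      by (rule simply_connected_punctured_convex) (use s in \<open>auto simp: aff_dim_open\<close>)
    ultimately have "simply_connected ((ball 0 s - {0 :: complex \<times> complex}) \<times> Y)"
      using simply_connected_Times convex_imp_simply_connected by blast
    moreover have "homeomorphism ((ball 0 s - {0 :: complex \<times> complex}) \<times> Y)
        (U - {z. z $ i = z0 $ i \<and> z $ k = z0 $ k}) (\<lambda>p. z0 + J (fst p) + snd p) (\<lambda>z. (q z, y z))"
    proof (rule homeomorphismI)
      show "continuous_on ((ball 0 s - {0}) \<times> Y) (\<lambda>p. z0 + J (fst p) + snd p)"
        by (intro continuous_intros continuous_on_compose2[OF cJ[of UNIV]]) auto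
      show "continuous_on (U - {z. z $ i = z0 $ i \<and> z $ k = z0 $ k}) (\<lambda>z. (q z, y z))"
        by (intro continuous_intros cq cy)
      show "(\<lambda>z. (q z, y z)) ` (U - {z. z $ i = z0 $ i \<and> z $ k = z0 $ k}) \<subseteq> (ball 0 s - {0}) \<times> Y"
        using yi by (auto simp: U_def Y_def q_def zero_prod_def dist_norm norm_Pair norm_minus_commute)
      show "(\<lambda>p. z0 + J (fst p) + snd p) ` ((ball 0 s - {0}) \<times> Y) \<subseteq> U - {z. z $ i = z0 $ i \<and> z $ k = z0 $ k}"
      proof (rule image_subsetI)
        fix x assume x: "x \<in> (ball 0 s - {0 :: complex \<times> complex}) \<times> Y"
        define p w where "p = fst x" and "w = snd x"
        then have p: "p \<in> ball 0 s" and p0: "p \<noteq> 0" and w: "w \<in> Y" using x by auto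
        have w0: "w $ i = 0" "w $ k = 0" using w by (auto simp: Y_def)
        have "z0 + J p + w \<in> U" using inv2[OF w0, of p] p w by (simp add: U_def Y_def)
        moreover have "\<not> ((z0 + J p + w) $ i = z0 $ i \<and> (z0 + J p + w) $ k = z0 $ k)"
        proof
          assume "(z0 + J p + w) $ i = z0 $ i \<and> (z0 + J p + w) $ k = z0 $ k"
          then have "q (z0 + J p + w) = 0" by (simp add: q_def zero_prod_def)
          then show False using inv2(1)[OF w0, of p] p0 by simp
        qed
        ultimately show "z0 + J (fst x) + snd x \<in> U - {z. z $ i = z0 $ i \<and> z $ k = z0 $ k}"
          by (simp add: p_def w_def)
      qed
    qed (use inv1 inv2 in \<open>auto simp: Y_def\<close>)
    ultimately show "simply_connected (U - {z. z $ i = z0 $ i \<and> z $ k = z0 $ k})"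
      using homeomorphic_simply_connected homeomorphic_def by blast
  qed
qed

lemma vol_coeff_scale:
  "cdiff h z \<Longrightarrow> (\<And>i. cdiff (a i) z) \<Longrightarrow> vol_coeff n (\<lambda>i z. h z * a i z) z = h z ^ (n + 1) * vol_coeff n a z"
  unfolding vol_coeff_def by (rule contact_form_scale)

lemma vol_coeff_cong_open:
  assumes "open U" "z \<in> U" "\<And>i w. w \<in> U \<Longrightarrow> a i w = b i w"
  shows "vol_coeff n a z = vol_coeff n b z"
  unfolding vol_coeff_def by (simp add: contact_form_cong_open[OF assms])

text \<open>Rescaling by \<open>h\<close> multiplies the volume coefficient by
  \<open>h ^ (n + 1)\<close>, so \<open>h\<close> has to be an \<open>(n + 1)\<close>-th root of its
  reciprocal. A branch exists on a ball where the coefficient stays near its value at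
  \<open>z\<close>.\<close>

lemma normalise_contact:
  fixes a :: "'m::finite \<Rightarrow> complex ^ 'm \<Rightarrow> complex"
  assumes B: "open B" "z \<in> B" and a: "\<And>i. holo (a i) B" and nz: "\<And>w. w \<in> B \<Longrightarrow> vol_coeff n a w \<noteq> 0"
  obtains r h where "0 < r" "ball z r \<subseteq> B" "holo h (ball z r)"
    "\<And>w. w \<in> ball z r \<Longrightarrow> vol_coeff n (\<lambda>i w. h w * a i w) w = 1"
proof -
  define g where "g = vol_coeff n a"
  have hg: "holo g B" unfolding g_def vol_coeff_def by (rule holo_contact_form[OF B(1) a])
  define c where "c = g z"
  have c: "c \<noteq> 0" using nz[OF B(2)] by (simp add: c_def g_def)
  have "open (B \<inter> g -` ball c (norm c))"
    by (rule continuous_open_preimage[OF holo_continuous_on[OF hg] B(1) open_ball])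
  moreover have "z \<in> B \<inter> g -` ball c (norm c)" using B c by (simp add: c_def)
  ultimately obtain r where r: "0 < r" "ball z r \<subseteq> B \<inter> g -` ball c (norm c)" using openE by blast
  have re: "g w / c \<notin> \<real>\<^sub>\<le>\<^sub>0" if "w \<in> ball z r" for w
  proof
    assume "g w / c \<in> \<real>\<^sub>\<le>\<^sub>0"
    then have "Re (1 - g w / c) \<ge> 1" by (auto simp: complex_nonpos_Reals_iff)
    then have "cmod (1 - g w / c) \<ge> 1" using complex_Re_le_cmod order_trans by blast
    moreover have "cmod (c - g w) < cmod c" using r that by (auto simp: dist_norm)
    moreover have "cmod (c - g w) = cmod (1 - g w / c) * cmod c"
    proof -
      have "c - g w = (1 - g w / c) * c" using c by (simp add: field_simps)
      then show ?thesis by (metis norm_mult)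
    qed
    ultimately show False using mult_right_mono[of 1 "cmod (1 - g w / c)" "cmod c"] by simp
  qed
  \<comment> \<open>\<open>g w / c\<close> stays in the open disc of radius 1 around 1, off the cut
    of \<open>Ln\<close>; so \<open>Ln (g w / c) + Ln c\<close> is a holomorphic logarithm of
    \<open>g\<close>.\<close>
  define h where "h w = exp (- (Ln (g w / c) + Ln c) / of_nat (n + 1))" for w
  have hh: "holo h (ball z r)"
    unfolding holo_cdiff
  proof (intro conjI ballI)
    fix w assume w: "w \<in> ball z r"
    have 1: "cdiff (\<lambda>w. g w / c) w" using holoD[OF hg] r w c by (intro cdiff_divide) auto
    have 2: "cdiff (\<lambda>w. Ln (g w / c)) w"
      by (rule cdiff_field[OF 1 has_field_derivative_Ln[OF re[OF w]]])
    have 3: "cdiff (\<lambda>w. - (Ln (g w / c) + Ln c) / of_nat (n + 1)) w"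
      by (rule cdiff_field[OF 2, where g = "\<lambda>x. - (x + Ln c) / of_nat (n + 1)" and d = "- 1 / of_nat (n + 1)"])
         (auto intro!: derivative_eq_intros simp del: of_nat_Suc)
    show "cdiff h w" unfolding h_def by (rule cdiff_field[OF 3 DERIV_exp])
  qed simp
  show thesis
  proof (rule that[OF r(1) _ hh])
    show "ball z r \<subseteq> B" using r by blast
    fix w assume w: "w \<in> ball z r"
    have gw: "g w \<noteq> 0" using nz r w by (auto simp: g_def)
    have "h w ^ (n + 1) = exp (- (Ln (g w / c) + Ln c))"
      unfolding h_def by (subst exp_of_nat_mult[symmetric]) (simp del: of_nat_Suc of_nat_add)
    also have "\<dots> = 1 / g w" unfolding exp_minus exp_add using gw c by (simp add: field_simps)
    finally have "h w ^ (n + 1) * g w = 1" using gw by simp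
    moreover have "vol_coeff n (\<lambda>i w. h w * a i w) w = h w ^ (n + 1) * g w"
      unfolding g_def by (rule vol_coeff_scale) (use holoD[OF hh w] holoD[OF a] r w in auto)
    ultimately show "vol_coeff n (\<lambda>i w. h w * a i w) w = 1" by simp
  qed
qed

text \<open>\<open>Fam\<close> collects the chart expressions of the local forms that define the
  structure, so that the argument runs in the coordinate space. The members are known to be
  proportional point by point; ratios that vary differentiably are obtained by dividing
  coefficients. The last conclusion includes points on the subspace, where members of
  \<open>Fam\<close> may be defined too.\<close>

theorem contact_extend_codim_two:
  fixes z0 :: "complex ^ 'm::finite"
  assumes card: "CARD('m) = 2 * n + 1" and ik: "i \<noteq> k" and U: "open U" "z0 \<in> U"
    and fam: "\<And>B a. Fam B a \<Longrightarrow> open B \<and> (\<forall>j. holo (a j) B) \<and> (\<forall>z\<in>B. \<exists>v. contact_form n a z v \<noteq> 0)"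
    and par: "\<And>B a B' a' z. Fam B a \<Longrightarrow> Fam B' a' \<Longrightarrow> z \<in> B \<Longrightarrow> z \<in> B' \<Longrightarrow> \<exists>c. \<forall>j. a' j z = c * a j z"
    and cover: "\<And>z. z \<in> U \<Longrightarrow> \<not> (z $ i = z0 $ i \<and> z $ k = z0 $ k) \<Longrightarrow> \<exists>B a. Fam B a \<and> z \<in> B"
  obtains V b where "open V" "z0 \<in> V" "V \<subseteq> U" "\<And>j. holo (b j) V" "\<And>z. z \<in> V \<Longrightarrow> vol_coeff n b z = 1"
    "\<And>B a z. Fam B a \<Longrightarrow> z \<in> B \<Longrightarrow> z \<in> V \<Longrightarrow> \<exists>c. \<forall>j. b j z = c * a j z"
proof -
  define N where "N = {z. z $ i = z0 $ i \<and> z $ k = z0 $ k}"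
  obtain r0 where r0: "0 < r0" "ball z0 r0 \<subseteq> U" using U openE by blast
  obtain U1 where U1: "open U1" "z0 \<in> U1" "U1 \<subseteq> ball z0 r0" "simply_connected (U1 - N)"
    unfolding N_def by (rule simply_connected_codim_two[where ?z0.0 = z0, OF ik r0(1)])
  define X where "X = U1 - N"
  have "closed N"
    unfolding N_def by (intro closed_Collect_conj closed_Collect_eq continuous_intros)
  then have X: "open X" "simply_connected X" using U1 by (auto simp: X_def)
  \<comment> \<open>The sections for the covering: forms that span the structure and have volume
    coefficient exactly 1. By the scaling law two of them differ at each point by an
    \<open>(n + 1)\<close>-th root of unity.\<close>
  define Good where "Good B a \<longleftrightarrow> open B \<and> B \<subseteq> X \<and> (\<forall>j. holo (\<lambda>z. a z $ j) B) \<and>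
      (\<forall>z\<in>B. vol_coeff n (\<lambda>j z. a z $ j) z = 1) \<and>
      (\<forall>B' a' z. Fam B' a' \<longrightarrow> z \<in> B \<longrightarrow> z \<in> B' \<longrightarrow> (\<exists>c. \<forall>j. a z $ j = c * a' j z))"
    for B and a :: "complex ^ 'm \<Rightarrow> complex ^ 'm"
  have nz: "\<exists>j. a z $ j \<noteq> 0" if "Good B a" "z \<in> B" for B a z
  proof -
    have "vol_coeff n (\<lambda>j z. a z $ j) z = 1" using that by (auto simp: Good_def)
    then show ?thesis using contact_form_nonzero[of n "\<lambda>j z. a z $ j" z "\<lambda>i. axis (coord_enum i) 1"] by (simp add: vol_coeff_def)
  qed
  define R where "R = {\<zeta>::complex. \<zeta> ^ (n + 1) = 1}"
  have famcover: "\<exists>B a. Fam B a \<and> z \<in> B" if "z \<in> X" for z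
    using cover[of z] that U1 r0 by (auto simp: X_def N_def)
  obtain b where b: "\<And>z. z \<in> X \<Longrightarrow> \<exists>B a r. Good B a \<and> 0 < r \<and> ball z r \<subseteq> B \<and> (\<forall>w\<in>ball z r. b w = a w)"
  proof (rule section_of_finite_cover[OF X, of R Good])
    show "finite R" unfolding R_def by (rule finite_roots_unity) simp
  next
    fix B a assume g: "Good B a"
    have "continuous_on B a" by (rule continuous_on_vec_nthI) (use g holo_continuous_on in \<open>auto simp: Good_def\<close>)
    moreover have "\<forall>z\<in>B. a z \<noteq> 0" using nz[OF g] by fastforce
    ultimately show "open B \<and> B \<subseteq> X \<and> continuous_on B a \<and> (\<forall>z\<in>B. a z \<noteq> 0)"
      using g by (auto simp: Good_def)
  next
    fix z assume z: "z \<in> X"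
    then obtain A \<alpha> where A: "Fam A \<alpha>" "z \<in> A" using famcover by blast
    have oA: "open (A \<inter> X)" using fam[OF A(1)] X by blast
    have h\<alpha>: "holo (\<alpha> j) (A \<inter> X)" for j using fam[OF A(1)] oA holo_subset by blast
    have "vol_coeff n \<alpha> w \<noteq> 0" if "w \<in> A \<inter> X" for w
      using fam[OF A(1)] that vol_coeff_nonzero[OF card] by blast
    then obtain r h where r: "0 < r" "ball z r \<subseteq> A \<inter> X" and h: "holo h (ball z r)"
      "\<And>w. w \<in> ball z r \<Longrightarrow> vol_coeff n (\<lambda>i w. h w * \<alpha> i w) w = 1"
      by (rule normalise_contact[where a = \<alpha> and n = n, OF oA IntI[OF A(2) z] h\<alpha>]) blast+
    have "Good (ball z r) (\<lambda>w. \<chi> j. h w * \<alpha> j w)"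
      unfolding Good_def
    proof (intro conjI allI ballI impI)
      show "holo (\<lambda>w. (\<chi> j. h w * \<alpha> j w) $ j) (ball z r)" for j
        using holo_mult[OF h(1) holo_subset[OF h\<alpha> open_ball r(2)]] by simp
      show "\<exists>c. \<forall>j. (\<chi> j. h w * \<alpha> j w) $ j = c * a' j w" if t: "Fam B' a'" "w \<in> ball z r" "w \<in> B'" for B' a' w
      proof -
        obtain c where "\<forall>j. \<alpha> j w = c * a' j w" using par[OF t(1) A(1) t(3)] r t by blast
        then show ?thesis by (intro exI[of _ "h w * c"]) simp
      qed
    qed (use r h in auto)
    then show "\<exists>B a. Good B a \<and> z \<in> B" using r(1) by (meson centre_in_ball)
  next
    fix B a B' a' z assume g: "Good B a" and g': "Good B' a'" and z: "z \<in> B" "z \<in> B'"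
    have "z \<in> X" using g z by (auto simp: Good_def)
    then obtain A \<alpha> where A: "Fam A \<alpha>" "z \<in> A" using famcover by blast
    obtain j where j: "a z $ j \<noteq> 0" using nz[OF g z(1)] by blast
    have hj: "holo (\<lambda>z. a z $ j) B" and h'j: "holo (\<lambda>z. a' z $ j) B'" using g g' by (auto simp: Good_def)
    define W where "W = (B \<inter> (\<lambda>z. a z $ j) -` (- {0})) \<inter> B' \<inter> A"
    have "open (B \<inter> (\<lambda>z. a z $ j) -` (- {0}))"
      by (rule continuous_open_preimage[OF holo_continuous_on[OF hj]]) (use holo_open[OF hj] in auto)
    then have W: "open W" "z \<in> W" using g g' fam[OF A(1)] z A(2) j by (auto simp: W_def Good_def)
    \<comment> \<open>Both forms are multiples of the member \<open>\<alpha>\<close>, so near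
      \<open>z\<close>, where \<open>a w $ j\<close> is nonzero, they differ by the ratio of their
      \<open>j\<close>-th coefficients. It is complex differentiable, as the scaling law
      requires.\<close>
    define h where "h w = a' w $ j / a w $ j" for w
    have eq: "a' w $ l = h w * a w $ l" if w: "w \<in> W" for w l
    proof -
      obtain c c' where c: "\<And>l. a w $ l = c * \<alpha> l w" and c': "\<And>l. a' w $ l = c' * \<alpha> l w"
        using g g' A(1) w unfolding Good_def W_def by blast
      have "a w $ j \<noteq> 0" using w by (auto simp: W_def)
      then have "c \<noteq> 0" "\<alpha> j w \<noteq> 0" using c by auto
      then show ?thesis by (simp add: h_def c c')
    qed
    have hz: "cdiff h z" unfolding h_def
      by (rule cdiff_divide[OF holoD[OF h'j z(2)] holoD[OF hj z(1)] j])
    have "1 = vol_coeff n (\<lambda>j z. a' z $ j) z" using g' z by (auto simp: Good_def)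
    also have "\<dots> = vol_coeff n (\<lambda>j z. h z * a z $ j) z"
      by (rule vol_coeff_cong_open[OF W]) (rule eq)
    also have "\<dots> = h z ^ (n + 1) * vol_coeff n (\<lambda>j z. a z $ j) z"
    proof (rule vol_coeff_scale[OF hz])
      show "cdiff (\<lambda>z. a z $ j) z" for j
        by (rule holoD[OF _ z(1)]) (use g in \<open>simp add: Good_def\<close>)
    qed
    also have "vol_coeff n (\<lambda>j z. a z $ j) z = 1" using g z by (auto simp: Good_def)
    finally have "h z \<in> R" by (simp add: R_def)
    moreover have "a' z = h z *s a z" using eq[OF W(2)] by (simp add: vec_eq_iff)
    ultimately show "\<exists>\<zeta>\<in>R. a' z = \<zeta> *s a z" by blast
  next
    fix B a \<zeta> assume g: "Good B a" and \<zeta>: "\<zeta> \<in> R"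
    show "Good B (\<lambda>z. \<zeta> *s a z)"
      unfolding Good_def
    proof (intro conjI allI ballI impI)
      show "open B" "B \<subseteq> X" using g by (auto simp: Good_def)
      show "holo (\<lambda>z. (\<zeta> *s a z) $ j) B" for j
        using holo_mult[OF holo_const[of B \<zeta>], of "\<lambda>z. a z $ j"] g by (simp add: Good_def)
      show "vol_coeff n (\<lambda>j z. (\<zeta> *s a z) $ j) z = 1" if z: "z \<in> B" for z
      proof -
        have "vol_coeff n (\<lambda>j z. \<zeta> * a z $ j) z = \<zeta> ^ (n + 1) * vol_coeff n (\<lambda>j z. a z $ j) z"
        proof (rule vol_coeff_scale[where h = "\<lambda>z. \<zeta>", OF cdiff_const])
          show "cdiff (\<lambda>z. a z $ j) z" for j
            by (rule holoD[OF _ z]) (use g in \<open>simp add: Good_def\<close>)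
        qed
        moreover have "vol_coeff n (\<lambda>j z. a z $ j) z = 1" using g z by (auto simp: Good_def)
        ultimately show ?thesis using \<zeta> by (simp add: R_def)
      qed
      show "\<exists>c. \<forall>j. (\<zeta> *s a z) $ j = c * a' j z" if t: "Fam B' a'" "z \<in> B" "z \<in> B'" for B' a' z
      proof -
        obtain c where "\<forall>j. a z $ j = c * a' j z" using g t unfolding Good_def by blast
        then show ?thesis by (intro exI[of _ "\<zeta> * c"]) simp
      qed
    qed
  qed blast
  have hb: "holo (\<lambda>z. b z $ j) X" for j
  proof (rule holo_local)
    fix z assume "z \<in> X"
    then obtain B a r where *: "Good B a" "0 < r" "ball z r \<subseteq> B" "\<forall>w\<in>ball z r. b w = a w" using b by blast
    have "holo (\<lambda>z. a z $ j) (ball z r)"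
      by (rule holo_subset[OF _ open_ball *(3)]) (use *(1) in \<open>simp add: Good_def\<close>)
    then have "holo (\<lambda>z. b z $ j) (ball z r)" using holo_cong[of "ball z r" "\<lambda>z. b z $ j" "\<lambda>z. a z $ j"] * by auto
    then show "\<exists>V. z \<in> V \<and> V \<subseteq> X \<and> holo (\<lambda>z. b z $ j) V"
      using * by (intro exI[of _ "ball z r"]) (auto simp: Good_def)
  qed
  obtain r1 where r1: "0 < r1" "ball z0 r1 \<subseteq> U1" using U1 openE by blast
  \<comment> \<open>\<open>holo_hartogs\<close> extends to a ball what is given on the punctured
    ball of twice the radius.\<close>
  define \<rho> where "\<rho> = r1 / 2"
  have \<rho>: "0 < \<rho>" "ball z0 (2 * \<rho>) \<subseteq> U1" "ball z0 \<rho> \<subseteq> U1"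
    using r1 by (auto simp: \<rho>_def intro!: subset_trans[OF subset_ball r1(2)])
  have "\<exists>F. holo F (ball z0 \<rho>) \<and> (\<forall>z\<in>ball z0 \<rho>. \<not> (z $ i = z0 $ i \<and> z $ k = z0 $ k) \<longrightarrow> F z = b z $ j)" for j
  proof -
    have "holo (\<lambda>z. b z $ j) (ball z0 (2 * \<rho>) - N)"
      by (rule holo_subset[OF hb]) (use \<rho> \<open>closed N\<close> in \<open>auto simp: X_def\<close>)
    from holo_hartogs[OF this[unfolded N_def] \<rho>(1) ik] show ?thesis by metis
  qed
  then obtain F where F: "\<And>j. holo (F j) (ball z0 \<rho>)"
    "\<And>j z. z \<in> ball z0 \<rho> \<Longrightarrow> \<not> (z $ i = z0 $ i \<and> z $ k = z0 $ k) \<Longrightarrow> F j z = b z $ j" by metis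
  have vol: "vol_coeff n F z = 1" if z: "z \<in> ball z0 \<rho>" "z \<notin> N" for z
  proof -
    have "z \<in> X" using z \<rho> by (auto simp: X_def)
    then obtain B a r where *: "Good B a" "0 < r" "ball z r \<subseteq> B" "\<forall>w\<in>ball z r. b w = a w" using b by blast
    have "vol_coeff n F z = vol_coeff n (\<lambda>j z. a z $ j) z"
    proof (rule vol_coeff_cong_open)
      show "open (ball z r \<inter> ball z0 \<rho> - N)" using \<open>closed N\<close> by blast
      show "z \<in> ball z r \<inter> ball z0 \<rho> - N" using z * by simp
      show "F j w = a w $ j" if "w \<in> ball z r \<inter> ball z0 \<rho> - N" for j w
        using F(2)[of w j] that * by (auto simp: N_def)
    qed
    moreover have "z \<in> B" using *(2,3) by auto
    ultimately show ?thesis using *(1) by (simp add: Good_def)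
  qed
  show thesis
  proof (rule that[of "ball z0 \<rho>" F])
    show "ball z0 \<rho> \<subseteq> U" using \<rho> U1 r0 by blast
    show "vol_coeff n F z = 1" if z: "z \<in> ball z0 \<rho>" for z
    proof (cases "z \<in> N")
      case True
      have "holo (\<lambda>z. vol_coeff n F z - 1) (ball z0 \<rho>)"
        unfolding vol_coeff_def by (intro holo_diff holo_contact_form holo_const F(1)) auto
      then have "isCont (\<lambda>z. vol_coeff n F z - 1) z" using cdiff_isCont holoD z by blast
      moreover obtain e where e: "0 < e" "ball z e \<subseteq> ball z0 \<rho>" using openE[OF open_ball z] by blast
      moreover have "vol_coeff n F w - 1 = 0" if "w \<in> ball z e" "w $ k \<noteq> z $ k" for w
        using vol[of w] that e(2) True by (auto simp: N_def)
      ultimately have "vol_coeff n F z - 1 = 0" using isCont_zero_off[of z "\<lambda>z. vol_coeff n F z - 1" e k] by meson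
      then show ?thesis by simp
    qed (rule vol[OF z])
    have off: "\<exists>c. \<forall>j. F j z = c * a j z"
      if t: "Fam B a" "z \<in> B" "z \<in> ball z0 \<rho>" "\<not> (z $ i = z0 $ i \<and> z $ k = z0 $ k)" for B a z
    proof -
      have "z \<in> X" using t \<rho> by (auto simp: X_def N_def)
      then obtain B' a' r where *: "Good B' a'" "0 < r" "ball z r \<subseteq> B'" "\<forall>w\<in>ball z r. b w = a' w" using b by blast
      then have "z \<in> B'" "b z = a' z" by auto
      then obtain c where "\<forall>j. a' z $ j = c * a j z" using * t unfolding Good_def by blast
      then show ?thesis using F(2)[OF t(3,4)] \<open>b z = a' z\<close> by auto
    qed
    show "\<exists>c. \<forall>j. F j z = c * a j z" if t: "Fam B a" "z \<in> B" "z \<in> ball z0 \<rho>" for B a z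
    proof (cases "z \<in> N")
      case True
      have ha: "holo (a j) B" for j using fam[OF t(1)] by blast
      obtain j0 where j0: "a j0 z \<noteq> 0" using fam[OF t(1)] t(2) contact_form_nonzero by metis
      \<comment> \<open>As the vanishing of 2 by 2 minors, proportionality is a closed condition and
        passes from the complement to the subspace; dividing by \<open>a j0 z\<close> then recovers
        the factor.\<close>
      have "a l z * F j z - a j z * F l z = 0" for l j
      proof -
        obtain e where e: "0 < e" "ball z e \<subseteq> ball z0 \<rho> \<inter> B"
          using openE[of "ball z0 \<rho> \<inter> B" z] fam[OF t(1)] t by blast
        have "cdiff (\<lambda>z. a l z * F j z - a j z * F l z) z"
          by (intro cdiff_diff cdiff_mult holoD[OF ha t(2)] holoD[OF F(1) t(3)])
        then have "isCont (\<lambda>z. a l z * F j z - a j z * F l z) z" by (rule cdiff_isCont)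
        moreover have "a l w * F j w - a j w * F l w = 0" if w: "w \<in> ball z e" "w $ k \<noteq> z $ k" for w
        proof -
          have "w \<in> B" "w \<in> ball z0 \<rho>" "\<not> (w $ i = z0 $ i \<and> w $ k = z0 $ k)"
            using w e(2) True unfolding N_def by (blast, blast, simp)
          then obtain c where "\<forall>j. F j w = c * a j w" using off[OF t(1)] by blast
          then show ?thesis by simp
        qed
        ultimately show ?thesis using isCont_zero_off[of z "\<lambda>z. a l z * F j z - a j z * F l z" e k] e(1) by meson
      qed
      then have "a j0 z * F j z = a j z * F j0 z" for j by (metis right_minus_eq)
      then have "F j z = F j0 z / a j0 z * a j z" for j using j0 by (simp add: field_simps)
      then show ?thesis by blast
    next
      case False
      then show ?thesis using off[OF t] by (simp add: N_def)
    qed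
  qed (use F \<rho> in auto)
qed

section \<open>Charts\<close>

text \<open>Domain and image of a chart are open, so openness relative to them is openness in the
  whole space. This trades the homeomorphism for injectivity and two conditions without subspace
  topologies.\<close>

lemma is_chart_iff:
  "is_chart X (V, \<phi>) \<longleftrightarrow> openin X V \<and> inj_on \<phi> V \<and>
     (\<forall>W. openin X W \<longrightarrow> W \<subseteq> V \<longrightarrow> open (\<phi> ` W)) \<and>
     (\<forall>B. open B \<longrightarrow> openin X {x \<in> V. \<phi> x \<in> B})"
  (is "_ \<longleftrightarrow> ?R")
proof
  assume c: "is_chart X (V, \<phi>)"
  then have V: "openin X V" "open (\<phi> ` V)" and hom: "homeomorphic_map (subtopology X V) (top_of_set (\<phi> ` V)) \<phi>"
    by (auto simp: is_chart_def)
  have top: "topspace (subtopology X V) = V" using V(1) openin_subset by (auto simp: topspace_subtopology)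
  have inj: "inj_on \<phi> V" using homeomorphic_imp_injective_map[OF hom] top by simp
  have "open (\<phi> ` W)" if "openin X W" "W \<subseteq> V" for W
  proof -
    have "openin (subtopology X V) W" using that V(1) by (simp add: openin_open_subtopology)
    then have "openin (top_of_set (\<phi> ` V)) (\<phi> ` W)"
      using homeomorphic_imp_open_map[OF hom] by (simp add: open_map_def)
    then show ?thesis using V(2) openin_open_trans by blast
  qed
  moreover have "openin X {x \<in> V. \<phi> x \<in> B}" if "open B" for B
  proof -
    have "openin (subtopology X V) {x \<in> topspace (subtopology X V). \<phi> x \<in> \<phi> ` V \<inter> B}"
      using homeomorphic_imp_continuous_map[OF hom] openin_open_Int[OF that, of "\<phi> ` V"]
      by (rule openin_continuous_map_preimage)
    moreover have "{x \<in> topspace (subtopology X V). \<phi> x \<in> \<phi> ` V \<inter> B} = {x \<in> V. \<phi> x \<in> B}" using top by auto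
    ultimately show ?thesis using V(1) openin_trans_full by metis
  qed
  ultimately show ?R using V(1) inj by blast
next
  assume R: ?R
  then have top: "topspace (subtopology X V) = V" using openin_subset by (auto simp: topspace_subtopology)
  have oV: "open (\<phi> ` V)" using R by blast
  have "continuous_map (subtopology X V) (top_of_set (\<phi> ` V)) \<phi>"
    unfolding continuous_map_def
  proof (intro conjI allI impI)
    fix B assume "openin (top_of_set (\<phi> ` V)) B"
    then have "open B" using oV openin_open_trans by blast
    then have "openin X {x \<in> V. \<phi> x \<in> B}" using R by blast
    then show "openin (subtopology X V) {x \<in> topspace (subtopology X V). \<phi> x \<in> B}"
      using R unfolding top by (simp add: openin_open_subtopology)
  qed (use top in auto)
  moreover have "open_map (subtopology X V) (top_of_set (\<phi> ` V)) \<phi>"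
    unfolding open_map_def
  proof (intro allI impI)
    fix W assume "openin (subtopology X V) W"
    then have "openin X W" "W \<subseteq> V" using R by (auto simp: openin_open_subtopology)
    then have "open (\<phi> ` W)" "\<phi> ` W \<subseteq> \<phi> ` V" using R by auto
    then show "openin (top_of_set (\<phi> ` V)) (\<phi> ` W)" using open_subset by blast
  qed
  ultimately have "homeomorphic_map (subtopology X V) (top_of_set (\<phi> ` V)) \<phi>"
    using R top by (intro bijective_open_imp_homeomorphic_map) auto
  then show "is_chart X (V, \<phi>)" using R oV by (simp add: is_chart_def)
qed

locale cmanifold =
  fixes M :: "('a, 'm::finite) cmfd"
  assumes mfd: "complex_manifold M"
begin

lemma charts_is_chart: "(V, \<phi>) \<in> charts M \<Longrightarrow> is_chart (top_of M) (V, \<phi>)"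
  by (simp add: charts_def)

lemma atlas_charts: "c \<in> atlas M \<Longrightarrow> c \<in> charts M"
  using mfd by (auto simp: charts_def complex_manifold_def)

lemma chart_openin: "(V, \<phi>) \<in> charts M \<Longrightarrow> openin (top_of M) V"
  using charts_is_chart is_chart_iff by metis

lemma chart_inj: "(V, \<phi>) \<in> charts M \<Longrightarrow> inj_on \<phi> V"
  using charts_is_chart is_chart_iff by metis

lemma chart_image_open: "(V, \<phi>) \<in> charts M \<Longrightarrow> openin (top_of M) W \<Longrightarrow> W \<subseteq> V \<Longrightarrow> open (\<phi> ` W)"
  using charts_is_chart is_chart_iff by metis

lemma chart_preimage_open: "(V, \<phi>) \<in> charts M \<Longrightarrow> open B \<Longrightarrow> openin (top_of M) {x \<in> V. \<phi> x \<in> B}"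
  using charts_is_chart is_chart_iff by metis

lemma chart_inv [simp]: "(V, \<phi>) \<in> charts M \<Longrightarrow> x \<in> V \<Longrightarrow> inv_into V \<phi> (\<phi> x) = x"
  by (simp add: chart_inj)

lemma atlas_cover: "p \<in> points M \<Longrightarrow> \<exists>V \<phi>. (V, \<phi>) \<in> atlas M \<and> p \<in> V"
  using mfd by (auto simp: complex_manifold_def)

lemma chart_at:
  assumes "p \<in> points M"
  obtains V \<phi> where "(V, \<phi>) \<in> charts M" "p \<in> V"
  using atlas_cover[OF assms] atlas_charts by blast

lemma transition:
  assumes "(V, \<phi>) \<in> charts M" "(W, \<psi>) \<in> atlas M"
  shows "holo (\<lambda>z. \<psi> (inv_into V \<phi> z) $ i) (\<phi> ` (V \<inter> W))"
    and "holo (\<lambda>z. \<phi> (inv_into W \<psi> z) $ i) (\<psi> ` (V \<inter> W))"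
  using assms by (auto simp: charts_def compatible_def)

lemma chart_restrict:
  assumes c: "(V, \<phi>) \<in> charts M" and W: "openin (top_of M) W" "W \<subseteq> V"
  shows "(W, \<phi>) \<in> charts M"
proof -
  have "openin (top_of M) {x \<in> W. \<phi> x \<in> B}" if "open B" for B
  proof -
    have "{x \<in> W. \<phi> x \<in> B} = W \<inter> {x \<in> V. \<phi> x \<in> B}" using W by auto
    then show ?thesis using W chart_preimage_open[OF c that] by auto
  qed
  then have "is_chart (top_of M) (W, \<phi>)"
    unfolding is_chart_iff
  proof (intro conjI allI impI)
    show "inj_on \<phi> W" using chart_inj[OF c] W(2) inj_on_subset by blast
    show "open (\<phi> ` W')" if "openin (top_of M) W'" "W' \<subseteq> W" for W'
      using chart_image_open[OF c that(1)] that(2) W(2) by blast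
  qed (use W in auto)
  moreover have "compatible (W, \<phi>) (A, \<psi>)" if d: "(A, \<psi>) \<in> atlas M" for A \<psi>
  proof -
    have A: "openin (top_of M) A" using chart_openin[OF atlas_charts[OF d]] .
    \<comment> \<open>\<open>inv_into\<close> depends on its domain, so the inverse of the
      restricted chart has to be compared with the old one on the smaller image.\<close>
    have eq: "inv_into W \<phi> z = inv_into V \<phi> z" if z: "z \<in> \<phi> ` (W \<inter> A)" for z
    proof -
      obtain x where x: "x \<in> W" "z = \<phi> x" using z by blast
      then show ?thesis
        using inv_into_f_f[OF inj_on_subset[OF chart_inj[OF c] W(2)] x(1)] inv_into_f_f[OF chart_inj[OF c], of x] W(2)
        by auto
    qed
    have "holo (\<lambda>z. \<psi> (inv_into V \<phi> z) $ i) (\<phi> ` (W \<inter> A))" for i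
      by (rule holo_subset[OF transition(1)[OF c d]]) (use chart_image_open[OF c, of "W \<inter> A"] W A in auto)
    then have "holo (\<lambda>z. \<psi> (inv_into W \<phi> z) $ i) (\<phi> ` (W \<inter> A))" for i
      using holo_cong[of "\<phi> ` (W \<inter> A)" "\<lambda>z. \<psi> (inv_into W \<phi> z) $ i"] eq by simp
    moreover have "holo (\<lambda>z. \<phi> (inv_into A \<psi> z) $ i) (\<psi> ` (W \<inter> A))" for i
      by (rule holo_subset[OF transition(2)[OF c d]])
        (use chart_image_open[OF atlas_charts[OF d], of "W \<inter> A"] W A in auto)
    ultimately show ?thesis by (simp add: compatible_def)
  qed
  ultimately show ?thesis by (auto simp: charts_def)
qed

text \<open>\<open>holo_fun\<close> tests only charts of the atlas, whereas adapted charts come from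
  the maximal one; transition maps to atlas charts bridge the difference.\<close>

lemma holo_fun_chart:
  assumes c: "(V, \<phi>) \<in> charts M" and f: "holo_fun M W f"
  shows "holo (\<lambda>z. f (inv_into V \<phi> z)) (\<phi> ` (V \<inter> W))"
proof (rule holo_local)
  fix z assume "z \<in> \<phi> ` (V \<inter> W)"
  then obtain x where x: "x \<in> V" "x \<in> W" "z = \<phi> x" by auto
  have W: "openin (top_of M) W" using f by (simp add: holo_fun_def)
  then have "x \<in> points M" using x openin_subset by blast
  then obtain A \<psi> where d: "(A, \<psi>) \<in> atlas M" "x \<in> A" using atlas_cover by blast
  note d' = atlas_charts[OF d(1)]
  have fd: "holo (f \<circ> inv_into A \<psi>) (\<psi> ` (A \<inter> W))" using f d by (auto simp: holo_fun_def)
  have op: "openin (top_of M) (V \<inter> A \<inter> W)" using chart_openin[OF c] chart_openin[OF d'] W by blast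
  have oB: "open (\<phi> ` (V \<inter> A \<inter> W))" by (rule chart_image_open[OF c op]) auto
  have "holo (\<lambda>z. (f \<circ> inv_into A \<psi>) (\<psi> (inv_into V \<phi> z))) (\<phi> ` (V \<inter> A \<inter> W))"
    by (rule holo_comp[OF fd holo_subset[OF transition(1)[OF c d(1)] oB] _ oB])
       (use c in \<open>auto simp del: o_apply\<close>)
  then have "holo (\<lambda>z. f (inv_into V \<phi> z)) (\<phi> ` (V \<inter> A \<inter> W))"
    by (rule holo_transfer) (use c d' in auto)
  then show "\<exists>Va. z \<in> Va \<and> Va \<subseteq> \<phi> ` (V \<inter> W) \<and> holo (\<lambda>z. f (inv_into V \<phi> z)) Va"
    using x d by (intro exI[of _ "\<phi> ` (V \<inter> A \<inter> W)"]) auto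
qed

lemma holo_fun_chartI:
  assumes c: "(V, \<phi>) \<in> charts M" and W: "openin (top_of M) W" "W \<subseteq> V"
    and f: "holo (\<lambda>z. f (inv_into V \<phi> z)) (\<phi> ` W)"
  shows "holo_fun M W f"
  unfolding holo_fun_def
proof (intro conjI W(1) ballI, clarify)
  fix A \<psi> assume d: "(A, \<psi>) \<in> atlas M"
  note d' = atlas_charts[OF d]
  have op: "openin (top_of M) (A \<inter> W)" using chart_openin[OF d'] W by blast
  have oB: "open (\<psi> ` (A \<inter> W))" by (rule chart_image_open[OF d' op]) auto
  have "holo (\<lambda>z. f (inv_into V \<phi> (\<phi> (inv_into A \<psi> z)))) (\<psi> ` (A \<inter> W))"
    by (rule holo_comp[OF f holo_subset[OF transition(2)[OF c d] oB] _ oB])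
       (use d' W in auto)
  then show "holo (f \<circ> inv_into A \<psi>) (\<psi> ` (A \<inter> W))"
    by (rule holo_transfer) (use c d' W in auto)
qed

lemma holo_near_iff:
  assumes c: "(V, \<phi>) \<in> charts M" and p: "p \<in> V"
  shows "holo_near M p f \<longleftrightarrow> (\<exists>B. open B \<and> \<phi> p \<in> B \<and> B \<subseteq> \<phi> ` V \<and> holo (\<lambda>z. f (inv_into V \<phi> z)) B)"
proof
  assume "holo_near M p f"
  then obtain W where W: "p \<in> W" "holo_fun M W f" by (auto simp: holo_near_def)
  have "holo (\<lambda>z. f (inv_into V \<phi> z)) (\<phi> ` (V \<inter> W))" by (rule holo_fun_chart[OF c W(2)])
  then show "\<exists>B. open B \<and> \<phi> p \<in> B \<and> B \<subseteq> \<phi> ` V \<and> holo (\<lambda>z. f (inv_into V \<phi> z)) B"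
    using p W(1) holo_open by (intro exI[of _ "\<phi> ` (V \<inter> W)"]) auto
next
  assume "\<exists>B. open B \<and> \<phi> p \<in> B \<and> B \<subseteq> \<phi> ` V \<and> holo (\<lambda>z. f (inv_into V \<phi> z)) B"
  then obtain B where B: "open B" "\<phi> p \<in> B" "B \<subseteq> \<phi> ` V" "holo (\<lambda>z. f (inv_into V \<phi> z)) B" by blast
  define W where "W = {x \<in> V. \<phi> x \<in> B}"
  have "\<phi> ` W = B" using B(3) by (auto simp: W_def)
  then have "holo_fun M W f"
    using chart_preimage_open[OF c B(1)] B(4) by (intro holo_fun_chartI[OF c]) (auto simp: W_def)
  moreover have "p \<in> W" using p B(2) by (simp add: W_def)
  ultimately show "holo_near M p f" unfolding holo_near_def by blast
qed

lemma holo_near_coord: "(V, \<phi>) \<in> charts M \<Longrightarrow> p \<in> V \<Longrightarrow> holo_near M p (\<lambda>x. \<phi> x $ i)"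
proof -
  assume c: "(V, \<phi>) \<in> charts M" and p: "p \<in> V"
  have o: "open (\<phi> ` V)" using chart_image_open[OF c chart_openin[OF c]] by simp
  have "holo (\<lambda>z. z $ i) (\<phi> ` V)" by (rule holo_nth[OF o])
  then have "holo (\<lambda>z. \<phi> (inv_into V \<phi> z) $ i) (\<phi> ` V)"
    using holo_cong[of "\<phi> ` V" "\<lambda>z. \<phi> (inv_into V \<phi> z) $ i" "\<lambda>z. z $ i"] by (simp add: f_inv_into_f)
  then show ?thesis unfolding holo_near_iff[OF c p] using o p by blast
qed

lemma holo_near_cdiff:
  assumes "(V, \<phi>) \<in> charts M" "p \<in> V" "holo_near M p f"
  shows "cdiff (\<lambda>z. f (inv_into V \<phi> z)) (\<phi> p)"
  using assms holoD unfolding holo_near_iff[OF assms(1,2)] by blast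

lemma holo_near_point: "holo_near M p f \<Longrightarrow> p \<in> points M"
  unfolding holo_near_def holo_fun_def using openin_subset by blast

lemma holo_near_both:
  assumes c: "(V, \<phi>) \<in> charts M" and p: "p \<in> V" and "holo_near M p f" "holo_near M p g"
  obtains B where "open B" "\<phi> p \<in> B" "B \<subseteq> \<phi> ` V" "holo (\<lambda>z. f (inv_into V \<phi> z)) B" "holo (\<lambda>z. g (inv_into V \<phi> z)) B"
proof -
  obtain B B' where "open B" "\<phi> p \<in> B" "B \<subseteq> \<phi> ` V" "holo (\<lambda>z. f (inv_into V \<phi> z)) B"
      "open B'" "\<phi> p \<in> B'" "holo (\<lambda>z. g (inv_into V \<phi> z)) B'"
    using assms unfolding holo_near_iff[OF c p] by blast
  then show thesis by (intro that[of "B \<inter> B'"]) (auto intro: holo_subset)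
qed

lemma holo_near_ops:
  assumes f: "holo_near M p f" and g: "holo_near M p g"
  shows "holo_near M p (\<lambda>x. f x + g x)" "holo_near M p (\<lambda>x. f x * g x)" 
proof -
  obtain V \<phi> where c: "(V, \<phi>) \<in> charts M" and p: "p \<in> V" using chart_at[OF holo_near_point[OF f]] by blast
  obtain B where "open B" "\<phi> p \<in> B" "B \<subseteq> \<phi> ` V" "holo (\<lambda>z. f (inv_into V \<phi> z)) B" "holo (\<lambda>z. g (inv_into V \<phi> z)) B"
    using holo_near_both[OF c p f g] .
  note B = this
  show "holo_near M p (\<lambda>x. f x + g x)"
    unfolding holo_near_iff[OF c p] using B(1-3) holo_add[OF B(4,5)] by blast
  show "holo_near M p (\<lambda>x. f x * g x)"
    unfolding holo_near_iff[OF c p] using B(1-3) holo_mult[OF B(4,5)] by blast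
qed

lemma holo_near_const: "p \<in> points M \<Longrightarrow> holo_near M p (\<lambda>x. k)"
proof -
  assume "p \<in> points M"
  then obtain V \<phi> where c: "(V, \<phi>) \<in> charts M" and p: "p \<in> V" using chart_at by blast
  have "open (\<phi> ` V)" using chart_image_open[OF c chart_openin[OF c]] by simp
  then show ?thesis unfolding holo_near_iff[OF c p] using p holo_const by blast
qed

lemma holo_near_cmult: "holo_near M p f \<Longrightarrow> holo_near M p (\<lambda>x. k * f x)"
  using holo_near_ops(2)[OF holo_near_const] holo_near_point by blast

section \<open>Tangent and cotangent vectors in coordinates\<close>

text \<open>The derivation with components \<open>x\<close> in the chart \<open>c\<close>. The value
  0 off the holomorphic germs follows the convention of \<open>tangent_space\<close>.\<close>

definition tvec_of :: "('a, 'm) chart \<Rightarrow> 'a \<Rightarrow> complex ^ 'm \<Rightarrow> 'a tvec" where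
  "tvec_of c p x f = (if holo_near M p f then pair (\<lambda>k. pd k (\<lambda>z. f (inv_into (fst c) (snd c) z)) (snd c p)) x else 0)"

lemma coord_vec_tvec_of: "coord_vec M c i q = tvec_of c q (axis i 1)"
  by (cases c) (auto simp: coord_vec_def tvec_of_def pair_def pd_def o_def fun_eq_iff axis_def if_distrib cong: if_cong)

lemma tvec_of_lin: "tvec_of c p (k *s x + y) f = k * tvec_of c p x f + tvec_of c p y f"
  by (simp add: tvec_of_def pair_lin)

lemma germ_pd:
  assumes c: "(V, \<phi>) \<in> charts M" and p: "p \<in> V" and W: "openin (top_of M) W" "p \<in> W" "\<And>x. x \<in> W \<Longrightarrow> f x = g x"
  shows "pd k (\<lambda>z. f (inv_into V \<phi> z)) (\<phi> p) = pd k (\<lambda>z. g (inv_into V \<phi> z)) (\<phi> p)"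
proof (rule pd_cong_open)
  show "open (\<phi> ` (V \<inter> W))" using chart_image_open[OF c, of "V \<inter> W"] chart_openin[OF c] W by blast
qed (use p W c in auto)

lemma tvec_of_tangent:
  assumes c: "(V, \<phi>) \<in> charts M" and p: "p \<in> V"
  shows "tvec_of (V, \<phi>) p x \<in> tangent_space M p"
  unfolding tangent_space_def
proof (intro CollectI conjI allI impI)
  show "tvec_of (V, \<phi>) p x f = tvec_of (V, \<phi>) p x g"
    if t: "holo_near M p f \<and> holo_near M p g \<and> (\<exists>W. openin (top_of M) W \<and> p \<in> W \<and> (\<forall>x\<in>W. f x = g x))" for f g
  proof -
    obtain W where "openin (top_of M) W" "p \<in> W" "\<forall>x\<in>W. f x = g x" using t by blast
    then show ?thesis using t germ_pd[OF c p, of W f g] by (simp add: tvec_of_def)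
  qed
  fix f g assume fg: "holo_near M p f \<and> holo_near M p g"
  have cd: "cdiff (\<lambda>z. f (inv_into V \<phi> z)) (\<phi> p)" "cdiff (\<lambda>z. g (inv_into V \<phi> z)) (\<phi> p)"
    using holo_near_cdiff[OF c p] fg by auto
  show "tvec_of (V, \<phi>) p x (\<lambda>x. f x + g x) = tvec_of (V, \<phi>) p x f + tvec_of (V, \<phi>) p x g"
    using fg by (simp add: tvec_of_def holo_near_ops pd_add[OF cd] pair_def algebra_simps sum.distrib)
  show "tvec_of (V, \<phi>) p x (\<lambda>x. f x * g x) = f p * tvec_of (V, \<phi>) p x g + g p * tvec_of (V, \<phi>) p x f"
    using fg c p by (simp add: tvec_of_def holo_near_ops pd_mult[OF cd] pair_def algebra_simps sum.distrib sum_distrib_left)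
next
  fix k f assume f: "holo_near M p f"
  have cd: "cdiff (\<lambda>z. f (inv_into V \<phi> z)) (\<phi> p)" using holo_near_cdiff[OF c p f] .
  show "tvec_of (V, \<phi>) p x (\<lambda>x. k * f x) = k * tvec_of (V, \<phi>) p x f"
    using f by (simp add: tvec_of_def holo_near_cmult pd_mult[OF cdiff_const cd] pair_def algebra_simps sum_distrib_left)
qed (simp add: tvec_of_def)

lemma tvec_of_coord:
  assumes c: "(V, \<phi>) \<in> charts M" and p: "p \<in> V"
  shows "tvec_of (V, \<phi>) p x (\<lambda>y. \<phi> y $ i) = x $ i"
proof -
  have "pd k (\<lambda>z. \<phi> (inv_into V \<phi> z) $ i) (\<phi> p) = (if k = i then 1 else 0)" for k
  proof -
    have "pd k (\<lambda>z. \<phi> (inv_into V \<phi> z) $ i) (\<phi> p) = pd k (\<lambda>z. z $ i) (\<phi> p)"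
      by (rule pd_cong_open[of "\<phi> ` V"])
        (use p chart_image_open[OF c chart_openin[OF c]] in \<open>auto simp: f_inv_into_f\<close>)
    then show ?thesis by simp
  qed
  then show ?thesis
    using holo_near_coord[OF c p] by (simp add: tvec_of_def pair_def if_distrib[of "\<lambda>x. x * _"] cong: if_cong)
qed

lemma tangent_space_germ:
  assumes "v \<in> tangent_space M p" "holo_near M p f" "holo_near M p g"
    and "openin (top_of M) W" "p \<in> W" "\<And>x. x \<in> W \<Longrightarrow> f x = g x"
  shows "v f = v g"
  using assms unfolding tangent_space_def mem_Collect_eq by blast

lemma tangent_space_add:
  "v \<in> tangent_space M p \<Longrightarrow> holo_near M p f \<Longrightarrow> holo_near M p g \<Longrightarrow> v (\<lambda>x. f x + g x) = v f + v g"
  by (simp add: tangent_space_def)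

lemma tangent_space_cmult:
  "v \<in> tangent_space M p \<Longrightarrow> holo_near M p f \<Longrightarrow> v (\<lambda>x. k * f x) = k * v f"
  by (simp add: tangent_space_def)

lemma tangent_space_mult:
  "v \<in> tangent_space M p \<Longrightarrow> holo_near M p f \<Longrightarrow> holo_near M p g \<Longrightarrow>
    v (\<lambda>x. f x * g x) = f p * v g + g p * v f"
  by (simp add: tangent_space_def)

lemma tangent_space_outside: "v \<in> tangent_space M p \<Longrightarrow> \<not> holo_near M p f \<Longrightarrow> v f = 0"
  by (simp add: tangent_space_def)

lemma tangent_sum:
  assumes v: "v \<in> tangent_space M p" and p: "p \<in> points M" and g: "\<And>i. i \<in> I \<Longrightarrow> holo_near M p (g i)" and I: "finite I"
  shows "holo_near M p (\<lambda>x. \<Sum>i\<in>I. g i x) \<and> v (\<lambda>x. \<Sum>i\<in>I. g i x) = (\<Sum>i\<in>I. v (g i))"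
  using I g
proof (induction I)
  case empty
  have "v (\<lambda>x. 0 * 0) = 0 * v (\<lambda>x. 0)"
    by (rule tangent_space_cmult[OF v holo_near_const[OF p]])
  then show ?case using holo_near_const[OF p] by simp
next
  case (insert i I)
  have "v (\<lambda>x. g i x + (\<Sum>j\<in>I. g j x)) = v (g i) + v (\<lambda>x. \<Sum>j\<in>I. g j x)"
    using insert by (intro tangent_space_add[OF v]) auto
  then show ?case using insert holo_near_ops(1)[of p "g i"] by simp
qed

text \<open>By Hadamard's lemma \<open>f = f(p) + \<Sum>\<^sub>i (z\<^sub>i - p\<^sub>i) g\<^sub>i\<close>, a derivation is determined by its values on the coordinates.\<close>

lemma tangent_tvec_of:
  assumes c: "(V, \<phi>) \<in> charts M" and p: "p \<in> V" and v: "v \<in> tangent_space M p"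
  shows "v = tvec_of (V, \<phi>) p (\<chi> i. v (\<lambda>x. \<phi> x $ i))"
proof
  fix f
  have pM: "p \<in> points M" using chart_openin[OF c] p openin_subset by blast
  have v_add: "v (\<lambda>x. f x + g x) = v f + v g" and v_mult: "v (\<lambda>x. f x * g x) = f p * v g + g p * v f"
    if "holo_near M p f" "holo_near M p g" for f g
    using tangent_space_add[OF v that] tangent_space_mult[OF v that] by blast+
  have v_cmult: "v (\<lambda>x. k * f x) = k * v f" if "holo_near M p f" for f k
    using tangent_space_cmult[OF v that] .
  \<comment> \<open>The product rule for 1 = 1 * 1 shows that derivations kill constants.\<close>
  have "v (\<lambda>x. 1 * 1) = 1 * v (\<lambda>x. 1) + 1 * v (\<lambda>x. 1)"
    using v_mult[OF holo_near_const[OF pM] holo_near_const[OF pM], of 1 1] by simp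
  then have v1: "v (\<lambda>x. 1) = 0" by simp
  have v_const: "v (\<lambda>x. k) = 0" for k
    using v_cmult[OF holo_near_const[OF pM], of k 1] v1 by simp
  show "v f = tvec_of (V, \<phi>) p (\<chi> i. v (\<lambda>x. \<phi> x $ i)) f"
  proof (cases "holo_near M p f")
    case True
    then obtain B where B: "open B" "\<phi> p \<in> B" "B \<subseteq> \<phi> ` V" "holo (\<lambda>z. f (inv_into V \<phi> z)) B"
      unfolding holo_near_iff[OF c p] by blast
    obtain r where r: "0 < r" "ball (\<phi> p) r \<subseteq> B" using B openE by blast
    let ?F = "\<lambda>z. f (inv_into V \<phi> z)"
    obtain g where g: "\<And>i. holo (g i) (ball (\<phi> p) r)"
      "\<And>z. z \<in> ball (\<phi> p) r \<Longrightarrow> ?F z - ?F (\<phi> p) = (\<Sum>i\<in>UNIV. (z - \<phi> p) $ i * g i z)"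
      "\<And>i z. z \<in> ball (\<phi> p) r \<Longrightarrow> \<phi> p = z \<Longrightarrow> g i z = pd i ?F z"
      by (rule holo_segment[where f = ?F and U = "ball (\<phi> p) r" and P = "\<lambda>z. \<phi> p"])
         (use holo_subset[OF B(4) open_ball r(2)] r in \<open>auto intro: holo_const\<close>)
    define W where "W = {x \<in> V. \<phi> x \<in> ball (\<phi> p) r}"
    have W: "openin (top_of M) W" "p \<in> W" using chart_preimage_open[OF c open_ball] p r by (auto simp: W_def)
    have ng: "holo_near M p (\<lambda>x. g i (\<phi> x))" for i
      unfolding holo_near_iff[OF c p]
    proof (intro exI conjI)
      show sub: "ball (\<phi> p) r \<subseteq> \<phi> ` V" using r B by blast
      show "holo (\<lambda>z. g i (\<phi> (inv_into V \<phi> z))) (ball (\<phi> p) r)"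
        using holo_cong[of "ball (\<phi> p) r" "\<lambda>z. g i (\<phi> (inv_into V \<phi> z))" "g i"] g(1)[of i] sub
        by (metis f_inv_into_f subsetD)
    qed (use r in auto)
    have nc: "holo_near M p (\<lambda>x. \<phi> x $ i + (- \<phi> p $ i))" for i
      by (rule holo_near_ops[OF holo_near_coord[OF c p] holo_near_const[OF pM]])
    let ?G = "\<lambda>i x. (\<phi> x $ i + (- \<phi> p $ i)) * g i (\<phi> x)"
    have nG: "holo_near M p (?G i)" for i by (rule holo_near_ops[OF nc ng])
    have vG: "v (?G i) = pd i ?F (\<phi> p) * v (\<lambda>x. \<phi> x $ i)" for i
      unfolding v_mult[OF nc ng] v_add[OF holo_near_coord[OF c p] holo_near_const[OF pM]]
      using g(3)[of "\<phi> p"] r(1) by (simp add: v_const)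
    have sum: "holo_near M p (\<lambda>x. \<Sum>i\<in>UNIV. ?G i x) \<and> v (\<lambda>x. \<Sum>i\<in>UNIV. ?G i x) = (\<Sum>i\<in>UNIV. v (?G i))"
      by (rule tangent_sum[OF v pM nG]) simp
    have "f x = f p + (\<Sum>i\<in>UNIV. ?G i x)" if "x \<in> W" for x
      using g(2)[of "\<phi> x"] that c p by (simp add: W_def algebra_simps)
    moreover have "holo_near M p (\<lambda>x. f p + (\<Sum>i\<in>UNIV. ?G i x))"
      using holo_near_ops(1)[OF holo_near_const[OF pM]] sum by blast
    ultimately have "v f = v (\<lambda>x. f p + (\<Sum>i\<in>UNIV. ?G i x))"
      by (intro tangent_space_germ[OF v True _ W])
    also have "\<dots> = (\<Sum>i\<in>UNIV. pd i ?F (\<phi> p) * v (\<lambda>x. \<phi> x $ i))"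
      using v_add[OF holo_near_const[OF pM]] sum vG by (simp add: v_const)
    finally show ?thesis using True by (simp add: tvec_of_def pair_def)
  next
    case False
    then have "v f = 0" using tangent_space_outside[OF v] by blast
    then show ?thesis using False by (simp add: tvec_of_def)
  qed
qed

lemma cotangent_space_add:
  "\<xi> \<in> cotangent_space M p \<Longrightarrow> v \<in> tangent_space M p \<Longrightarrow> w \<in> tangent_space M p \<Longrightarrow>
    \<xi> (\<lambda>f. v f + w f) = \<xi> v + \<xi> w"
  by (simp add: cotangent_space_def)

lemma cotangent_space_cmult:
  "\<xi> \<in> cotangent_space M p \<Longrightarrow> v \<in> tangent_space M p \<Longrightarrow> \<xi> (\<lambda>f. k * v f) = k * \<xi> v"
  by (simp add: cotangent_space_def)

lemma cotangent_space_outside: "\<xi> \<in> cotangent_space M p \<Longrightarrow> v \<notin> tangent_space M p \<Longrightarrow> \<xi> v = 0"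
  by (simp add: cotangent_space_def)

lemma cotangent_tvec_of:
  assumes c: "(V, \<phi>) \<in> charts M" and p: "p \<in> V" and \<xi>: "\<xi> \<in> cotangent_space M p"
  shows "\<xi> (tvec_of (V, \<phi>) p x) = pair (\<lambda>i. \<xi> (coord_vec M (V, \<phi>) i p)) x"
proof -
  let ?T = "tvec_of (V, \<phi>) p"
  have T: "?T x \<in> tangent_space M p" for x using tvec_of_tangent[OF c p] .
  have add: "\<xi> (?T (x + y)) = \<xi> (?T x) + \<xi> (?T y)" for x y
  proof -
    have "?T (x + y) = (\<lambda>f. ?T x f + ?T y f)" using tvec_of_lin[of _ p 1 x y] by auto
    then show ?thesis using cotangent_space_add[OF \<xi> T T] by simp
  qed
  have zero: "?T 0 = (\<lambda>f. 0)" by (simp add: tvec_of_def pair_def fun_eq_iff)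
  have scale: "\<xi> (?T (k *s x)) = k * \<xi> (?T x)" for k x
  proof -
    have "?T (k *s x) = (\<lambda>f. k * ?T x f)" using tvec_of_lin[of _ p k x 0] zero by (auto simp: fun_eq_iff)
    then show ?thesis using cotangent_space_cmult[OF \<xi> T] by simp
  qed
  have z: "\<xi> (?T 0) = 0" using scale[of 0 0] by simp
  have "\<xi> (?T (\<Sum>i\<in>I. x $ i *s axis i 1)) = (\<Sum>i\<in>I. x $ i * \<xi> (?T (axis i 1)))" for I
    by (induction I rule: infinite_finite_induct) (simp_all add: z add scale)
  from this[of UNIV] show ?thesis
    by (simp add: basis_expansion pair_def coord_vec_tvec_of mult.commute)
qed

lemma cotangent_eqI:
  assumes c: "(V, \<phi>) \<in> charts M" and p: "p \<in> V" and "\<xi> \<in> cotangent_space M p" "\<eta> \<in> cotangent_space M p"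
    and "\<And>i. \<xi> (coord_vec M (V, \<phi>) i p) = \<eta> (coord_vec M (V, \<phi>) i p)"
  shows "\<xi> = \<eta>"
proof
  fix v show "\<xi> v = \<eta> v"
  proof (cases "v \<in> tangent_space M p")
    case True
    then obtain x where "v = tvec_of (V, \<phi>) p x" using tangent_tvec_of[OF c p True] by blast
    then show ?thesis by (simp add: cotangent_tvec_of[OF c p assms(3)] cotangent_tvec_of[OF c p assms(4)] assms(5))
  next
    case False
    then show ?thesis using assms(3,4) cotangent_space_outside by metis
  qed
qed

text \<open>The components of a coordinate vector of \<open>\<psi>\<close> in the chart
  \<open>\<phi>\<close> are its values on the coordinate functions of \<open>\<phi>\<close>, that
  is, a column of the Jacobian of the transition map.\<close>

lemma coeff_change:
  assumes c: "(V, \<phi>) \<in> charts M" and d: "(A, \<psi>) \<in> charts M" and q: "q \<in> V" "q \<in> A"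
    and \<alpha>: "\<alpha> q \<in> cotangent_space M q"
  shows "coeff M (A, \<psi>) \<alpha> j q = (\<Sum>i\<in>UNIV. pd j (\<lambda>z. \<phi> (inv_into A \<psi> z) $ i) (\<psi> q) * coeff M (V, \<phi>) \<alpha> i q)"
proof -
  have "coord_vec M (A, \<psi>) j q = tvec_of (V, \<phi>) q (\<chi> i. tvec_of (A, \<psi>) q (axis j 1) (\<lambda>x. \<phi> x $ i))"
    unfolding coord_vec_tvec_of by (rule tangent_tvec_of[OF c q(1) tvec_of_tangent[OF d q(2)]])
  moreover have "tvec_of (A, \<psi>) q (axis j 1) (\<lambda>x. \<phi> x $ i) = pd j (\<lambda>z. \<phi> (inv_into A \<psi> z) $ i) (\<psi> q)" for i
    using holo_near_coord[OF c q(1), of i]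
    by (simp add: tvec_of_def pair_def axis_def if_distrib[of "\<lambda>x. _ * x"] cong: if_cong)
  ultimately show ?thesis
    by (simp add: coeff_def cotangent_tvec_of[OF c q(1) \<alpha>]) (simp add: pair_def mult.commute)
qed

end

section \<open>One-forms and the exterior derivative in coordinates\<close>

lemma wedge_gwedge: "wedge k l \<omega> \<eta> = gwedge k l \<omega> \<eta>"
  by (simp add: wedge_def gwedge_def fun_eq_iff)

lemma wedge_power_gpower: "wedge_power \<omega> n = gpower \<omega> n"
  by (induction n) (simp_all add: wedge_gwedge)

lemma gwedge_pullback:
  "gwedge k l \<omega> \<eta> (\<lambda>i. T (x i)) = gwedge k l (\<lambda>u. \<omega> (\<lambda>i. T (u i))) (\<lambda>u. \<eta> (\<lambda>i. T (u i))) x"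
  by (simp add: gwedge_def)

lemma gpower_pullback: "gpower \<omega> n (\<lambda>i. T (x i)) = gpower (\<lambda>u. \<omega> (\<lambda>i. T (u i))) n x"
  by (induction n arbitrary: x) (simp_all add: gwedge_def)

text \<open>The set \<open>K\<close> is meant for tangent vectors: the exterior derivatives on a
  manifold and on an open part of it are shown to agree on these only.\<close>

lemma gpower_cong:
  assumes "\<And>v. (\<And>i. v i \<in> K) \<Longrightarrow> \<omega> v = \<omega>' v" and "\<And>i. v i \<in> K"
  shows "gpower \<omega> n v = gpower \<omega>' n v"
  using assms(2)
proof (induction n arbitrary: v)
  case (Suc n)
  then have "\<omega> (\<lambda>i. v (\<sigma> i)) = \<omega>' (\<lambda>i. v (\<sigma> i))"
    "gpower \<omega> n (\<lambda>i. v (\<sigma> (2 + i))) = gpower \<omega>' n (\<lambda>i. v (\<sigma> (2 + i)))" for \<sigma>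
    by (auto intro: assms(1))
  then show ?case by (simp add: gwedge_def)
qed simp

lemma hessian_symmetric:
  assumes "holo f U" "z \<in> U"
  shows "(\<Sum>i\<in>UNIV. pair (\<lambda>k. pd k (pd i f) z) x * y $ i) = (\<Sum>i\<in>UNIV. pair (\<lambda>k. pd k (pd i f) z) y * x $ i)"
proof -
  have "(\<Sum>i\<in>UNIV. pair (\<lambda>k. pd k (pd i f) z) x * y $ i) = (\<Sum>i\<in>UNIV. \<Sum>k\<in>UNIV. pd k (pd i f) z * x $ k * y $ i)"
    by (simp add: pair_def sum_distrib_right)
  also have "\<dots> = (\<Sum>k\<in>UNIV. \<Sum>i\<in>UNIV. pd k (pd i f) z * x $ k * y $ i)"
    by (rule sum.swap)
  also have "\<dots> = (\<Sum>k\<in>UNIV. \<Sum>i\<in>UNIV. pd i (pd k f) z * y $ i * x $ k)"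
    by (intro sum.cong refl) (simp add: pd_commute[OF assms] mult_ac)
  finally show ?thesis by (simp add: pair_def sum_distrib_right)
qed

text \<open>Invariance of \<open>d\<close> under a change \<open>\<tau>\<close> of coordinates: the second derivatives of \<open>\<tau>\<close> cancel by symmetry.\<close>

lemma dform_change:
  assumes U: "open U" "z \<in> U" and \<tau>: "\<And>j. holo (\<tau> j) U" and b: "\<And>j. holo (b j) U"
    and a: "\<And>i w. w \<in> U \<Longrightarrow> a i w = (\<Sum>j\<in>UNIV. pd i (\<tau> j) w * b j w)"
  shows "dform a z u = (\<Sum>j\<in>(UNIV :: 'm::finite set).
    pair (\<lambda>k. pd k (b j) z) (u 0) * pair (\<lambda>k. pd k (\<tau> j) z) (u 1)
    - pair (\<lambda>k. pd k (b j) z) (u 1) * pair (\<lambda>k. pd k (\<tau> j) z) (u 0))"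
proof -
  have pda: "pd k (a i) z = (\<Sum>j\<in>UNIV. pd k (pd i (\<tau> j)) z * b j z + pd i (\<tau> j) z * pd k (b j) z)" for k i
  proof -
    have cd: "cdiff (pd i (\<tau> j)) z" "cdiff (b j) z" for j
      using holoD[OF holo_pd[OF \<tau>] U(2)] holoD[OF b U(2)] by auto
    have "pd k (a i) z = pd k (\<lambda>w. \<Sum>j\<in>UNIV. pd i (\<tau> j) w * b j w) z"
      by (rule pd_cong_open[OF U]) (rule a)
    also have "\<dots> = (\<Sum>j\<in>UNIV. pd k (\<lambda>w. pd i (\<tau> j) w * b j w) z)"
      by (rule pd_sum) (intro cdiff_mult cd)
    finally show ?thesis by (simp add: pd_mult[OF cd])
  qed
  let ?H = "\<lambda>i j x. pair (\<lambda>k. pd k (pd i (\<tau> j)) z) x" and ?B = "\<lambda>j x. pair (\<lambda>k. pd k (b j) z) x"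
  have P: "pair (\<lambda>k. pd k (a i) z) x = (\<Sum>j\<in>UNIV. b j z * ?H i j x + pd i (\<tau> j) z * ?B j x)" for i x
  proof -
    have "pair (\<lambda>k. pd k (a i) z) x = (\<Sum>k\<in>UNIV. \<Sum>j\<in>UNIV. (pd k (pd i (\<tau> j)) z * b j z + pd i (\<tau> j) z * pd k (b j) z) * x $ k)"
      by (simp add: pair_def pda sum_distrib_right)
    also have "\<dots> = (\<Sum>j\<in>UNIV. \<Sum>k\<in>UNIV. (pd k (pd i (\<tau> j)) z * b j z + pd i (\<tau> j) z * pd k (b j) z) * x $ k)"
      by (rule sum.swap)
    also have "\<dots> = (\<Sum>j\<in>UNIV. b j z * ?H i j x + pd i (\<tau> j) z * ?B j x)"
      by (intro sum.cong refl) (simp add: pair_def sum_distrib_left algebra_simps sum.distrib)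
    finally show ?thesis .
  qed
  have S: "(\<Sum>i\<in>UNIV. pair (\<lambda>k. pd k (a i) z) x * y $ i) =
      (\<Sum>j\<in>UNIV. b j z * (\<Sum>i\<in>UNIV. ?H i j x * y $ i) + ?B j x * pair (\<lambda>k. pd k (\<tau> j) z) y)" for x y
  proof -
    have "(\<Sum>i\<in>UNIV. pair (\<lambda>k. pd k (a i) z) x * y $ i) =
        (\<Sum>i\<in>UNIV. \<Sum>j\<in>UNIV. (b j z * ?H i j x + pd i (\<tau> j) z * ?B j x) * y $ i)"
      by (simp add: P sum_distrib_right)
    also have "\<dots> = (\<Sum>j\<in>UNIV. \<Sum>i\<in>UNIV. (b j z * ?H i j x + pd i (\<tau> j) z * ?B j x) * y $ i)"
      by (rule sum.swap)
    also have "\<dots> = (\<Sum>j\<in>UNIV. b j z * (\<Sum>i\<in>UNIV. ?H i j x * y $ i) + ?B j x * pair (\<lambda>k. pd k (\<tau> j) z) y)"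
    proof (intro sum.cong refl)
      fix j
      show "(\<Sum>i\<in>UNIV. (b j z * ?H i j x + pd i (\<tau> j) z * ?B j x) * y $ i) =
          b j z * (\<Sum>i\<in>UNIV. ?H i j x * y $ i) + ?B j x * pair (\<lambda>k. pd k (\<tau> j) z) y"
        unfolding pair_def[of "\<lambda>k. pd k (\<tau> j) z" y] sum_distrib_left sum.distrib[symmetric]
        by (intro sum.cong refl) (simp add: algebra_simps)
    qed
    finally show ?thesis .
  qed
  have "dform a z u = (\<Sum>i\<in>UNIV. pair (\<lambda>k. pd k (a i) z) (u 0) * u 1 $ i) - (\<Sum>i\<in>UNIV. pair (\<lambda>k. pd k (a i) z) (u 1) * u 0 $ i)"
    by (simp add: dform_def sum_subtractf)
  then show ?thesis
    unfolding S by (simp add: hessian_symmetric[OF \<tau> U(2), where x = "u 0" and y = "u (Suc 0)"] flip: sum_subtractf)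
qed

context cmanifold
begin

lemma holo_fun_openin: "holo_fun M W f \<Longrightarrow> openin (top_of M) W"
  by (simp add: holo_fun_def)

lemma one_form_openin: "holo_one_form M W \<alpha> \<Longrightarrow> openin (top_of M) W"
  by (simp add: holo_one_form_def)

lemma one_form_cotangent: "holo_one_form M W \<alpha> \<Longrightarrow> q \<in> W \<Longrightarrow> \<alpha> q \<in> cotangent_space M q"
  by (simp add: holo_one_form_def)

text \<open>The same passage from atlas to maximal atlas as for functions, now with the Jacobian of
  the transition map, whose entries are holomorphic by \<open>holo_pd\<close>.\<close>

lemma one_form_coeff:
  assumes \<alpha>: "holo_one_form M W \<alpha>" and c: "(V, \<phi>) \<in> charts M"
  shows "holo (\<lambda>z. coeff M (V, \<phi>) \<alpha> i (inv_into V \<phi> z)) (\<phi> ` (V \<inter> W))"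
proof (rule holo_local)
  fix z assume "z \<in> \<phi> ` (V \<inter> W)"
  then obtain x where x: "x \<in> V" "x \<in> W" "z = \<phi> x" by auto
  have W: "openin (top_of M) W" using one_form_openin[OF \<alpha>] .
  then have "x \<in> points M" using x openin_subset by blast
  then obtain A \<psi> where d: "(A, \<psi>) \<in> atlas M" "x \<in> A" using atlas_cover by blast
  note d' = atlas_charts[OF d(1)]
  have op: "openin (top_of M) (V \<inter> A \<inter> W)" using chart_openin[OF c] chart_openin[OF d'] W by blast
  let ?B = "\<phi> ` (V \<inter> A \<inter> W)"
  have oB: "open ?B" by (rule chart_image_open[OF c op]) auto
  have 1: "holo (pd i (\<lambda>z. \<psi> (inv_into V \<phi> z) $ j)) ?B" for j
    by (rule holo_subset[OF holo_pd[OF transition(1)[OF c d(1)]] oB]) auto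
  have 2: "holo (\<lambda>z. coeff M (A, \<psi>) \<alpha> j (inv_into V \<phi> z)) ?B" for j
  proof -
    have "holo_fun M (A \<inter> W) (coeff M (A, \<psi>) \<alpha> j)" using \<alpha> d(1) by (fastforce simp: holo_one_form_def)
    from holo_subset[OF holo_fun_chart[OF c this] oB] show ?thesis by auto
  qed
  have "holo (\<lambda>z. \<Sum>j\<in>UNIV. pd i (\<lambda>z. \<psi> (inv_into V \<phi> z) $ j) z * coeff M (A, \<psi>) \<alpha> j (inv_into V \<phi> z)) ?B"
    by (intro holo_sum oB holo_mult 1 2)
  then have "holo (\<lambda>z. coeff M (V, \<phi>) \<alpha> i (inv_into V \<phi> z)) ?B"
  proof (rule holo_transfer)
    fix w assume "w \<in> ?B"
    then obtain q where q: "q \<in> V" "q \<in> A" "q \<in> W" "w = \<phi> q" by auto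
    show "(\<Sum>j\<in>UNIV. pd i (\<lambda>z. \<psi> (inv_into V \<phi> z) $ j) w * coeff M (A, \<psi>) \<alpha> j (inv_into V \<phi> w))
        = coeff M (V, \<phi>) \<alpha> i (inv_into V \<phi> w)"
      using coeff_change[where \<alpha> = \<alpha> and j = i, OF d' c q(2,1) one_form_cotangent[OF \<alpha> q(3)]] c q by simp
  qed
  then show "\<exists>Va. z \<in> Va \<and> Va \<subseteq> \<phi> ` (V \<inter> W) \<and> holo (\<lambda>z. coeff M (V, \<phi>) \<alpha> i (inv_into V \<phi> z)) Va"
    using x d by (intro exI[of _ ?B]) auto
qed

lemma one_formI:
  assumes c: "(V, \<phi>) \<in> charts M" and W: "openin (top_of M) W" "W \<subseteq> V"
    and \<alpha>: "\<And>q. q \<in> W \<Longrightarrow> \<alpha> q \<in> cotangent_space M q"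
    and h: "\<And>i. holo (\<lambda>z. coeff M (V, \<phi>) \<alpha> i (inv_into V \<phi> z)) (\<phi> ` W)"
  shows "holo_one_form M W \<alpha>"
  unfolding holo_one_form_def
proof (intro conjI W(1) ballI allI \<alpha>)
  fix d j assume "d \<in> atlas M"
  then obtain A \<psi> where d: "d = (A, \<psi>)" "(A, \<psi>) \<in> atlas M" by (cases d) auto
  note d' = atlas_charts[OF d(2)]
  have op: "openin (top_of M) (A \<inter> W)" using chart_openin[OF d'] W by blast
  let ?B = "\<psi> ` (A \<inter> W)"
  have oB: "open ?B" by (rule chart_image_open[OF d' op]) auto
  have 1: "holo (pd j (\<lambda>z. \<phi> (inv_into A \<psi> z) $ i)) ?B" for i
    by (rule holo_subset[OF holo_pd[OF transition(2)[OF c d(2)]] oB]) (use W in auto)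
  have 2: "holo (\<lambda>z. coeff M (V, \<phi>) \<alpha> i (inv_into A \<psi> z)) ?B" for i
    using holo_fun_chart[OF d' holo_fun_chartI[OF c W h]] .
  have "holo (\<lambda>z. \<Sum>i\<in>UNIV. pd j (\<lambda>z. \<phi> (inv_into A \<psi> z) $ i) z * coeff M (V, \<phi>) \<alpha> i (inv_into A \<psi> z)) ?B"
    by (intro holo_sum oB holo_mult 1 2)
  then have "holo (\<lambda>z. coeff M (A, \<psi>) \<alpha> j (inv_into A \<psi> z)) ?B"
  proof (rule holo_transfer)
    fix w assume "w \<in> ?B"
    then obtain q where q: "q \<in> A" "q \<in> W" "w = \<psi> q" by auto
    then show "(\<Sum>i\<in>UNIV. pd j (\<lambda>z. \<phi> (inv_into A \<psi> z) $ i) w * coeff M (V, \<phi>) \<alpha> i (inv_into A \<psi> w))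
        = coeff M (A, \<psi>) \<alpha> j (inv_into A \<psi> w)"
      using coeff_change[where \<alpha> = \<alpha> and j = j, OF c d' _ q(1) \<alpha>[OF q(2)]] d' W by auto
  qed
  then show "holo_fun M (fst d \<inter> W) (coeff M d \<alpha> j)"
    unfolding d using holo_fun_chartI[OF d' op] by simp
qed

text \<open>The form is \<open>\<Sum>\<^sub>i a\<^sub>i dx\<^sub>i\<close> with
  \<open>dx\<^sub>i(v) = v(x\<^sub>i)\<close>. That it is a cotangent vector rests on the tangent
  space being closed under linear combinations, which is seen in coordinates.\<close>

lemma one_form_of_coeffs:
  assumes c: "(V, \<phi>) \<in> charts M" and W: "openin (top_of M) W" "W \<subseteq> V" and a: "\<And>i. holo (a i) (\<phi> ` W)"
  obtains \<alpha> where "holo_one_form M W \<alpha>" "\<And>q i. q \<in> W \<Longrightarrow> coeff M (V, \<phi>) \<alpha> i q = a i (\<phi> q)"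
proof -
  define \<alpha> where "\<alpha> q v = (if v \<in> tangent_space M q then \<Sum>i\<in>UNIV. a i (\<phi> q) * v (\<lambda>x. \<phi> x $ i) else 0)" for q v
  have coeff: "coeff M (V, \<phi>) \<alpha> i q = a i (\<phi> q)" if "q \<in> W" for q i
    using that W tvec_of_tangent[OF c, of q] tvec_of_coord[OF c, of q]
    by (auto simp: coeff_def coord_vec_tvec_of \<alpha>_def axis_def if_distrib[of "\<lambda>x. _ * x"] cong: if_cong)
  have cot: "\<alpha> q \<in> cotangent_space M q" if q: "q \<in> W" for q
  proof -
    have qV: "q \<in> V" using q W by blast
    have lin: "(\<lambda>f. k * v f + w f) \<in> tangent_space M q" if t: "v \<in> tangent_space M q" "w \<in> tangent_space M q" for k v w
    proof -
      obtain x y where "v = tvec_of (V, \<phi>) q x" "w = tvec_of (V, \<phi>) q y"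
        using tangent_tvec_of[OF c qV t(1)] tangent_tvec_of[OF c qV t(2)] by blast
      then have "(\<lambda>f. k * v f + w f) = tvec_of (V, \<phi>) q (k *s x + y)" by (simp add: tvec_of_lin fun_eq_iff)
      then show ?thesis using tvec_of_tangent[OF c qV] by simp
    qed
    have zero: "(\<lambda>f. 0) \<in> tangent_space M q"
      using tvec_of_tangent[OF c qV, of 0] by (simp add: tvec_of_def[abs_def] pair_def if_distrib cong: if_cong)
    have "(\<lambda>f. v f + w f) \<in> tangent_space M q" if "v \<in> tangent_space M q" "w \<in> tangent_space M q" for v w
      using lin[of v w 1] that by simp
    moreover have "(\<lambda>f. k * v f) \<in> tangent_space M q" if "v \<in> tangent_space M q" for v k
      using lin[OF that zero, of k] by simp
    ultimately show ?thesis
      by (simp add: cotangent_space_def \<alpha>_def algebra_simps sum.distrib sum_distrib_left)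
  qed
  have "holo_one_form M W \<alpha>"
  proof (rule one_formI[OF c W cot])
    show "holo (\<lambda>z. coeff M (V, \<phi>) \<alpha> i (inv_into V \<phi> z)) (\<phi> ` W)" for i
      by (rule holo_transfer[OF a]) (use coeff W c in auto)
  qed
  then show thesis using coeff that by blast
qed

definition chart_coeff :: "('a, 'm) chart \<Rightarrow> ('a \<Rightarrow> 'a covec) \<Rightarrow> 'm \<Rightarrow> complex ^ 'm \<Rightarrow> complex" where
  "chart_coeff c \<alpha> i z = coeff M c \<alpha> i (inv_into (fst c) (snd c) z)"

lemma holo_chart_coeff: "holo_one_form M W \<alpha> \<Longrightarrow> (V, \<phi>) \<in> charts M \<Longrightarrow> holo (chart_coeff (V, \<phi>) \<alpha> i) (\<phi> ` (V \<inter> W))"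
  unfolding chart_coeff_def[abs_def] fst_conv snd_conv by (rule one_form_coeff)

lemma chart_coeff_at: "(V, \<phi>) \<in> charts M \<Longrightarrow> q \<in> V \<Longrightarrow> chart_coeff (V, \<phi>) \<alpha> i (\<phi> q) = coeff M (V, \<phi>) \<alpha> i q"
  by (simp add: chart_coeff_def)

text \<open>Two charts are mixed: \<open>d\<alpha>\<close> is computed in \<open>(A, \<psi>)\<close>
  and evaluated on vectors given in \<open>(V, \<phi>)\<close>. This is the invariance in
  \<open>dform_change\<close> with \<open>\<tau>\<close> the transition map, and the reason why the
  choice of chart in \<open>contact_at\<close> is immaterial.\<close>

lemma ext_deriv_dform:
  assumes \<alpha>: "holo_one_form M W \<alpha>" and c: "(V, \<phi>) \<in> charts M" and p: "p \<in> V" "p \<in> W"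
    and d: "(A, \<psi>) \<in> atlas M" "p \<in> A"
  shows "ext_deriv M (A, \<psi>) \<alpha> (\<lambda>i. tvec_of (V, \<phi>) p (x i)) = dform (chart_coeff (V, \<phi>) \<alpha>) (\<phi> p) x"
proof -
  note d' = atlas_charts[OF d(1)]
  have W: "openin (top_of M) W" using one_form_openin[OF \<alpha>] .
  have op: "openin (top_of M) (V \<inter> A \<inter> W)" using chart_openin[OF c] chart_openin[OF d'] W by blast
  let ?B = "\<phi> ` (V \<inter> A \<inter> W)"
  define \<tau> where "\<tau> j z = \<psi> (inv_into V \<phi> z) $ j" for j z
  define b where "b j z = coeff M (A, \<psi>) \<alpha> j (inv_into V \<phi> z)" for j z
  have oB: "open ?B" by (rule chart_image_open[OF c op]) auto
  have cf: "holo_fun M (A \<inter> W) (coeff M (A, \<psi>) \<alpha> j)" for j using \<alpha> d(1) by (fastforce simp: holo_one_form_def)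
  have h\<tau>: "holo (\<tau> j) ?B" for j
    unfolding \<tau>_def by (rule holo_subset[OF transition(1)[OF c d(1)] oB]) auto
  have hb: "holo (b j) ?B" for j
    using holo_subset[OF holo_fun_chart[OF c cf] oB] unfolding b_def by auto
  have "dform (chart_coeff (V, \<phi>) \<alpha>) (\<phi> p) x = (\<Sum>j\<in>UNIV.
      pair (\<lambda>k. pd k (b j) (\<phi> p)) (x 0) * pair (\<lambda>k. pd k (\<tau> j) (\<phi> p)) (x 1)
      - pair (\<lambda>k. pd k (b j) (\<phi> p)) (x 1) * pair (\<lambda>k. pd k (\<tau> j) (\<phi> p)) (x 0))"
  proof (rule dform_change[OF oB _ h\<tau> hb])
    show "\<phi> p \<in> ?B" using p d by blast
    fix i w assume "w \<in> ?B"
    then obtain q where q: "q \<in> V" "q \<in> A" "q \<in> W" "w = \<phi> q" by auto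
    show "chart_coeff (V, \<phi>) \<alpha> i w = (\<Sum>j\<in>UNIV. pd i (\<tau> j) w * b j w)"
      using coeff_change[where \<alpha> = \<alpha> and j = i, OF d' c q(2,1) one_form_cotangent[OF \<alpha> q(3)]] c q
      by (simp add: chart_coeff_def \<tau>_def[abs_def] b_def)
  qed
  moreover have "tvec_of (V, \<phi>) p y (coeff M (A, \<psi>) \<alpha> j) = pair (\<lambda>k. pd k (b j) (\<phi> p)) y" for y j
    using cf[of j] p d by (auto simp: tvec_of_def b_def[abs_def] holo_near_def)
  moreover have "tvec_of (V, \<phi>) p y (\<lambda>x. \<psi> x $ j) = pair (\<lambda>k. pd k (\<tau> j) (\<phi> p)) y" for y j
    using holo_near_coord[OF d' d(2), of j] by (simp add: tvec_of_def \<tau>_def[abs_def])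
  ultimately show ?thesis by (simp add: ext_deriv_def)
qed

text \<open>Every tangent vector has the form \<open>tvec_of (V, \<phi>) p x\<close>, so sequences
  of tangent vectors may be replaced by coordinate vectors. The contact condition can now be checked
  in one chart, which may be an adapted one.\<close>

lemma contact_at_iff:
  assumes \<alpha>: "holo_one_form M W \<alpha>" and c: "(V, \<phi>) \<in> charts M" and p: "p \<in> V" "p \<in> W"
  shows "contact_at M n \<alpha> p \<longleftrightarrow> (\<exists>x. contact_form n (chart_coeff (V, \<phi>) \<alpha>) (\<phi> p) x \<noteq> 0)"
proof -
  have eq: "wedge 1 (2 * n) (\<lambda>u. \<alpha> p (u 0)) (wedge_power (ext_deriv M (A, \<psi>) \<alpha>) n) (\<lambda>i. tvec_of (V, \<phi>) p (x i))
      = contact_form n (chart_coeff (V, \<phi>) \<alpha>) (\<phi> p) x" if d: "(A, \<psi>) \<in> atlas M" "p \<in> A" for A \<psi> x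
  proof -
    have 1: "(\<lambda>u. ext_deriv M (A, \<psi>) \<alpha> (\<lambda>i. tvec_of (V, \<phi>) p (u i))) = dform (chart_coeff (V, \<phi>) \<alpha>) (\<phi> p)"
      using ext_deriv_dform[OF \<alpha> c p d] by blast
    have 2: "\<alpha> p (tvec_of (V, \<phi>) p y) = pair (\<lambda>i. chart_coeff (V, \<phi>) \<alpha> i (\<phi> p)) y" for y
      using cotangent_tvec_of[OF c p(1) one_form_cotangent[OF \<alpha> p(2)]] c p by (simp add: chart_coeff_def coeff_def)
    show ?thesis
      unfolding wedge_gwedge wedge_power_gpower gwedge_pullback gpower_pullback 1 2 contact_form_def top_form_def ..
  qed
  have tan: "\<exists>x. v = (\<lambda>i. tvec_of (V, \<phi>) p (x i))" if "\<forall>i::nat. v i \<in> tangent_space M p" for v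
    using tangent_tvec_of[OF c p(1)] that by (intro exI[of _ "\<lambda>i. \<chi> j. v i (\<lambda>x. \<phi> x $ j)"]) auto
  have "p \<in> points M" using chart_openin[OF c] p openin_subset by blast
  then obtain A \<psi> where d: "(A, \<psi>) \<in> atlas M" "p \<in> A" using atlas_cover by blast
  show ?thesis
  proof
    assume "contact_at M n \<alpha> p"
    then obtain v where "\<forall>i. v i \<in> tangent_space M p"
      "wedge 1 (2 * n) (\<lambda>u. \<alpha> p (u 0)) (wedge_power (ext_deriv M (A, \<psi>) \<alpha>) n) v \<noteq> 0"
      using d unfolding contact_at_def by fastforce
    then show "\<exists>x. contact_form n (chart_coeff (V, \<phi>) \<alpha>) (\<phi> p) x \<noteq> 0" using tan eq[OF d] by metis
  next
    assume "\<exists>x. contact_form n (chart_coeff (V, \<phi>) \<alpha>) (\<phi> p) x \<noteq> 0"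
    then obtain x where "contact_form n (chart_coeff (V, \<phi>) \<alpha>) (\<phi> p) x \<noteq> 0" by blast
    then have "wedge 1 (2 * n) (\<lambda>u. \<alpha> p (u 0)) (wedge_power (ext_deriv M (A, \<psi>) \<alpha>) n) (\<lambda>i. tvec_of (V, \<phi>) p (x i)) \<noteq> 0"
      if "(A, \<psi>) \<in> atlas M" "p \<in> A" for A \<psi>
      using eq[OF that] by simp
    then show "contact_at M n \<alpha> p"
      unfolding contact_at_def using tvec_of_tangent[OF c p(1)] by (metis prod.collapse)
  qed
qed

section \<open>Open submanifolds\<close>

lemma holo_fun_subset:
  assumes f: "holo_fun M W f" and W': "openin (top_of M) W'" "W' \<subseteq> W"
  shows "holo_fun M W' f"
  unfolding holo_fun_def
proof (intro conjI W'(1) ballI, clarify)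
  fix V \<phi> assume "(V, \<phi>) \<in> atlas M"
  note d = atlas_charts[OF this]
  have "open (\<phi> ` (V \<inter> W'))" using chart_image_open[OF d, of "V \<inter> W'"] chart_openin[OF d] W' by blast
  then show "holo (f \<circ> inv_into V \<phi>) (\<phi> ` (V \<inter> W'))"
    unfolding o_def by (rule holo_subset[OF holo_fun_chart[OF d f]]) (use W' in blast)
qed

lemma holo_fun_transfer:
  assumes f: "holo_fun M W f" and eq: "\<And>x. x \<in> W \<Longrightarrow> f x = g x"
  shows "holo_fun M W g"
  unfolding holo_fun_def
proof (intro conjI ballI holo_fun_openin[OF f], clarify)
  fix V \<phi> assume "(V, \<phi>) \<in> atlas M"
  note d = atlas_charts[OF this]
  show "holo (g \<circ> inv_into V \<phi>) (\<phi> ` (V \<inter> W))"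
    unfolding o_def by (rule holo_transfer[OF holo_fun_chart[OF d f]]) (use eq d in auto)
qed

context
  fixes U M0
  assumes U: "openin (top_of M) U"
  defines "M0 \<equiv> open_submanifold M U"
begin

lemma submanifold_openin: "openin (top_of M0) W \<longleftrightarrow> openin (top_of M) W \<and> W \<subseteq> U"
  using U by (simp add: M0_def open_submanifold_def openin_open_subtopology)

lemma submanifold_atlas_ball: "(\<forall>c\<in>atlas M0. P c) \<longleftrightarrow> (\<forall>V \<phi>. (V, \<phi>) \<in> atlas M \<longrightarrow> P (V \<inter> U, \<phi>))"
  by (auto simp: M0_def open_submanifold_def)

lemma atlas_ball: "(\<forall>c\<in>atlas M. P c) \<longleftrightarrow> (\<forall>V \<phi>. (V, \<phi>) \<in> atlas M \<longrightarrow> P (V, \<phi>))"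
  by auto

lemma submanifold_inv:
  assumes "(V, \<phi>) \<in> atlas M" "z \<in> \<phi> ` (V \<inter> U)"
  shows "inv_into (V \<inter> U) \<phi> z = inv_into V \<phi> z"
proof -
  have "inj_on \<phi> V" using chart_inj[OF atlas_charts[OF assms(1)]] .
  then have "inj_on \<phi> (V \<inter> U)" by (rule inj_on_subset) auto
  with \<open>inj_on \<phi> V\<close> show ?thesis using assms(2) by (auto simp: inv_into_f_f)
qed

lemma submanifold_holo_fun:
  assumes W: "W \<subseteq> U"
  shows "holo_fun M0 W f \<longleftrightarrow> holo_fun M W f"
proof -
  have "holo (f \<circ> inv_into (V \<inter> U) \<phi>) (\<phi> ` (V \<inter> U \<inter> W)) \<longleftrightarrow> holo (f \<circ> inv_into V \<phi>) (\<phi> ` (V \<inter> W))"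
    if "(V, \<phi>) \<in> atlas M" for V \<phi>
  proof -
    have A: "V \<inter> U \<inter> W = V \<inter> W" using W by blast
    have "(f \<circ> inv_into (V \<inter> U) \<phi>) z = (f \<circ> inv_into V \<phi>) z" if "z \<in> \<phi> ` (V \<inter> W)" for z
      using submanifold_inv[OF \<open>(V, \<phi>) \<in> atlas M\<close>, of z] that W by auto
    then show ?thesis unfolding A by (rule holo_cong)
  qed
  then have "(\<forall>(V, \<phi>)\<in>atlas M0. holo (f \<circ> inv_into V \<phi>) (\<phi> ` (V \<inter> W))) \<longleftrightarrow>
      (\<forall>(V, \<phi>)\<in>atlas M. holo (f \<circ> inv_into V \<phi>) (\<phi> ` (V \<inter> W)))"
    unfolding submanifold_atlas_ball atlas_ball by simp
  then show ?thesis using W by (simp add: holo_fun_def submanifold_openin)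
qed

lemma submanifold_holo_near:
  assumes p: "p \<in> U"
  shows "holo_near M0 p f \<longleftrightarrow> holo_near M p f"
proof
  assume "holo_near M0 p f"
  then obtain W where W: "p \<in> W" "holo_fun M0 W f" by (auto simp: holo_near_def)
  then have "W \<subseteq> U" using submanifold_openin by (auto simp: holo_fun_def)
  then show "holo_near M p f" using W submanifold_holo_fun by (auto simp: holo_near_def)
next
  assume "holo_near M p f"
  then obtain W where W: "p \<in> W" "holo_fun M W f" by (auto simp: holo_near_def)
  have "holo_fun M (W \<inter> U) f"
    using holo_fun_openin[OF W(2)] U by (intro holo_fun_subset[OF W(2)]) auto
  then have "holo_fun M0 (W \<inter> U) f" by (simp add: submanifold_holo_fun)
  then show "holo_near M0 p f" using W p unfolding holo_near_def by blast
qed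

lemma submanifold_tangent:
  assumes p: "p \<in> U"
  shows "tangent_space M0 p = tangent_space M p"
proof -
  have "(\<exists>W. openin (top_of M0) W \<and> p \<in> W \<and> (\<forall>x\<in>W. f x = g x)) \<longleftrightarrow>
      (\<exists>W. openin (top_of M) W \<and> p \<in> W \<and> (\<forall>x\<in>W. f x = g x))" for f g :: "'a \<Rightarrow> complex"
  proof
    assume "\<exists>W. openin (top_of M) W \<and> p \<in> W \<and> (\<forall>x\<in>W. f x = g x)"
    then obtain W where "openin (top_of M) W" "p \<in> W" "\<forall>x\<in>W. f x = g x" by blast
    then show "\<exists>W. openin (top_of M0) W \<and> p \<in> W \<and> (\<forall>x\<in>W. f x = g x)"
      using U p by (intro exI[of _ "W \<inter> U"]) (auto simp: submanifold_openin)
  qed (auto simp: submanifold_openin)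
  then show ?thesis by (simp add: tangent_space_def submanifold_holo_near[OF p])
qed

lemma submanifold_cotangent: "p \<in> U \<Longrightarrow> cotangent_space M0 p = cotangent_space M p"
  by (simp add: cotangent_space_def submanifold_tangent)

lemma submanifold_coeff:
  assumes d: "(V, \<phi>) \<in> atlas M" and q: "q \<in> V" "q \<in> U"
  shows "coeff M0 (V \<inter> U, \<phi>) \<alpha> i q = coeff M (V, \<phi>) \<alpha> i q"
proof -
  note d' = atlas_charts[OF d]
  have "pd i (f \<circ> inv_into (V \<inter> U) \<phi>) (\<phi> q) = pd i (f \<circ> inv_into V \<phi>) (\<phi> q)" for f
  proof (rule pd_cong_open)
    show "open (\<phi> ` (V \<inter> U))" using chart_image_open[OF d', of "V \<inter> U"] chart_openin[OF d'] U by blast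
    show "\<phi> q \<in> \<phi> ` (V \<inter> U)" using q by blast
  qed (use submanifold_inv[OF d] in simp)
  then have "coord_vec M0 (V \<inter> U, \<phi>) i q = coord_vec M (V, \<phi>) i q"
    by (simp add: coord_vec_def submanifold_holo_near[OF q(2)] pd_def fun_eq_iff)
  then show ?thesis by (simp add: coeff_def)
qed

lemma submanifold_one_form:
  assumes W: "W \<subseteq> U"
  shows "holo_one_form M0 W \<alpha> \<longleftrightarrow> holo_one_form M W \<alpha>"
proof -
  have "holo_fun M0 (V \<inter> U \<inter> W) (coeff M0 (V \<inter> U, \<phi>) \<alpha> i) \<longleftrightarrow> holo_fun M (V \<inter> W) (coeff M (V, \<phi>) \<alpha> i)"
    if d: "(V, \<phi>) \<in> atlas M" for V \<phi> i
  proof -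
    have "V \<inter> U \<inter> W = V \<inter> W" using W by blast
    moreover have "holo_fun M0 (V \<inter> W) g \<longleftrightarrow> holo_fun M (V \<inter> W) g" for g using W by (intro submanifold_holo_fun) blast
    moreover have "coeff M0 (V \<inter> U, \<phi>) \<alpha> i q = coeff M (V, \<phi>) \<alpha> i q" if "q \<in> V \<inter> W" for q
      using submanifold_coeff[OF d] that W by blast
    ultimately show ?thesis using holo_fun_transfer[of "V \<inter> W"] by metis
  qed
  then have "(\<forall>c\<in>atlas M0. \<forall>i. holo_fun M0 (fst c \<inter> W) (coeff M0 c \<alpha> i)) \<longleftrightarrow>
      (\<forall>c\<in>atlas M. \<forall>i. holo_fun M (fst c \<inter> W) (coeff M c \<alpha> i))"
    unfolding submanifold_atlas_ball atlas_ball by simp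
  moreover have "(\<forall>p\<in>W. \<alpha> p \<in> cotangent_space M0 p) \<longleftrightarrow> (\<forall>p\<in>W. \<alpha> p \<in> cotangent_space M p)"
    using W submanifold_cotangent by blast
  ultimately show ?thesis using W by (simp add: holo_one_form_def submanifold_openin)
qed

text \<open>The coefficient functions of \<open>\<alpha>\<close> in \<open>M0\<close> and in
  \<open>M\<close> agree near \<open>p\<close>, so tangent vectors at \<open>p\<close> cannot
  distinguish them. Hence the exterior derivatives agree on tangent vectors, on which alone
  \<open>contact_at\<close> evaluates.\<close>

lemma submanifold_contact_at:
  assumes \<alpha>: "holo_one_form M W \<alpha>" and W: "W \<subseteq> U" and p: "p \<in> W"
  shows "contact_at M0 n \<alpha> p \<longleftrightarrow> contact_at M n \<alpha> p"
proof -
  have pU: "p \<in> U" using p W by blast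
  have eq: "wedge 1 (2 * n) (\<lambda>u. \<alpha> p (u 0)) (wedge_power (ext_deriv M0 (V \<inter> U, \<phi>) \<alpha>) n) v =
      wedge 1 (2 * n) (\<lambda>u. \<alpha> p (u 0)) (wedge_power (ext_deriv M (V, \<phi>) \<alpha>) n) v"
    if d: "(V, \<phi>) \<in> atlas M" "p \<in> V" and v: "\<And>i. v i \<in> tangent_space M p" for V \<phi> v
  proof -
    have hf: "holo_fun M (V \<inter> W) (coeff M (V, \<phi>) \<alpha> i)" for i
      using \<alpha> d(1) by (fastforce simp: holo_one_form_def)
    have ceq: "coeff M (V, \<phi>) \<alpha> i q = coeff M0 (V \<inter> U, \<phi>) \<alpha> i q" if "q \<in> V \<inter> W" for q i
      using submanifold_coeff[OF d(1)] that W by auto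
    have hf0: "holo_fun M (V \<inter> W) (coeff M0 (V \<inter> U, \<phi>) \<alpha> i)" for i
      by (rule holo_fun_transfer[OF hf ceq])
    have germ: "w (coeff M0 (V \<inter> U, \<phi>) \<alpha> i) = w (coeff M (V, \<phi>) \<alpha> i)" if "w \<in> tangent_space M p" for w i
    proof (rule tangent_space_germ[OF that])
      show "holo_near M p (coeff M0 (V \<inter> U, \<phi>) \<alpha> i)" "holo_near M p (coeff M (V, \<phi>) \<alpha> i)"
        unfolding holo_near_def using hf hf0 d p by blast+
      show "openin (top_of M) (V \<inter> W)" using holo_fun_openin[OF hf] .
    qed (use ceq d p in auto)
    have "ext_deriv M0 (V \<inter> U, \<phi>) \<alpha> u = ext_deriv M (V, \<phi>) \<alpha> u" if "\<And>i. u i \<in> tangent_space M p" for u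
      by (simp add: ext_deriv_def germ that)
    then have "wedge_power (ext_deriv M0 (V \<inter> U, \<phi>) \<alpha>) n u = wedge_power (ext_deriv M (V, \<phi>) \<alpha>) n u"
      if "\<And>i. u i \<in> tangent_space M p" for u
      unfolding wedge_power_gpower by (rule gpower_cong[where K = "tangent_space M p"]) (use that in auto)
    then show ?thesis using v by (simp add: wedge_def)
  qed
  have "contact_at M0 n \<alpha> p \<longleftrightarrow> (\<forall>V \<phi>. (V, \<phi>) \<in> atlas M \<longrightarrow> p \<in> V \<longrightarrow>
     (\<exists>v. (\<forall>i. v i \<in> tangent_space M p) \<and>
        wedge 1 (2 * n) (\<lambda>u. \<alpha> p (u 0)) (wedge_power (ext_deriv M0 (V \<inter> U, \<phi>) \<alpha>) n) v \<noteq> 0))"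
    unfolding contact_at_def submanifold_atlas_ball submanifold_tangent[OF pU] using pU by simp
  also have "\<dots> \<longleftrightarrow> (\<forall>V \<phi>. (V, \<phi>) \<in> atlas M \<longrightarrow> p \<in> V \<longrightarrow>
     (\<exists>v. (\<forall>i. v i \<in> tangent_space M p) \<and>
        wedge 1 (2 * n) (\<lambda>u. \<alpha> p (u 0)) (wedge_power (ext_deriv M (V, \<phi>) \<alpha>) n) v \<noteq> 0))"
    using eq by metis
  also have "\<dots> \<longleftrightarrow> contact_at M n \<alpha> p"
    unfolding contact_at_def atlas_ball by simp
  finally show ?thesis .
qed

end

end

section \<open>Thin sets and the extension theorem\<close>

text \<open>Divide \<open>f\<close> by the highest possible power of \<open>z\<^sub>j\<close> and take a zero of \<open>z\<^sub>j\<close> at which the quotient is nonzero.\<close>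

lemma zero_set_near_hyperplane:
  fixes f :: "complex ^ 'm::finite \<Rightarrow> complex"
  assumes f: "holo f (ball z0 r)" and z0: "z0 $ j = 0"
    and van: "\<And>z. z \<in> ball z0 r \<Longrightarrow> z $ j = 0 \<Longrightarrow> f z = 0" and w: "w \<in> ball z0 r" "f w \<noteq> 0"
  obtains z2 \<rho> where "z2 \<in> ball z0 r" "z2 $ j = 0" "0 < \<rho>" "ball z2 \<rho> \<subseteq> ball z0 r"
    "\<And>z. z \<in> ball z2 \<rho> \<Longrightarrow> f z = 0 \<Longrightarrow> z $ j = 0"
proof -
  let ?B = "ball z0 r"
  define P where "P z = z + (- (z $ j)) *s axis j 1" for z :: "complex ^ 'm"
  have Pj: "P z $ j = 0" for z by (simp add: P_def axis_def)
  have PB: "P z \<in> ?B" if "z \<in> ?B" for z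
  proof -
    have "norm (P z - z0) \<le> norm (z - z0)"
      unfolding norm_vec_def by (rule L2_set_mono) (auto simp: P_def axis_def z0)
    then show ?thesis using that by (simp add: dist_norm norm_minus_commute)
  qed
  define dvb where "dvb k h \<longleftrightarrow> (\<exists>g. holo g ?B \<and> (\<forall>z\<in>?B. h z = (z $ j) ^ k * g z))" for k :: nat and h
  have step: "\<exists>g'. holo g' ?B \<and> (\<forall>z\<in>?B. g z = z $ j * g' z)"
    if g: "holo g ?B" and v: "\<And>z. z \<in> ?B \<Longrightarrow> z $ j = 0 \<Longrightarrow> g z = 0" for g
  proof -
    obtain g' where g': "\<And>i. holo (g' i) ?B" "\<And>z. z \<in> ?B \<Longrightarrow> g z - g (P z) = (\<Sum>i\<in>UNIV. (z - P z) $ i * g' i z)"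
    proof (rule holo_segment[OF g convex_ball])
      show "holo (\<lambda>z. P z $ i) ?B" for i
        by (simp add: holo_cdiff P_def) (intro ballI cdiff_diff cdiff_mult cdiff_nth cdiff_const)
      show "P ` ?B \<subseteq> ?B" using PB by blast
    qed blast
    have "g z = z $ j * g' j z" if "z \<in> ?B" for z
    proof -
      have "(z - P z) $ i * g' i z = (if i = j then z $ j * g' j z else 0)" for i
        by (simp add: P_def axis_def)
      then show ?thesis using g'(2)[OF that] v[OF PB[OF that] Pj] by simp
    qed
    then show ?thesis using g'(1) by blast
  qed
  have "\<exists>k. \<not> dvb k f"
  proof (rule ccontr)
    assume "\<nexists>k. \<not> dvb k f"
    then have all: "\<forall>k. dvb k f" by blast
    \<comment> \<open>Functions divisible by every power of \<open>z $ j\<close>. They vanish on the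
      hyperplane and are closed under differentiation in direction \<open>j\<close>, which costs
      only one power; moving from \<open>P w\<close> to \<open>w\<close> gives
      \<open>f w = 0\<close>.\<close>
    let ?F = "{h. holo h ?B \<and> (\<forall>k. dvb k h)}"
    let ?v = "(w $ j) *s axis j 1 :: complex ^ 'm"
    have Pw: "P w + ?v = w" by (simp add: P_def vec_eq_iff)
    have "f (P w + ?v) = 0"
    proof (rule vanish_along[where F = ?F and W = ?B])
      show "holo h ?B \<and> h (P w) = 0" if "h \<in> ?F" for h
      proof -
        have "dvb 1 h" using that by blast
        then show ?thesis using that PB[OF w(1)] Pj by (auto simp: dvb_def)
      qed
      show "(\<lambda>z. \<Sum>i\<in>UNIV. pd i h z * ?v $ i) \<in> ?F" if h: "h \<in> ?F" for h
      proof -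
        have eq: "(\<lambda>z. \<Sum>i\<in>UNIV. pd i h z * ?v $ i) = (\<lambda>z. pd j h z * w $ j)"
          by (simp add: axis_def if_distrib[of "\<lambda>x. _ * x"] cong: if_cong)
        have "dvb k (\<lambda>z. pd j h z * w $ j)" for k
        proof -
          have "dvb (Suc k) h" using h by blast
          then obtain g where g: "holo g ?B" "\<And>z. z \<in> ?B \<Longrightarrow> h z = (z $ j) ^ Suc k * g z" by (auto simp: dvb_def)
          have pw: "pd j (\<lambda>z. (z $ j) ^ Suc k) z = of_nat (Suc k) * (z $ j) ^ k \<and> cdiff (\<lambda>z. (z $ j) ^ Suc k) z" for z
          proof -
            have "cder (\<lambda>z. (z $ j) ^ Suc k) (\<lambda>i. (of_nat (Suc k) * (z $ j) ^ k) * (if i = j then 1 else 0)) z"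
              by (rule cder_field[OF cder_nth]) (auto intro!: derivative_eq_intros simp del: power_Suc of_nat_Suc)
            from cder_pd[OF this, of j] cder_cdiff[OF this] show ?thesis by simp
          qed
          have "pd j h z = (z $ j) ^ k * (of_nat (Suc k) * g z + z $ j * pd j g z)" if z: "z \<in> ?B" for z
          proof -
            have "pd j h z = pd j (\<lambda>z. (z $ j) ^ Suc k * g z) z"
              by (rule pd_cong_open[OF open_ball z]) (rule g(2))
            also have "\<dots> = of_nat (Suc k) * (z $ j) ^ k * g z + (z $ j) ^ Suc k * pd j g z"
              using pd_mult[of "\<lambda>z. (z $ j) ^ Suc k" z g j] pw[of z] holoD[OF g(1) z] by simp
            finally show ?thesis by (simp add: algebra_simps)
          qed
          moreover have "holo (\<lambda>z. (of_nat (Suc k) * g z + z $ j * pd j g z) * w $ j) ?B"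
            by (intro holo_mult holo_add holo_const holo_nth holo_pd g(1)) auto
          ultimately show ?thesis unfolding dvb_def
            by (intro exI[of _ "\<lambda>z. (of_nat (Suc k) * g z + z $ j * pd j g z) * w $ j"]) simp
        qed
        moreover have "holo (\<lambda>z. pd j h z * w $ j) ?B" using h by (intro holo_mult holo_pd holo_const) auto
        ultimately show ?thesis unfolding eq by blast
      qed
      show "f \<in> ?F" using f all by blast
    qed (use PB w Pw in auto)
    then show False using w Pw by simp
  qed
  moreover have "dvb 0 f" unfolding dvb_def using f by (intro exI[of _ f]) simp
  ultimately have "\<exists>k. dvb k f \<and> \<not> dvb (Suc k) f"
    by (metis nat_induct[of "\<lambda>k. dvb k f"])
  then obtain k where k: "dvb k f" "\<not> dvb (Suc k) f" by blast
  then obtain g where g: "holo g ?B" "\<And>z. z \<in> ?B \<Longrightarrow> f z = (z $ j) ^ k * g z" by (auto simp: dvb_def)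
  have "\<exists>z\<in>?B. z $ j = 0 \<and> g z \<noteq> 0"
  proof (rule ccontr)
    assume "\<not> (\<exists>z\<in>?B. z $ j = 0 \<and> g z \<noteq> 0)"
    \<comment> \<open>A quotient that vanishes on the whole hyperplane is divisible once
      more.\<close>
    then obtain g' where "holo g' ?B" "\<forall>z\<in>?B. g z = z $ j * g' z" using step[OF g(1)] by blast
    then have "dvb (Suc k) f" unfolding dvb_def using g(2) by (intro exI[of _ g']) simp
    then show False using k by blast
  qed
  then obtain z2 where z2: "z2 \<in> ?B" "z2 $ j = 0" "g z2 \<noteq> 0" by blast
  have "open (?B \<inter> g -` (- {0}))"
    by (rule continuous_open_preimage[OF holo_continuous_on[OF g(1)]]) auto
  moreover have "z2 \<in> ?B \<inter> g -` (- {0})" using z2 by simp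
  ultimately obtain \<rho> where \<rho>: "0 < \<rho>" "ball z2 \<rho> \<subseteq> ?B \<inter> g -` (- {0})" using openE by blast
  show thesis
  proof (rule that[OF z2(1,2) \<rho>(1)])
    show "ball z2 \<rho> \<subseteq> ?B" using \<rho> by blast
    show "z $ j = 0" if "z \<in> ball z2 \<rho>" "f z = 0" for z
    proof -
      have "z \<in> ?B" "g z \<noteq> 0" using \<rho>(2) that(1) by auto
      then show ?thesis using g(2)[of z] that(2) by simp
    qed
  qed
qed

section \<open>Charts adapted to a set, and sets of codimension at least two\<close>

context cmanifold
begin

text \<open>Supplies the better chart for the maximality argument: \<open>h\<close> becomes the
  \<open>j\<close>-th coordinate and all others are kept, so equations already achieved
  survive.\<close>

lemma chart_replace_coord:
  assumes c: "(V, \<phi>) \<in> charts M" and B: "B \<subseteq> \<phi> ` V" and h: "holo h B"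
    and q: "q \<in> V" "\<phi> q \<in> B" and nz: "pd j h (\<phi> q) \<noteq> 0"
  obtains V' where "(V', \<lambda>x. \<chi> k. if k = j then h (\<phi> x) else \<phi> x $ k) \<in> charts M" "q \<in> V'" "V' \<subseteq> {x \<in> V. \<phi> x \<in> B}"
proof -
  define \<Phi> where "\<Phi> z = (\<chi> k. if k = j then h z else z $ k)" for z
  obtain U' V'' G where U': "open U'" "\<phi> q \<in> U'" "U' \<subseteq> B" "open V''" and hom: "homeomorphism U' V'' \<Phi> G"
    and G: "\<And>k. holo (\<lambda>w. G w $ k) V''"
    unfolding \<Phi>_def[abs_def] by (rule holo_inverse_coord[OF h q(2) nz]) blast+
  define V' where "V' = {x \<in> V. \<phi> x \<in> U'}"
  define \<phi>' where "\<phi>' x = \<Phi> (\<phi> x)" for x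
  have V'V: "V' \<subseteq> V" by (auto simp: V'_def)
  have V': "openin (top_of M) V'" unfolding V'_def by (rule chart_preimage_open[OF c U'(1)])
  have GP: "G (\<Phi> z) = z" if "z \<in> U'" for z using hom that by (simp add: homeomorphism_def)
  have PV: "\<Phi> z \<in> V''" if "z \<in> U'" for z using hom that by (auto simp: homeomorphism_def)
  have inj: "inj_on \<phi>' V'"
  proof (rule inj_onI)
    fix x y assume xy: "x \<in> V'" "y \<in> V'" "\<phi>' x = \<phi>' y"
    then have "\<phi> x = \<phi> y" using GP by (metis (mono_tags, lifting) V'_def \<phi>'_def mem_Collect_eq)
    then show "x = y" using chart_inj[OF c] xy V'V by (auto dest: inj_onD)
  qed
  have "is_chart (top_of M) (V', \<phi>')"
    unfolding is_chart_iff
  proof (intro conjI allI impI V' inj)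
    fix W assume W: "openin (top_of M) W" "W \<subseteq> V'"
    have "open (\<phi> ` W)" by (rule chart_image_open[OF c W(1)]) (use W V'V in blast)
    moreover have "\<phi> ` W \<subseteq> U'" using W by (auto simp: V'_def)
    ultimately have "openin (top_of_set U') (\<phi> ` W)" by (rule open_subset[rotated])
    then have "openin (top_of_set V'') (\<Phi> ` \<phi> ` W)" by (rule homeomorphism_imp_open_map[OF hom])
    then show "open (\<phi>' ` W)" using U'(4) openin_open_trans by (auto simp: \<phi>'_def image_image)
  next
    fix C :: "(complex ^ 'm) set" assume "open C"
    then have "open (U' \<inter> \<Phi> -` C)"
      using hom U'(1) by (intro continuous_open_preimage) (auto simp: homeomorphism_def)
    from chart_preimage_open[OF c this] show "openin (top_of M) {x \<in> V'. \<phi>' x \<in> C}"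
      by (simp add: V'_def \<phi>'_def conj_assoc)
  qed
  moreover have "compatible (V', \<phi>') (A, \<psi>)" if d: "(A, \<psi>) \<in> atlas M" for A \<psi>
  proof -
    note d' = atlas_charts[OF d]
    have op: "openin (top_of M) (V' \<inter> A)" using V' chart_openin[OF d'] by blast
    have o1: "open (\<phi>' ` (V' \<inter> A))"
      using \<open>is_chart (top_of M) (V', \<phi>')\<close> op unfolding is_chart_iff by blast
    have o2: "open (\<psi> ` (V' \<inter> A))" by (rule chart_image_open[OF d' op]) auto
    have "holo (\<lambda>z. \<psi> (inv_into V \<phi> (G z)) $ i) (\<phi>' ` (V' \<inter> A))" for i
    proof (rule holo_comp[OF transition(1)[OF c d] holo_subset[OF G o1] _ o1])
      show "\<phi>' ` (V' \<inter> A) \<subseteq> V''" using PV by (auto simp: \<phi>'_def V'_def)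
      show "G ` \<phi>' ` (V' \<inter> A) \<subseteq> \<phi> ` (V \<inter> A)" using GP by (auto simp: \<phi>'_def V'_def)
    qed
    then have "holo (\<lambda>z. \<psi> (inv_into V' \<phi>' z) $ i) (\<phi>' ` (V' \<inter> A))" for i
    proof (rule holo_transfer)
      fix z assume "z \<in> \<phi>' ` (V' \<inter> A)"
      then obtain x where x: "x \<in> V'" "z = \<phi>' x" by blast
      have "inv_into V' \<phi>' z = x" using x inj by simp
      moreover have "G z = \<phi> x" using x GP by (simp add: \<phi>'_def V'_def)
      ultimately show "\<psi> (inv_into V \<phi> (G z)) $ i = \<psi> (inv_into V' \<phi>' z) $ i" using c x V'V by auto
    qed
    moreover have "holo (\<lambda>z. \<phi>' (inv_into A \<psi> z) $ i) (\<psi> ` (V' \<inter> A))" for i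
    proof -
      have t: "holo (\<lambda>z. \<phi> (inv_into A \<psi> z) $ i) (\<psi> ` (V' \<inter> A))" for i
        by (rule holo_subset[OF transition(2)[OF c d] o2]) (use V'V in auto)
      have "holo (\<lambda>z. h (\<phi> (inv_into A \<psi> z))) (\<psi> ` (V' \<inter> A))"
        by (rule holo_comp[OF h t _ o2]) (use d' U' in \<open>auto simp: V'_def\<close>)
      then show ?thesis using t[of i] by (cases "i = j") (simp_all add: \<phi>'_def \<Phi>_def)
    qed
    ultimately show ?thesis by (simp add: compatible_def)
  qed
  ultimately have "(V', \<phi>') \<in> charts M" by (auto simp: charts_def)
  then show thesis
    using that[of V'] q U' unfolding \<phi>'_def[abs_def] \<Phi>_def by (auto simp: V'_def)
qed

lemma adapted_chart:
  assumes T: "T \<subseteq> points M" "T \<noteq> {}"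
  obtains V \<phi> J where "(V, \<phi>) \<in> charts M" "T \<inter> V \<noteq> {}" "\<And>x i. x \<in> T \<inter> V \<Longrightarrow> i \<in> J \<Longrightarrow> \<phi> x $ i = 0"
    "\<And>B h q z. convex B \<Longrightarrow> B \<subseteq> \<phi> ` V \<Longrightarrow> holo h B \<Longrightarrow> (\<And>y. y \<in> T \<inter> V \<Longrightarrow> \<phi> y \<in> B \<Longrightarrow> h (\<phi> y) = 0) \<Longrightarrow>
      q \<in> T \<inter> V \<Longrightarrow> \<phi> q \<in> B \<Longrightarrow> z \<in> B \<Longrightarrow> (\<And>i. i \<in> J \<Longrightarrow> z $ i = 0) \<Longrightarrow> h z = 0"
proof -
  define Q where "Q k \<longleftrightarrow> (\<exists>V \<phi> J. (V, \<phi>) \<in> charts M \<and> T \<inter> V \<noteq> {} \<and>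
      (\<forall>x\<in>T \<inter> V. \<forall>i\<in>J. \<phi> x $ i = 0) \<and> card J = k)" for k
  have "Q 0"
  proof -
    obtain p where p: "p \<in> T" using T by blast
    then obtain V \<phi> where "(V, \<phi>) \<in> atlas M" "p \<in> V" using atlas_cover T by blast
    then show ?thesis unfolding Q_def using p atlas_charts
      by (intro exI[of _ V] exI[of _ \<phi>] exI[of _ "{}"]) auto
  qed
  moreover have bound: "k \<le> CARD('m)" if "Q k" for k
    using that by (auto simp: Q_def intro: card_mono)
  \<comment> \<open>The empty \<open>J\<close> is admissible and no \<open>J\<close> has more than
    \<open>CARD('m)\<close> elements, so a largest one exists.\<close>
  ultimately obtain k where k: "Q k" "\<And>l. Q l \<Longrightarrow> l \<le> k"
    using GreatestI_nat[of Q 0 "CARD('m)"] Greatest_le_nat[of Q _ "CARD('m)"] by blast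
  then obtain V \<phi> J where c: "(V, \<phi>) \<in> charts M" and ne: "T \<inter> V \<noteq> {}"
    and J: "\<And>x i. x \<in> T \<inter> V \<Longrightarrow> i \<in> J \<Longrightarrow> \<phi> x $ i = 0" "card J = k"
    unfolding Q_def by blast
  \<comment> \<open>A nonzero derivative in a direction outside \<open>J\<close> would let
    \<open>h\<close> replace the \<open>j\<close>-th coordinate and enlarge
    \<open>J\<close>.\<close>
  have pd0: "pd j h (\<phi> q) = 0"
    if B: "B \<subseteq> \<phi> ` V" and h: "holo h B" and van: "\<And>y. y \<in> T \<inter> V \<Longrightarrow> \<phi> y \<in> B \<Longrightarrow> h (\<phi> y) = 0"
      and q: "q \<in> T \<inter> V" "\<phi> q \<in> B" and j: "j \<notin> J" for B h q j
  proof (rule ccontr)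
    assume nz: "pd j h (\<phi> q) \<noteq> 0"
    obtain V' where V': "(V', \<lambda>x. \<chi> k. if k = j then h (\<phi> x) else \<phi> x $ k) \<in> charts M" "q \<in> V'" "V' \<subseteq> {x \<in> V. \<phi> x \<in> B}"
      using chart_replace_coord[OF c B h _ q(2) nz] q(1) by blast
    have "Q (Suc k)"
      unfolding Q_def
    proof (intro exI conjI)
      show "T \<inter> V' \<noteq> {}" using q V' by blast
      show "card (insert j J) = Suc k" using j J(2) by (simp add: finite_subset[OF subset_UNIV])
      show "\<forall>x\<in>T \<inter> V'. \<forall>i\<in>insert j J. (\<chi> k. if k = j then h (\<phi> x) else \<phi> x $ k) $ i = 0"
        using V'(3) van J(1) by auto
    qed (rule V'(1))
    then show False using k(2) by fastforce
  qed
  show thesis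
  proof (rule that[OF c ne J(1)])
    fix B h q z
    assume B: "convex B" "B \<subseteq> \<phi> ` V" and h: "holo h B" and van: "\<And>y. y \<in> T \<inter> V \<Longrightarrow> \<phi> y \<in> B \<Longrightarrow> h (\<phi> y) = 0"
      and q: "q \<in> T \<inter> V" "\<phi> q \<in> B" and z: "z \<in> B" "\<And>i. i \<in> J \<Longrightarrow> z $ i = 0"
    \<comment> \<open>The direction \<open>?v\<close> has no components in \<open>J\<close>, and the
      other derivatives vanish on \<open>T\<close> by \<open>pd0\<close>; so this family is closed
      under differentiation along \<open>?v\<close>.\<close>
    let ?F = "{h. holo h B \<and> (\<forall>y. y \<in> T \<inter> V \<longrightarrow> \<phi> y \<in> B \<longrightarrow> h (\<phi> y) = 0)}"
    let ?v = "z - \<phi> q"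
    have v: "?v $ i = 0" if "i \<in> J" for i using z(2)[OF that] J(1)[OF q(1) that] by simp
    have oB: "open B" using h holo_open by blast
    have "h (\<phi> q + ?v) = 0"
    proof (rule vanish_along[where F = ?F and W = B])
      show "(\<lambda>z. \<Sum>i\<in>UNIV. pd i g z * ?v $ i) \<in> ?F" if g: "g \<in> ?F" for g
      proof (intro CollectI conjI allI impI)
        show "holo (\<lambda>z. \<Sum>i\<in>UNIV. pd i g z * ?v $ i) B"
          using g by (intro holo_sum holo_mult holo_pd holo_const oB) auto
        fix y assume y: "y \<in> T \<inter> V" "\<phi> y \<in> B"
        have "pd i g (\<phi> y) * ?v $ i = 0" for i
        proof (cases "i \<in> J")
          case False
          have "pd i g (\<phi> y) = 0" by (rule pd0[OF B(2) _ _ y False]) (use g in auto)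
          then show ?thesis by simp
        qed (use v in simp)
        then show "(\<Sum>i\<in>UNIV. pd i g (\<phi> y) * ?v $ i) = 0" by (intro sum.neutral) blast
      qed
    qed (use B q z oB h van in auto)
    then show "h z = 0" by simp
  qed
qed

lemma regular_point_codimension: "regular_point M A p k \<Longrightarrow> 2 \<le> codimension M A \<Longrightarrow> 2 \<le> k"
proof -
  assume r: "regular_point M A p k" and "2 \<le> codimension M A"
  moreover have "codimension M A \<le> enat k"
    unfolding codimension_def by (rule Inf_lower) (use r in blast)
  ultimately have "2 \<le> enat k" using order_trans by blast
  then show ?thesis by (simp add: numeral_eq_enat)
qed

lemma codim_two_data:
  assumes S: "codim_two_or_more M S" and s: "s \<in> S"
  obtains V F A where "openin (top_of M) V" "s \<in> V" "finite F" "\<And>f. f \<in> F \<Longrightarrow> holo_fun M V f"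
    "S \<inter> V \<subseteq> A" "A \<inter> V = {x\<in>V. \<forall>f\<in>F. f x = 0}" "2 \<le> codimension M A"
proof -
  obtain U A where U: "openin (top_of M) U" "s \<in> U" "analytic_subvariety M U A" "2 \<le> codimension M A" "S \<inter> U \<subseteq> A"
    using S s unfolding codim_two_or_more_def by blast
  then obtain V F where V: "openin (top_of M) V" "s \<in> V" "V \<subseteq> U" "finite F" "\<forall>f\<in>F. holo_fun M V f"
      "A \<inter> V = {x\<in>V. \<forall>f\<in>F. f x = 0}"
    unfolding analytic_subvariety_def by blast
  show thesis by (rule that[OF V(1,2,4) _ _ V(6) U(4)]) (use V U in auto)
qed

text \<open>A point interior to \<open>A\<close> is regular of codimension 0, with the empty set of
  equations.\<close>

lemma codim_two_not_open:
  assumes A: "2 \<le> codimension M A" and W: "openin (top_of M) W" "W \<subseteq> A" and p: "p \<in> W"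
  shows False
proof -
  have "p \<in> points M" using W p openin_subset by blast
  then obtain V \<phi> where c: "(V, \<phi>) \<in> charts M" and pV: "p \<in> V" using chart_at by blast
  have "(V \<inter> W, \<phi>) \<in> charts M" by (rule chart_restrict[OF c]) (use W chart_openin[OF c] in auto)
  then have "regular_point M A p 0"
    unfolding regular_point_def
    by (intro conjI bexI[of _ "(V \<inter> W, \<phi>)"]) (use W p pV in \<open>auto intro!: exI[of _ "{}"]\<close>)
  then show False using regular_point_codimension[OF _ A] by fastforce
qed

lemma codim_two_dense:
  assumes S: "codim_two_or_more M S" and W: "openin (top_of M) W" "p \<in> W"
  shows "\<exists>x\<in>W. x \<notin> S"
proof (rule ccontr)
  assume n: "\<not> (\<exists>x\<in>W. x \<notin> S)"
  then have "p \<in> S" using W by blast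
  then obtain V F A where V: "openin (top_of M) V" "p \<in> V" "S \<inter> V \<subseteq> A" "2 \<le> codimension M A"
    by (rule codim_two_data[OF S])
  show False by (rule codim_two_not_open[OF V(4), of "W \<inter> V" p]) (use V W n in auto)
qed

lemma cotangent_scale:
  assumes "\<xi> \<in> cotangent_space M p"
  shows "(\<lambda>v. k * \<xi> v) \<in> cotangent_space M p"
  using assms by (simp add: cotangent_space_def algebra_simps)

end

section \<open>Local extensions of a contact structure and their gluing\<close>

locale contact_off_thin = cmanifold M for M :: "('a, 'm::finite) cmfd" +
  fixes n :: nat and S :: "'a set" and L :: "('a \<times> 'a covec) set"
  assumes card: "CARD('m) = 2 * n + 1" and S_closed: "closedin (top_of M) S"
    and S_thin: "codim_two_or_more M S"
    and contact: "contact_structure (open_submanifold M (points M - S)) n L"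
begin

lemma regular_open: "openin (top_of M) (points M - S)"
  using S_closed by (simp add: closedin_def)

text \<open>Translates the hypothesis from the open submanifold to \<open>M\<close>, so that
  afterwards only forms on \<open>M\<close> occur.\<close>

lemma L_line:
  assumes "p \<in> points M - S"
  obtains W \<alpha> where "p \<in> W" "W \<subseteq> points M - S" "holo_one_form M W \<alpha>" "\<And>q. q \<in> W \<Longrightarrow> contact_at M n \<alpha> q"
    "\<And>q. q \<in> W \<Longrightarrow> {\<xi>. (q, \<xi>) \<in> L} = {(\<lambda>v. c * \<alpha> q v) |c. True}"
proof -
  let ?M0 = "open_submanifold M (points M - S)"
  have "p \<in> points ?M0" using assms by (auto simp: open_submanifold_def)
  then obtain W \<alpha> where W: "p \<in> W" "nonvanishing_section ?M0 L W \<alpha>"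
      "\<forall>q\<in>W. {\<xi>. (q, \<xi>) \<in> L} = {(\<lambda>v. c * \<alpha> q v) |c. True}"
    using contact unfolding contact_structure_def hyperplane_field_def by blast
  then have 0: "holo_one_form ?M0 W \<alpha>" by (simp add: nonvanishing_section_def)
  then have sub: "W \<subseteq> points M - S"
    using submanifold_openin[OF regular_open] by (simp add: holo_one_form_def)
  have \<alpha>: "holo_one_form M W \<alpha>" using 0 submanifold_one_form[OF regular_open sub] by blast
  have "contact_at M n \<alpha> q" if "q \<in> W" for q
    using contact W(2) that submanifold_contact_at[OF regular_open \<alpha> sub that] unfolding contact_structure_def by blast
  then show thesis using that W(1,3) sub \<alpha> by blast
qed

lemma L_fibre:
  assumes "p \<in> points M - S"
  shows "\<exists>\<eta>. {\<xi>. (p, \<xi>) \<in> L} = {(\<lambda>v. c * \<eta> v) |c. True}"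
proof (rule L_line[OF assms])
  fix W \<alpha>
  assume "p \<in> W" "\<And>q. q \<in> W \<Longrightarrow> {\<xi>. (q, \<xi>) \<in> L} = {(\<lambda>v. c * \<alpha> q v) |c. True}"
  then show ?thesis by blast
qed

text \<open>\<open>W\<close> may meet \<open>S\<close>. A contact form has no zeros, so off
  \<open>S\<close> it spans the fibre of \<open>L\<close>; at points of \<open>S\<close> its
  direction is determined by density of the complement.\<close>

definition local_ext :: "'a set \<Rightarrow> ('a \<Rightarrow> 'a covec) \<Rightarrow> bool" where
  "local_ext W \<alpha> \<longleftrightarrow> holo_one_form M W \<alpha> \<and> (\<forall>q\<in>W. contact_at M n \<alpha> q) \<and> (\<forall>q\<in>W - S. (q, \<alpha> q) \<in> L)"

lemma local_ext_form: "local_ext W \<alpha> \<Longrightarrow> holo_one_form M W \<alpha>"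
  by (simp add: local_ext_def)

lemma local_ext_regular:
  assumes "p \<in> points M - S"
  shows "\<exists>W \<alpha>. local_ext W \<alpha> \<and> p \<in> W"
proof -
  obtain W \<alpha> where W: "p \<in> W" "holo_one_form M W \<alpha>" "\<And>q. q \<in> W \<Longrightarrow> contact_at M n \<alpha> q"
    "\<And>q. q \<in> W \<Longrightarrow> {\<xi>. (q, \<xi>) \<in> L} = {(\<lambda>v. c * \<alpha> q v) |c. True}"
    by (rule L_line[OF assms]) (rule that)
  have "(q, \<alpha> q) \<in> L" if "q \<in> W" for q
  proof -
    have "\<alpha> q \<in> {(\<lambda>v. c * \<alpha> q v) |c. True}" by (auto intro!: exI[of _ 1])
    then show ?thesis using W(4)[OF that] by blast
  qed
  then show ?thesis using W by (auto simp: local_ext_def)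
qed

lemma L_scale: "(p, \<xi>) \<in> L \<Longrightarrow> p \<in> points M - S \<Longrightarrow> (p, \<lambda>v. k * \<xi> v) \<in> L"
proof -
  assume L: "(p, \<xi>) \<in> L" and p: "p \<in> points M - S"
  obtain \<eta> where \<eta>: "{\<xi>. (p, \<xi>) \<in> L} = {(\<lambda>v. c * \<eta> v) |c. True}" using L_fibre[OF p] by blast
  then obtain c where "\<xi> = (\<lambda>v. c * \<eta> v)" using L by blast
  then have "(\<lambda>v. k * \<xi> v) = (\<lambda>v. (k * c) * \<eta> v)" by (simp add: mult.assoc)
  then show ?thesis using \<eta> by blast
qed

lemma L_parallel:
  assumes "(p, \<xi>) \<in> L" "(p, \<eta>) \<in> L" "p \<in> points M - S" "\<xi> v \<noteq> 0"
  shows "\<exists>k. \<eta> = (\<lambda>v. k * \<xi> v)"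
proof -
  obtain \<theta> where \<theta>: "{\<xi>. (p, \<xi>) \<in> L} = {(\<lambda>v. c * \<theta> v) |c. True}" using L_fibre[OF assms(3)] by blast
  then obtain c d where cd: "\<xi> = (\<lambda>v. c * \<theta> v)" "\<eta> = (\<lambda>v. d * \<theta> v)" using assms(1,2) by blast
  then have "c \<noteq> 0" using assms(4) by auto
  then have "\<eta> = (\<lambda>v. (d / c) * \<xi> v)" using cd by simp
  then show ?thesis by blast
qed

lemma local_ext_nonzero:
  assumes \<alpha>: "local_ext W \<alpha>" and c: "(V, \<phi>) \<in> charts M" and q: "q \<in> V" "q \<in> W"
  shows "\<exists>i. chart_coeff (V, \<phi>) \<alpha> i (\<phi> q) \<noteq> 0"
proof -
  have "contact_at M n \<alpha> q" using \<alpha> q by (simp add: local_ext_def)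
  then show ?thesis using contact_at_iff[OF local_ext_form[OF \<alpha>] c q] contact_form_nonzero by blast
qed

text \<open>A nonzero minor would stay nonzero near \<open>q\<close>, hence at some point off
  \<open>S\<close>, because \<open>S\<close> has empty interior; but there both forms lie in the
  same line of \<open>L\<close>. So local extensions are unique up to a factor on \<open>S\<close>
  as well.\<close>

lemma local_ext_minors:
  assumes \<alpha>: "local_ext W \<alpha>" and \<beta>: "local_ext W' \<beta>" and c: "(V, \<phi>) \<in> charts M" and q: "q \<in> V" "q \<in> W" "q \<in> W'"
  shows "chart_coeff (V, \<phi>) \<alpha> i (\<phi> q) * chart_coeff (V, \<phi>) \<beta> j (\<phi> q) = chart_coeff (V, \<phi>) \<alpha> j (\<phi> q) * chart_coeff (V, \<phi>) \<beta> i (\<phi> q)"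
proof (rule ccontr)
  let ?a = "chart_coeff (V, \<phi>) \<alpha>" and ?b = "chart_coeff (V, \<phi>) \<beta>"
  assume ne: "?a i (\<phi> q) * ?b j (\<phi> q) \<noteq> ?a j (\<phi> q) * ?b i (\<phi> q)"
  have O: "openin (top_of M) (V \<inter> W \<inter> W')"
    using chart_openin[OF c] one_form_openin[OF local_ext_form[OF \<alpha>]] one_form_openin[OF local_ext_form[OF \<beta>]] by blast
  let ?B = "\<phi> ` (V \<inter> W \<inter> W')"
  have oB: "open ?B" by (rule chart_image_open[OF c O]) auto
  have ha: "holo (?a i) ?B" for i by (rule holo_subset[OF holo_chart_coeff[OF local_ext_form[OF \<alpha>] c] oB]) auto
  have hb: "holo (?b i) ?B" for i by (rule holo_subset[OF holo_chart_coeff[OF local_ext_form[OF \<beta>] c] oB]) auto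
  let ?D = "\<lambda>z. ?a i z * ?b j z - ?a j z * ?b i z"
  have hD: "holo ?D ?B" by (intro holo_diff holo_mult ha hb)
  have "open (?B \<inter> ?D -` (- {0}))"
    by (rule continuous_open_preimage[OF holo_continuous_on[OF hD] oB]) auto
  from chart_preimage_open[OF c this]
  have "openin (top_of M) {x \<in> V. \<phi> x \<in> ?B \<inter> ?D -` (- {0})}" .
  moreover have "q \<in> {x \<in> V. \<phi> x \<in> ?B \<inter> ?D -` (- {0})}" using q ne by auto
  ultimately obtain x where x: "x \<in> V" "\<phi> x \<in> ?B" "?D (\<phi> x) \<noteq> 0" "x \<notin> S"
    using codim_two_dense[OF S_thin] by blast
  then have xW: "x \<in> W" "x \<in> W'" using chart_inj[OF c] by (auto dest: inj_onD)
  have xp: "x \<in> points M - S" using x xW openin_subset[OF O] by blast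
  obtain l where "?a l (\<phi> x) \<noteq> 0" using local_ext_nonzero[OF \<alpha> c x(1) xW(1)] by blast
  then have "\<alpha> x (coord_vec M (V, \<phi>) l x) \<noteq> 0" using c x(1) by (simp add: chart_coeff_at coeff_def)
  moreover have "(x, \<alpha> x) \<in> L" "(x, \<beta> x) \<in> L" using \<alpha> \<beta> xW x(4) by (auto simp: local_ext_def)
  ultimately obtain k where "\<beta> x = (\<lambda>v. k * \<alpha> x v)" using L_parallel[OF _ _ xp] by blast
  then have "?b l (\<phi> x) = k * ?a l (\<phi> x)" for l using c x(1) by (simp add: chart_coeff_at coeff_def)
  then show False using x(3) by simp
qed

lemma local_ext_proportional:
  assumes \<alpha>: "local_ext W \<alpha>" and \<beta>: "local_ext W' \<beta>" and c: "(V, \<phi>) \<in> charts M" and q: "q \<in> V" "q \<in> W" "q \<in> W'"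
  shows "\<exists>k. \<forall>j. chart_coeff (V, \<phi>) \<beta> j (\<phi> q) = k * chart_coeff (V, \<phi>) \<alpha> j (\<phi> q)"
proof -
  obtain i where i: "chart_coeff (V, \<phi>) \<alpha> i (\<phi> q) \<noteq> 0" using local_ext_nonzero[OF \<alpha> c q(1,2)] by blast
  have "chart_coeff (V, \<phi>) \<beta> j (\<phi> q) = (chart_coeff (V, \<phi>) \<beta> i (\<phi> q) / chart_coeff (V, \<phi>) \<alpha> i (\<phi> q)) * chart_coeff (V, \<phi>) \<alpha> j (\<phi> q)" for j
    using local_ext_minors[OF assms, of i j] i by (simp add: field_simps)
  then show ?thesis by blast
qed

lemma proportional_covector:
  assumes c: "(V, \<phi>) \<in> charts M" and q: "q \<in> V" and cot: "\<alpha> q \<in> cotangent_space M q" "\<beta> q \<in> cotangent_space M q"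
    and k: "\<And>j. chart_coeff (V, \<phi>) \<beta> j (\<phi> q) = k * chart_coeff (V, \<phi>) \<alpha> j (\<phi> q)"
  shows "\<beta> q = (\<lambda>v. k * \<alpha> q v)"
  by (rule cotangent_eqI[OF c q cot(2) cotangent_scale[OF cot(1)]])
     (use k c q in \<open>simp add: chart_coeff_at coeff_def\<close>)

lemma local_ext_parallel:
  assumes \<alpha>: "local_ext W \<alpha>" and \<beta>: "local_ext W' \<beta>" and q: "q \<in> W" "q \<in> W'"
  shows "\<exists>k. \<beta> q = (\<lambda>v. k * \<alpha> q v)"
proof -
  have "q \<in> points M" using one_form_openin[OF local_ext_form[OF \<alpha>]] q openin_subset by blast
  then obtain V \<phi> where c: "(V, \<phi>) \<in> charts M" and qV: "q \<in> V" using chart_at by blast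
  obtain k where "\<forall>j. chart_coeff (V, \<phi>) \<beta> j (\<phi> q) = k * chart_coeff (V, \<phi>) \<alpha> j (\<phi> q)"
    using local_ext_proportional[OF \<alpha> \<beta> c qV q] by blast
  then show ?thesis
    using proportional_covector[where \<alpha> = \<alpha> and \<beta> = \<beta>, OF c qV one_form_cotangent[OF local_ext_form[OF \<alpha>] q(1)]
        one_form_cotangent[OF local_ext_form[OF \<beta>] q(2)]] by blast
qed

lemma local_ext_everywhere:
  assumes "p \<in> points M"
  shows "\<exists>W \<alpha>. local_ext W \<alpha> \<and> p \<in> W"
proof (rule ccontr)
  assume np: "\<nexists>W \<alpha>. local_ext W \<alpha> \<and> p \<in> W"
  define T where "T = {q \<in> points M. \<not> (\<exists>W \<alpha>. local_ext W \<alpha> \<and> q \<in> W)}"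
  have T: "T \<subseteq> points M" "T \<noteq> {}" using assms np by (auto simp: T_def)
  have TS: "T \<subseteq> S" using local_ext_regular by (auto simp: T_def)
  obtain V \<phi> J where c: "(V, \<phi>) \<in> charts M" and ne: "T \<inter> V \<noteq> {}"
    and J: "\<And>x i. x \<in> T \<inter> V \<Longrightarrow> i \<in> J \<Longrightarrow> \<phi> x $ i = 0"
    and van: "\<And>B h q z. convex B \<Longrightarrow> B \<subseteq> \<phi> ` V \<Longrightarrow> holo h B \<Longrightarrow> (\<And>y. y \<in> T \<inter> V \<Longrightarrow> \<phi> y \<in> B \<Longrightarrow> h (\<phi> y) = 0) \<Longrightarrow>
      q \<in> T \<inter> V \<Longrightarrow> \<phi> q \<in> B \<Longrightarrow> z \<in> B \<Longrightarrow> (\<And>i. i \<in> J \<Longrightarrow> z $ i = 0) \<Longrightarrow> h z = 0"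
    by (rule adapted_chart[OF T]) blast
  obtain q where q: "q \<in> T" "q \<in> V" using ne by blast
  then have "q \<in> S" using TS by blast
  then obtain V1 F A where V1: "openin (top_of M) V1" "q \<in> V1" and F: "\<And>f. f \<in> F \<Longrightarrow> holo_fun M V1 f"
    and A: "S \<inter> V1 \<subseteq> A" "A \<inter> V1 = {x\<in>V1. \<forall>f\<in>F. f x = 0}" "2 \<le> codimension M A"
    by (rule codim_two_data[OF S_thin]) blast
  have "open (\<phi> ` (V \<inter> V1))"
    using chart_image_open[OF c, of "V \<inter> V1"] chart_openin[OF c] V1(1) by blast
  then obtain r where r: "0 < r" "ball (\<phi> q) r \<subseteq> \<phi> ` (V \<inter> V1)" using q V1(2) openE[of "\<phi> ` (V \<inter> V1)" "\<phi> q"] by blast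
  let ?B = "ball (\<phi> q) r" and ?\<iota> = "inv_into V \<phi>"
  have BV: "?B \<subseteq> \<phi> ` V" using r by blast
  have inv: "?\<iota> z \<in> V" "?\<iota> z \<in> V1" "\<phi> (?\<iota> z) = z" if "z \<in> ?B" for z
    using r(2) that c by auto
  have inV1: "x \<in> V1" if "x \<in> V" "\<phi> x \<in> ?B" for x
    using inv(2)[OF that(2)] that(1) c by simp
  have hF: "holo (\<lambda>z. f (?\<iota> z)) ?B" if "f \<in> F" for f
    by (rule holo_subset[OF holo_fun_chart[OF c F[OF that]] open_ball r(2)])
  have F0: "f (?\<iota> z) = 0" if f: "f \<in> F" and z: "z \<in> ?B" "\<And>i. i \<in> J \<Longrightarrow> z $ i = 0" for f z
  proof (rule van[OF convex_ball BV hF[OF f] _ _ _ z])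
    fix y assume y: "y \<in> T \<inter> V" "\<phi> y \<in> ?B"
    then have "y \<in> A \<inter> V1" using TS A(1) inV1 by blast
    then show "f (?\<iota> (\<phi> y)) = 0" using A(2) f c y by auto
  qed (use q r in auto)
  have NA: "x \<in> A" if "x \<in> V" "\<phi> x \<in> ?B" "\<And>i. i \<in> J \<Longrightarrow> \<phi> x $ i = 0" for x
  proof -
    have "\<forall>f\<in>F. f x = 0" using F0[of _ "\<phi> x"] that c by auto
    then show ?thesis using inV1[OF that(1,2)] A(2) by blast
  qed
  have not_all: "\<exists>x\<in>V. \<phi> x \<in> ?B \<and> x \<notin> A"
  proof (rule ccontr)
    assume n: "\<not> (\<exists>x\<in>V. \<phi> x \<in> ?B \<and> x \<notin> A)"
    show False
      by (rule codim_two_not_open[OF A(3) chart_preimage_open[OF c open_ball, of "\<phi> q" r], of q]) (use n q r in auto)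
  qed
  \<comment> \<open>By \<open>NA\<close> the subspace cut out by \<open>J\<close> lies in
    \<open>A\<close> near \<open>q\<close>. Without equations \<open>A\<close> would contain an open
    set; with one equation it would be a hypersurface near some point. Both contradict codimension
    2.\<close>
  consider "card J = 0" | "card J = 1" | "2 \<le> card J" by linarith
  then show False
  proof cases
    case 1
    then have "J = {}" using finite_subset[OF subset_UNIV, of J] by simp
    then show False using not_all NA by blast
  next
    case 2
    then obtain j where j: "J = {j}" using card_1_singletonE by blast
    obtain x where x: "x \<in> V" "\<phi> x \<in> ?B" "x \<notin> A" using not_all by blast
    then obtain f where f: "f \<in> F" "f x \<noteq> 0" using inV1[OF x(1,2)] A(2) by blast
    obtain z2 \<rho> where z2: "z2 \<in> ?B" "z2 $ j = 0" "0 < \<rho>" "ball z2 \<rho> \<subseteq> ?B"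
      "\<And>z. z \<in> ball z2 \<rho> \<Longrightarrow> f (?\<iota> z) = 0 \<Longrightarrow> z $ j = 0"
    proof (rule zero_set_near_hyperplane[OF hF[OF f(1)]])
      show "\<phi> q $ j = 0" using J q j by blast
      show "f (?\<iota> z) = 0" if "z \<in> ?B" "z $ j = 0" for z
        using F0[OF f(1) that(1)] that(2) j by blast
      show "f (?\<iota> (\<phi> x)) \<noteq> 0" using f(2) x c by simp
    qed (use x in blast)+
    define V2 where "V2 = {x \<in> V. \<phi> x \<in> ball z2 \<rho>}"
    have c2: "(V2, \<phi>) \<in> charts M"
      by (rule chart_restrict[OF c]) (use chart_preimage_open[OF c open_ball] in \<open>auto simp: V2_def\<close>)
    \<comment> \<open>One inclusion comes from the single function \<open>f\<close>, whose zeros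
      near \<open>z2\<close> lie on the hyperplane, the other from \<open>NA\<close>.\<close>
    have AV2: "A \<inter> V2 = {x \<in> V2. \<phi> x $ j = 0}"
    proof
      show "A \<inter> V2 \<subseteq> {x \<in> V2. \<phi> x $ j = 0}"
      proof
        fix y assume y: "y \<in> A \<inter> V2"
        then have yV: "y \<in> V" "\<phi> y \<in> ball z2 \<rho>" by (auto simp: V2_def)
        then have "y \<in> V1" using inV1 z2(4) by blast
        then have "f y = 0" using y A(2) f(1) by blast
        then have "\<phi> y $ j = 0" using z2(5)[OF yV(2)] c yV(1) by simp
        then show "y \<in> {x \<in> V2. \<phi> x $ j = 0}" using y by blast
      qed
      show "{x \<in> V2. \<phi> x $ j = 0} \<subseteq> A \<inter> V2"
        using NA z2(4) j unfolding V2_def by blast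
    qed
    have pt: "?\<iota> z2 \<in> V2" using inv[OF z2(1)] z2(3) by (simp add: V2_def)
    have "regular_point M A (?\<iota> z2) 1"
      unfolding regular_point_def
    proof (intro conjI bexI[of _ "(V2, \<phi>)"] c2)
      have "\<phi> (?\<iota> z2) $ j = 0" unfolding inv(3)[OF z2(1)] by (rule z2(2))
      then show "?\<iota> z2 \<in> A" using pt AV2 by blast
      show "case (V2, \<phi>) of (V, \<phi>) \<Rightarrow> \<exists>J. ?\<iota> z2 \<in> V \<and> card J = 1 \<and> A \<inter> V = {x \<in> V. \<forall>i\<in>J. \<phi> x $ i = 0}"
        unfolding prod.case by (rule exI[of _ "{j}"]) (simp add: pt AV2)
    qed
    then show False using regular_point_codimension[OF _ A(3)] by fastforce
  next
    case 3
    \<comment> \<open>Two coordinates from \<open>J\<close> suffice: within \<open>V\<close>, the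
      set \<open>T\<close> lies in the subspace where both vanish, which has codimension exactly 2,
      the case settled by \<open>contact_extend_codim_two\<close>.\<close>
    then obtain i k where ik: "i \<in> J" "k \<in> J" "i \<noteq> k"
      by (metis One_nat_def card_le_Suc0_iff_eq finite_code not_less_eq_eq numeral_2_eq_2)
    define Fam where "Fam B a \<longleftrightarrow> (\<exists>W \<alpha>. local_ext W \<alpha> \<and> B = \<phi> ` (V \<inter> W) \<and> a = chart_coeff (V, \<phi>) \<alpha>)" for B a
    have qz: "\<phi> q $ i = 0" "\<phi> q $ k = 0" using J q ik by auto
    obtain V' b where V': "open V'" "\<phi> q \<in> V'" "V' \<subseteq> ?B" and b: "\<And>j. holo (b j) V'" "\<And>z. z \<in> V' \<Longrightarrow> vol_coeff n b z = 1"
      and par: "\<And>B a z. Fam B a \<Longrightarrow> z \<in> B \<Longrightarrow> z \<in> V' \<Longrightarrow> \<exists>c. \<forall>j. b j z = c * a j z"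
    proof (rule contact_extend_codim_two[OF card ik(3), where U = ?B and ?z0.0 = "\<phi> q" and Fam = Fam])
      show "open ?B" "\<phi> q \<in> ?B" using r by auto
    next
      fix B a assume "Fam B a"
      then obtain W \<alpha> where W: "local_ext W \<alpha>" "B = \<phi> ` (V \<inter> W)" "a = chart_coeff (V, \<phi>) \<alpha>" by (auto simp: Fam_def)
      have "\<exists>v. contact_form n a z v \<noteq> 0" if "z \<in> B" for z
      proof -
        obtain x where x: "x \<in> V" "x \<in> W" "z = \<phi> x" using \<open>z \<in> B\<close> W(2) by blast
        have "contact_at M n \<alpha> x" using W(1) x by (simp add: local_ext_def)
        then show ?thesis using contact_at_iff[OF local_ext_form[OF W(1)] c x(1,2)] W(3) x(3) by blast
      qed
      then show "open B \<and> (\<forall>j. holo (a j) B) \<and> (\<forall>z\<in>B. \<exists>v. contact_form n a z v \<noteq> 0)"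
        using holo_chart_coeff[OF local_ext_form[OF W(1)] c] holo_open W by blast
    next
      fix B a B' a' z assume "Fam B a" "Fam B' a'" "z \<in> B" "z \<in> B'"
      then obtain W \<alpha> W' \<alpha>' where W: "local_ext W \<alpha>" "local_ext W' \<alpha>'" "z \<in> \<phi> ` (V \<inter> W)" "z \<in> \<phi> ` (V \<inter> W')"
        and a: "a = chart_coeff (V, \<phi>) \<alpha>" "a' = chart_coeff (V, \<phi>) \<alpha>'" unfolding Fam_def by blast
      then obtain x where x: "x \<in> V" "x \<in> W" "x \<in> W'" "z = \<phi> x" using chart_inj[OF c] by (auto dest: inj_onD)
      show "\<exists>c. \<forall>j. a' j z = c * a j z"
        unfolding a x(4) by (rule local_ext_proportional[OF W(1,2) c x(1-3)])
    next
      fix z assume z: "z \<in> ?B" "\<not> (z $ i = \<phi> q $ i \<and> z $ k = \<phi> q $ k)"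
      \<comment> \<open>Local extensions are available off \<open>T\<close>, not merely off
        \<open>S\<close>; this is what lets the subspace take the place of \<open>S\<close>.\<close>
      have "?\<iota> z \<notin> T" using J[of "?\<iota> z"] ik inv[OF z(1)] z(2) qz by force
      moreover have "?\<iota> z \<in> points M" using inv(1)[OF z(1)] chart_openin[OF c] openin_subset by blast
      ultimately obtain W \<alpha> where "local_ext W \<alpha>" "?\<iota> z \<in> W" by (auto simp: T_def)
      then have "Fam (\<phi> ` (V \<inter> W)) (chart_coeff (V, \<phi>) \<alpha>)" "z \<in> \<phi> ` (V \<inter> W)"
        using inv[OF z(1)] by (auto simp: Fam_def image_iff intro!: bexI[of _ "?\<iota> z"])
      then show "\<exists>B a. Fam B a \<and> z \<in> B" by blast
    qed blast
    define W where "W = {x \<in> V. \<phi> x \<in> V'}"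
    have W: "openin (top_of M) W" "W \<subseteq> V" using chart_preimage_open[OF c V'(1)] by (auto simp: W_def)
    have im: "\<phi> ` W = V'" using V'(3) BV by (auto simp: W_def)
    have hbW: "holo (b i) (\<phi> ` W)" for i unfolding im by (rule b(1))
    obtain \<beta> where \<beta>: "holo_one_form M W \<beta>" "\<And>x i. x \<in> W \<Longrightarrow> coeff M (V, \<phi>) \<beta> i x = b i (\<phi> x)"
      by (rule one_form_of_coeffs[where a = b, OF c W hbW]) (rule that)
    have \<beta>b: "chart_coeff (V, \<phi>) \<beta> i z = b i z" if t: "z \<in> V'" for i z
    proof -
      obtain x where x: "x \<in> W" "z = \<phi> x" using im t by blast
      then show ?thesis using \<beta>(2) chart_coeff_at[OF c] W(2) by auto
    qed
    have "local_ext W \<beta>"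
      unfolding local_ext_def
    proof (intro conjI ballI \<beta>(1))
      fix x assume x: "x \<in> W"
      then have xV: "x \<in> V" "\<phi> x \<in> V'" by (auto simp: W_def)
      have "contact_form n (chart_coeff (V, \<phi>) \<beta>) (\<phi> x) = contact_form n b (\<phi> x)"
        by (rule contact_form_cong_open[OF V'(1) xV(2)]) (rule \<beta>b)
      then have "contact_form n (chart_coeff (V, \<phi>) \<beta>) (\<phi> x) (\<lambda>i. axis (coord_enum i) 1) \<noteq> 0" using b(2)[OF xV(2)] by (simp add: vol_coeff_def)
      then show "contact_at M n \<beta> x" using contact_at_iff[OF \<beta>(1) c xV(1) x] by blast
    next
      fix x assume x: "x \<in> W - S"
      then have xV: "x \<in> V" "\<phi> x \<in> V'" by (auto simp: W_def)
      have xp: "x \<in> points M - S" using x W(1) openin_subset by blast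
      then obtain W0 \<alpha>0 where W0: "local_ext W0 \<alpha>0" "x \<in> W0" using local_ext_regular by blast
      have "Fam (\<phi> ` (V \<inter> W0)) (chart_coeff (V, \<phi>) \<alpha>0)" using W0 by (auto simp: Fam_def)
      then obtain d where "\<forall>j. b j (\<phi> x) = d * chart_coeff (V, \<phi>) \<alpha>0 j (\<phi> x)" using par[of _ _ "\<phi> x"] xV W0(2) by blast
      then have "\<beta> x = (\<lambda>v. d * \<alpha>0 x v)"
        using \<beta>b[OF xV(2)] x
        by (intro proportional_covector[where \<alpha> = \<alpha>0 and \<beta> = \<beta>, OF c xV(1) one_form_cotangent[OF local_ext_form[OF W0(1)] W0(2)] one_form_cotangent[OF \<beta>(1)]]) auto
      moreover have "(x, \<alpha>0 x) \<in> L" using W0 x by (simp add: local_ext_def)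
      ultimately show "(x, \<beta> x) \<in> L" using L_scale[OF _ xp] by metis
    qed
    moreover have "q \<in> W" using q V'(2) by (simp add: W_def)
    ultimately show False using q(1) by (auto simp: T_def)
  qed
qed

text \<open>The lines spanned by all local extensions; that they fit together is
  \<open>local_ext_parallel\<close>.\<close>

definition L' :: "('a \<times> 'a covec) set" where
  "L' = {(p, \<xi>). \<exists>W \<alpha> k. local_ext W \<alpha> \<and> p \<in> W \<and> \<xi> = (\<lambda>v. k * \<alpha> p v)}"

lemma L'_fibre:
  assumes \<alpha>: "local_ext W \<alpha>" and q: "q \<in> W"
  shows "{\<xi>. (q, \<xi>) \<in> L'} = {(\<lambda>v. c * \<alpha> q v) |c. True}"
proof
  show "{(\<lambda>v. c * \<alpha> q v) |c. True} \<subseteq> {\<xi>. (q, \<xi>) \<in> L'}" using assms by (auto simp: L'_def)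
  show "{\<xi>. (q, \<xi>) \<in> L'} \<subseteq> {(\<lambda>v. c * \<alpha> q v) |c. True}"
  proof
    fix \<xi> assume "\<xi> \<in> {\<xi>. (q, \<xi>) \<in> L'}"
    then obtain W' \<beta> k where \<beta>: "local_ext W' \<beta>" "q \<in> W'" "\<xi> = (\<lambda>v. k * \<beta> q v)" by (auto simp: L'_def)
    then obtain l where "\<beta> q = (\<lambda>v. l * \<alpha> q v)" using local_ext_parallel[OF \<alpha> \<beta>(1) q] by blast
    then have "\<xi> = (\<lambda>v. (k * l) * \<alpha> q v)" using \<beta>(3) by (simp add: mult.assoc)
    then show "\<xi> \<in> {(\<lambda>v. c * \<alpha> q v) |c. True}" by blast
  qed
qed

lemma local_ext_nonvanishing: "local_ext W \<alpha> \<Longrightarrow> q \<in> W \<Longrightarrow> \<alpha> q \<noteq> (\<lambda>v. 0)"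
proof
  assume \<alpha>: "local_ext W \<alpha>" and q: "q \<in> W" and 0: "\<alpha> q = (\<lambda>v. 0)"
  have "q \<in> points M" using one_form_openin[OF local_ext_form[OF \<alpha>]] q openin_subset by blast
  then obtain V \<phi> where c: "(V, \<phi>) \<in> charts M" and qV: "q \<in> V" using chart_at by blast
  show False using local_ext_nonzero[OF \<alpha> c qV q] 0 chart_coeff_at[OF c qV] by (simp add: coeff_def)
qed

lemma L'_hyperplane_field: "hyperplane_field M L'"
  unfolding hyperplane_field_def
proof (intro conjI ballI)
  show "L' \<subseteq> cotangent_bundle M"
    unfolding L'_def cotangent_bundle_def
    using cotangent_scale one_form_cotangent local_ext_form one_form_openin openin_subset by fastforce
  fix p assume "p \<in> points M"
  then obtain W \<alpha> where \<alpha>: "local_ext W \<alpha>" "p \<in> W" using local_ext_everywhere by blast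
  have "(q, \<alpha> q) \<in> L'" if "q \<in> W" for q
    using \<alpha>(1) that by (auto simp: L'_def intro!: exI[of _ W] exI[of _ \<alpha>] exI[of _ 1])
  then have "nonvanishing_section M L' W \<alpha>"
    using local_ext_form[OF \<alpha>(1)] local_ext_nonvanishing[OF \<alpha>(1)] by (auto simp: nonvanishing_section_def)
  then show "\<exists>W \<alpha>. p \<in> W \<and> nonvanishing_section M L' W \<alpha> \<and> (\<forall>q\<in>W. {\<xi>. (q, \<xi>) \<in> L'} = {(\<lambda>v. c * \<alpha> q v) |c. True})"
    using \<alpha> L'_fibre by blast
qed

text \<open>Near \<open>p\<close> any section is a multiple \<open>h \<alpha>\<close> of a local
  extension, with \<open>h\<close> complex differentiable and nonzero at \<open>p\<close>, so the
  scaling law transfers the contact condition.\<close>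

lemma L'_contact:
  assumes \<beta>: "nonvanishing_section M L' W \<beta>" and p: "p \<in> W"
  shows "contact_at M n \<beta> p"
proof -
  have fb: "holo_one_form M W \<beta>" using \<beta> by (simp add: nonvanishing_section_def)
  have pM: "p \<in> points M" using one_form_openin[OF fb] p openin_subset by blast
  then obtain W' \<alpha> where \<alpha>: "local_ext W' \<alpha>" "p \<in> W'" using local_ext_everywhere by blast
  note fa = local_ext_form[OF \<alpha>(1)]
  obtain V \<phi> where c: "(V, \<phi>) \<in> charts M" and pV: "p \<in> V" using chart_at[OF pM] by blast
  let ?a = "chart_coeff (V, \<phi>) \<alpha>" and ?b = "chart_coeff (V, \<phi>) \<beta>"
  let ?B = "\<phi> ` (V \<inter> W \<inter> W')"
  have op: "openin (top_of M) (V \<inter> W \<inter> W')"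
    using chart_openin[OF c] one_form_openin[OF fa] one_form_openin[OF fb] by blast
  have oB: "open ?B" by (rule chart_image_open[OF c op]) auto
  have ha: "holo (?a i) ?B" for i by (rule holo_subset[OF holo_chart_coeff[OF fa c] oB]) auto
  have hb: "holo (?b i) ?B" for i by (rule holo_subset[OF holo_chart_coeff[OF fb c] oB]) auto
  have par: "\<exists>k. (\<forall>j. ?b j (\<phi> x) = k * ?a j (\<phi> x)) \<and> \<beta> x = (\<lambda>v. k * \<alpha> x v)" if x: "x \<in> V" "x \<in> W" "x \<in> W'" for x
  proof -
    have "(x, \<beta> x) \<in> L'" using \<beta> x by (simp add: nonvanishing_section_def)
    then obtain k where k: "\<beta> x = (\<lambda>v. k * \<alpha> x v)" using L'_fibre[OF \<alpha>(1) x(3)] by blast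
    then show ?thesis using chart_coeff_at[OF c x(1)] by (auto simp: coeff_def)
  qed
  obtain i where i: "?a i (\<phi> p) \<noteq> 0" using local_ext_nonzero[OF \<alpha>(1) c pV \<alpha>(2)] by blast
  define R where "R = ?B \<inter> ?a i -` (- {0})"
  have "open R" unfolding R_def by (rule continuous_open_preimage[OF holo_continuous_on[OF ha] oB]) auto
  have pR: "\<phi> p \<in> R" using pV p \<alpha>(2) i by (simp add: R_def)
  \<comment> \<open>The factors from \<open>L'_fibre\<close> are chosen point by point; dividing by
    a coefficient of \<open>\<alpha>\<close> that is nonzero near \<open>p\<close> exhibits them as
    a complex differentiable function.\<close>
  define h where "h z = ?b i z / ?a i z" for z
  have eq: "?b j z = h z * ?a j z" if t: "z \<in> R" for j z
  proof -
    obtain x where x: "x \<in> V" "x \<in> W" "x \<in> W'" "z = \<phi> x" using t by (auto simp: R_def)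
    obtain k where "\<forall>j. ?b j z = k * ?a j z" using par[OF x(1-3)] x(4) by blast
    then show ?thesis using t by (simp add: h_def R_def)
  qed
  have pB: "\<phi> p \<in> ?B" using pR by (simp add: R_def)
  have cdh: "cdiff h (\<phi> p)"
    unfolding h_def by (rule cdiff_divide[OF holoD[OF hb pB] holoD[OF ha pB] i])
  have contact_form: "contact_form n ?b (\<phi> p) x = h (\<phi> p) ^ (n + 1) * contact_form n ?a (\<phi> p) x" for x
  proof -
    have "contact_form n ?b (\<phi> p) = contact_form n (\<lambda>j z. h z * ?a j z) (\<phi> p)" by (rule contact_form_cong_open[OF \<open>open R\<close> pR eq])
    then show ?thesis using contact_form_scale[OF cdh holoD[OF ha pB]] by simp
  qed
  have "h (\<phi> p) \<noteq> 0"
  proof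
    assume h0: "h (\<phi> p) = 0"
    obtain k where k: "\<forall>j. ?b j (\<phi> p) = k * ?a j (\<phi> p)" "\<beta> p = (\<lambda>v. k * \<alpha> p v)"
      using par[OF pV p \<alpha>(2)] by blast
    have "k = 0" using k(1) eq[OF pR, of i] h0 i by simp
    then have "\<beta> p = (\<lambda>v. 0)" using k(2) by simp
    then show False using \<beta> p by (simp add: nonvanishing_section_def)
  qed
  moreover have "contact_at M n \<alpha> p" using \<alpha> by (simp add: local_ext_def)
  then obtain x where "contact_form n ?a (\<phi> p) x \<noteq> 0"
    using contact_at_iff[OF fa c pV \<alpha>(2)] by blast
  ultimately have "contact_form n ?b (\<phi> p) x \<noteq> 0" using contact_form by simp
  then show ?thesis using contact_at_iff[OF fb c pV p] by blast
qed

lemma L'_restrict: "restrict_bundle L' (points M - S) = L"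
proof
  show "restrict_bundle L' (points M - S) \<subseteq> L"
  proof
    fix x assume "x \<in> restrict_bundle L' (points M - S)"
    then obtain p W \<alpha> k where "local_ext W \<alpha>" "p \<in> W" "p \<in> points M - S" "x = (p, \<lambda>v. k * \<alpha> p v)"
      by (auto simp: restrict_bundle_def L'_def)
    then show "x \<in> L" using L_scale by (auto simp: local_ext_def)
  qed
  show "L \<subseteq> restrict_bundle L' (points M - S)"
  proof
    fix x assume x: "x \<in> L"
    obtain p \<xi> where p: "x = (p, \<xi>)" by (cases x)
    have "L \<subseteq> cotangent_bundle (open_submanifold M (points M - S))"
      using contact by (simp add: contact_structure_def hyperplane_field_def)
    then have pp: "p \<in> points M - S" using x p by (auto simp: cotangent_bundle_def open_submanifold_def)
    then obtain W \<alpha> where \<alpha>: "local_ext W \<alpha>" "p \<in> W" using local_ext_regular by blast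
    obtain v where "\<alpha> p v \<noteq> 0" using local_ext_nonvanishing[OF \<alpha>] by fastforce
    moreover have "(p, \<alpha> p) \<in> L" using \<alpha> pp by (simp add: local_ext_def)
    ultimately obtain k where "\<xi> = (\<lambda>v. k * \<alpha> p v)" using L_parallel[OF _ _ pp] x p by metis
    then show "x \<in> restrict_bundle L' (points M - S)"
      using \<alpha> pp p by (auto simp: restrict_bundle_def L'_def)
  qed
qed

end

theorem theorem5p9:
  fixes M :: "('a, 'm::finite) cmfd" and n :: nat and S :: "'a set"
    and L :: "('a \<times> 'a covec) set"
  assumes "complex_manifold M" and "CARD('m) = 2 * n + 1"
    and "closedin (top_of M) S" and "codim_two_or_more M S"
    and "contact_structure (open_submanifold M (points M - S)) n L"
  shows "contact_extends M n S L"
proof -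
  interpret contact_off_thin M n S L
    by unfold_locales (rule assms)+
  have "contact_structure M n L'"
    unfolding contact_structure_def using assms(2) L'_hyperplane_field L'_contact by blast
  then show ?thesis unfolding contact_extends_def using L'_restrict by blast
qed

end
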